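(* Let $A$ be an $N$-interior $G$-algebra, let $T=\{\varphi\in\mathrm{Aut}_G(P)\mid\varphi(u)u^{-1}\in N\ \forall u\in P\}$ and let $E=A\otimes_N N_G^T(P)N$. Then $$\overline{N}_E^T(P)=\overline{N}_A^T(P)\otimes_{N_N^T(P)}N_G^T(P)$$ as $N_G^T(P)$-interior $N_G(P)$-algebras (i.e. the two sides are isomorphic as $N_G^T(P)$-interior $N_G(P)$-algebras).
   Context: Throughout, $p$ is a prime, $k$ is an algebraically closed field of characteristic $p$ (the residue field of a discrete valuation ring $\mathcal O$), $G$ is a finite group, $N$ is a normal subgroup of $G$, and $P$ is a $p$-subgroup of $G$. All algebras and modules are finitely generated. For a normal subgroup $M$ of a group $L$, an $M$-interior $L$-algebra is a $k$-algebra $A$ with group homomorphisms $\alpha:M\to A^\times$ and $L\to\mathrm{Aut}_k(A)$, $g\mapsto(a\mapsto{}^ga)$, such that ${}^na=\alpha(n)a\alpha(n)^{-1}$ and ${}^g\alpha(n)=\alpha(gng^{-1})$ for $n\in M$, $g\in L$, $a\in A$. We write $na=\alpha(n)a$. Homomorphisms of such algebras are algebra homomorphisms compatible with the structure maps from $M$ and the $L$-actions. $\mathrm{Aut}_G(P)$ is the group of automorphisms of $P$ induced by conjugation with elements of $G$ (normalizing $P$). $T$ is a subgroup of $\mathrm{Aut}(P)$. $N_G^T(P)$ is the inverse image of $T$ under the canonical map $N_G(P)\to\mathrm{Aut}(P)$, and $N_N^T(P)=N\cap N_G^T(P)$. If $A$ is an $M$-interior $L$-algebra and $M\le X\le L$,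 then $A\otimes_M X=A\otimes_{kM}kX$ is the $k$-algebra with product $(a\otimes x)(b\otimes y)=a\,{}^xb\otimes xy$; it is interior via $X\ni x\mapsto 1\otimes x$, and any $g\in L$ normalizing $X$ acts by ${}^g(a\otimes x)={}^ga\otimes gxg^{-1}$. Thus $E$ is $N_G^T(P)N$-interior (in particular $N_G^T(P)$-interior and $N$-interior) and is an $N_G(P)$-algebra; and $\overline N_A^T(P)\otimes_{N_N^T(P)}N_G^T(P)$ is an $N_G^T(P)$-interior $N_G(P)$-algebra. Extended Brauer quotient: let $B$ be $A$ or $E$. For $\varphi\in T$ and $R\le P$ put $\Delta_\varphi(R)=\{(\varphi(u),u)\mid u\in R\}$. $\Delta_\varphi(P)$ acts on $B$ by $(\varphi(u),u)b=\varphi(u)u^{-1}\,{}^ub$ (note $\varphi(u)u^{-1}\in N$). Put $N_B^\varphi(R)=B^{\Delta_\varphi(R)}$ (fixed elements); for $c\in N_B^\varphi(R)$ let $\mathrm{Tr}_{\Delta_\varphi(R)}^{\Delta_\varphi(P)}(c)=\sum_{u\in[P/R]}\varphi(u)u^{-1}\,{}^uc$. Let $\mathrm{Br}^B_{\Delta_\varphi(P)}$ be the canonical surjection of $N_B^\varphi(P)$ onto $N_B^\varphi(P)/\sum_{R<P}\mathrm{Tr}_{\Delta_\varphi(R)}^{\Delta_\varphi(P)}(N_B^\varphi(R))$. The external direct sum $N_B^T(P)=\bigoplus_{\varphi\in T}N_B^\varphi(P)$ is a $k$-algebra via the multiplication of $B$, with $N_B^\psi(P)N_B^\varphi(P)\subseteq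 N_B^{\psi\circ\varphi}(P)$. $N_G(P)$ acts on it by $b\mapsto{}^xb$, sending the $\varphi$-component to the ${}^x\varphi$-component, where ${}^x\varphi(u)=x\varphi(x^{-1}ux)x^{-1}$. Then $$\overline N_B^T(P)=N_B^T(P)\Big/\bigoplus_{\varphi\in T}\mathrm{Ker}(\mathrm{Br}^B_{\Delta_\varphi(P)}).$$ The interior structures are: $n\in N_N^T(P)$ maps to the class of $\alpha(n)$ in the component of $\overline N_A^T(P)$ indexed by conjugation by $n$, and $g\in N_G^T(P)$ maps to the class of $1\otimes g$ in the component of $\overline N_E^T(P)$ indexed by conjugation $u\mapsto gug^{-1}$. *)

theory Defs
  imports "HOL-Algebra.Algebra" "HOL-Computational_Algebra.Primes"
begin

section \<open>Interior algebras\<close>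

text \<open>
  The HOL-Algebra locale \<^locale>\<open>algebra\<close> is for commutative algebras only; the algebras here
  are associative and unital, but not commutative in general.
\<close>

definition assoc_algebra ::
    "('k, 'm) ring_scheme \<Rightarrow> ('k, 'a, 'n) module_scheme \<Rightarrow> bool" where
  "assoc_algebra K A \<longleftrightarrow> ring A \<and> module K A \<and>
     (\<forall>c \<in> carrier K. \<forall>x \<in> carrier A. \<forall>y \<in> carrier A.
        (c \<odot>\<^bsub>A\<^esub> x) \<otimes>\<^bsub>A\<^esub> y = c \<odot>\<^bsub>A\<^esub> (x \<otimes>\<^bsub>A\<^esub> y) \<and> x \<otimes>\<^bsub>A\<^esub> (c \<odot>\<^bsub>A\<^esub> y) = c \<odot>\<^bsub>A\<^esub> (x \<otimes>\<^bsub>A\<^esub> y))"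

definition fin_gen_module ::
    "('k, 'm) ring_scheme \<Rightarrow> ('k, 'a, 'n) module_scheme \<Rightarrow> bool" where
  "fin_gen_module K A \<longleftrightarrow> (\<exists>S. finite S \<and> S \<subseteq> carrier A \<and>
     (\<forall>x \<in> carrier A. \<exists>c \<in> S \<rightarrow> carrier K. x = (\<Oplus>\<^bsub>A\<^esub>s\<in>S. c s \<odot>\<^bsub>A\<^esub> s)))"

text \<open>
  \<open>emb\<close> is the structure map \<open>\<alpha>\<close> and \<open>act g a\<close> is \<open>\<^sup>ga\<close>. Both are total functions on the
  ambient group; only their values on \<open>M\<close> and on \<open>L\<close> matter for an \<open>M\<close>-interior \<open>L\<close>-algebra,
  so one record may carry several such structures, for different \<open>M\<close> and \<open>L\<close>.
\<close>

record ('k, 'a, 'g) interior_alg = "('k, 'a) module" +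
  emb :: "'g \<Rightarrow> 'a"
  act :: "'g \<Rightarrow> 'a \<Rightarrow> 'a"

definition interior_algebra ::
    "('k, 'm) ring_scheme \<Rightarrow> ('g, 'n) monoid_scheme \<Rightarrow> 'g set \<Rightarrow> 'g set
      \<Rightarrow> ('k, 'a, 'g) interior_alg \<Rightarrow> bool" where
  "interior_algebra K G M L A \<longleftrightarrow>
     subgroup L G \<and> M \<lhd> G\<lparr>carrier := L\<rparr> \<and> assoc_algebra K A \<and>
     emb A \<in> hom (G\<lparr>carrier := M\<rparr>) (units_of A) \<and>
     group_action (G\<lparr>carrier := L\<rparr>) (carrier A) (\<lambda>g. restrict (act A g) (carrier A)) \<and>
     (\<forall>g \<in> L. act A g \<in> ring_hom A A \<and>
        (\<forall>c \<in> carrier K. \<forall>a \<in> carrier A. act A g (c \<odot>\<^bsub>A\<^esub> a) = c \<odot>\<^bsub>A\<^esub> act A g a)) \<and>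
     (\<forall>n \<in> M. \<forall>a \<in> carrier A. act A n a = emb A n \<otimes>\<^bsub>A\<^esub> a \<otimes>\<^bsub>A\<^esub> inv\<^bsub>A\<^esub> (emb A n)) \<and>
     (\<forall>g \<in> L. \<forall>n \<in> M. act A g (emb A n) = emb A (g \<otimes>\<^bsub>G\<^esub> n \<otimes>\<^bsub>G\<^esub> inv\<^bsub>G\<^esub> g))"

definition interior_iso ::
    "('k, 'm) ring_scheme \<Rightarrow> 'g set \<Rightarrow> 'g set
      \<Rightarrow> ('k, 'a, 'g) interior_alg \<Rightarrow> ('k, 'b, 'g) interior_alg \<Rightarrow> ('a \<Rightarrow> 'b) set" where
  "interior_iso K M L A B = {h \<in> ring_iso A B.
     (\<forall>c \<in> carrier K. \<forall>a \<in> carrier A. h (c \<odot>\<^bsub>A\<^esub> a) = c \<odot>\<^bsub>B\<^esub> h a) \<and>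
     (\<forall>n \<in> M. h (emb A n) = emb B n) \<and>
     (\<forall>g \<in> L. \<forall>a \<in> carrier A. h (act A g a) = act B g (h a))}"

definition isomorphic_interior_algebras ::
    "('k, 'm) ring_scheme \<Rightarrow> ('g, 'n) monoid_scheme \<Rightarrow> 'g set \<Rightarrow> 'g set
      \<Rightarrow> ('k, 'a, 'g) interior_alg \<Rightarrow> ('k, 'b, 'g) interior_alg \<Rightarrow> bool" where
  "isomorphic_interior_algebras K G M L A B \<longleftrightarrow>
     interior_algebra K G M L A \<and> interior_algebra K G M L B \<and> interior_iso K M L A B \<noteq> {}"

definition quot_alg :: "('k, 'a, 'g) interior_alg \<Rightarrow> 'a set \<Rightarrow> ('k, 'a set, 'g) interior_alg" where
  "quot_alg A I =
     \<lparr>carrier = carrier (A Quot I), monoid.mult = monoid.mult (A Quot I),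
      one = one (A Quot I), ring.zero = ring.zero (A Quot I), add = add (A Quot I),
      smult = \<lambda>c C. \<Union>a\<in>C. I +>\<^bsub>A\<^esub> (c \<odot>\<^bsub>A\<^esub> a),
      emb = \<lambda>g. I +>\<^bsub>A\<^esub> emb A g,
      act = \<lambda>g C. \<Union>a\<in>C. I +>\<^bsub>A\<^esub> act A g a\<rparr>"


section \<open>The algebra \<open>A \<otimes>\<^bsub>kM\<^esub> kH\<close>\<close>

text \<open>
  As \<open>kH\<close> has the basis \<open>H\<close>, the space \<open>A \<otimes>\<^bsub>k\<^esub> kH\<close> is the direct sum of the \<open>A \<otimes> x\<close>, \<open>x \<in> H\<close>;
  the function \<open>f\<close> on \<open>H\<close> stands for the sum of the \<open>f x \<otimes> x\<close> (\<open>H\<close> is finite). The product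
  extends \<open>(a \<otimes> x)(b \<otimes> y) = a \<^sup>xb \<otimes> xy\<close>. Then \<open>A \<otimes>\<^bsub>kM\<^esub> kH\<close> is the quotient by the subgroup
  generated by all \<open>an \<otimes> x - a \<otimes> nx\<close> with \<open>n \<in> M\<close>;
  by linearity, this is a subspace and contains the corresponding elements for all of \<open>kM\<close>.
\<close>

definition pure_tensor :: "('k, 'a, 'g) interior_alg \<Rightarrow> 'g set \<Rightarrow> 'a \<Rightarrow> 'g \<Rightarrow> 'g \<Rightarrow> 'a" where
  "pure_tensor A H a x = (\<lambda>z\<in>H. if z = x then a else \<zero>\<^bsub>A\<^esub>)"

definition tensor_over_field ::
    "('g, 'n) monoid_scheme \<Rightarrow> ('k, 'a, 'g) interior_alg \<Rightarrow> 'g set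
      \<Rightarrow> ('k, 'g \<Rightarrow> 'a, 'g) interior_alg" where
  "tensor_over_field G A H =
     \<lparr>carrier = H \<rightarrow>\<^sub>E carrier A,
      monoid.mult = \<lambda>f f'. \<lambda>z\<in>H. \<Oplus>\<^bsub>A\<^esub>x\<in>H. f x \<otimes>\<^bsub>A\<^esub> act A x (f' (inv\<^bsub>G\<^esub> x \<otimes>\<^bsub>G\<^esub> z)),
      one = pure_tensor A H \<one>\<^bsub>A\<^esub> \<one>\<^bsub>G\<^esub>,
      ring.zero = \<lambda>z\<in>H. \<zero>\<^bsub>A\<^esub>,
      add = \<lambda>f f'. \<lambda>z\<in>H. f z \<oplus>\<^bsub>A\<^esub> f' z,
      smult = \<lambda>c f. \<lambda>z\<in>H. c \<odot>\<^bsub>A\<^esub> f z,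
      emb = \<lambda>x. pure_tensor A H \<one>\<^bsub>A\<^esub> x,
      act = \<lambda>g f. \<lambda>z\<in>H. act A g (f (inv\<^bsub>G\<^esub> g \<otimes>\<^bsub>G\<^esub> z \<otimes>\<^bsub>G\<^esub> g))\<rparr>"

definition balancing ::
    "('g, 'n) monoid_scheme \<Rightarrow> ('k, 'a, 'g) interior_alg \<Rightarrow> 'g set \<Rightarrow> 'g set \<Rightarrow> ('g \<Rightarrow> 'a) set" where
  "balancing G A M H = generate (add_monoid (tensor_over_field G A H))
     {pure_tensor A H (a \<otimes>\<^bsub>A\<^esub> emb A n) x \<ominus>\<^bsub>tensor_over_field G A H\<^esub> pure_tensor A H a (n \<otimes>\<^bsub>G\<^esub> x)
       | a n x. a \<in> carrier A \<and> n \<in> M \<and> x \<in> H}"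

definition tensor_over_group ::
    "('g, 'n) monoid_scheme \<Rightarrow> ('k, 'a, 'g) interior_alg \<Rightarrow> 'g set \<Rightarrow> 'g set
      \<Rightarrow> ('k, ('g \<Rightarrow> 'a) set, 'g) interior_alg" where
  "tensor_over_group G A M H = quot_alg (tensor_over_field G A H) (balancing G A M H)"


section \<open>Automorphisms of \<open>P\<close> and the extended Brauer quotient\<close>

text \<open>
  Automorphisms of \<open>P\<close> are extensional functions on \<open>P\<close>, as in \<^const>\<open>auto\<close> and
  \<^const>\<open>BijGroup\<close>; their product is \<^const>\<open>compose\<close>.
\<close>

definition conj_on :: "('g, 'n) monoid_scheme \<Rightarrow> 'g set \<Rightarrow> 'g \<Rightarrow> 'g \<Rightarrow> 'g" where
  "conj_on G P g = (\<lambda>u\<in>P. g \<otimes>\<^bsub>G\<^esub> u \<otimes>\<^bsub>G\<^esub> inv\<^bsub>G\<^esub> g)"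

definition Aut_by :: "('g, 'n) monoid_scheme \<Rightarrow> 'g set \<Rightarrow> ('g \<Rightarrow> 'g) set" where
  "Aut_by G P = conj_on G P ` normalizer G P"

definition normalizer_T ::
    "('g, 'n) monoid_scheme \<Rightarrow> 'g set \<Rightarrow> ('g \<Rightarrow> 'g) set \<Rightarrow> 'g set" where
  "normalizer_T G P T = {g \<in> normalizer G P. conj_on G P g \<in> T}"

definition conj_aut :: "('g, 'n) monoid_scheme \<Rightarrow> 'g set \<Rightarrow> 'g \<Rightarrow> ('g \<Rightarrow> 'g) \<Rightarrow> 'g \<Rightarrow> 'g" where
  "conj_aut G P x \<phi> = (\<lambda>u\<in>P. x \<otimes>\<^bsub>G\<^esub> \<phi> (inv\<^bsub>G\<^esub> x \<otimes>\<^bsub>G\<^esub> u \<otimes>\<^bsub>G\<^esub> x) \<otimes>\<^bsub>G\<^esub> inv\<^bsub>G\<^esub> x)"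

text \<open>The action of \<open>(\<phi> u, u) \<in> \<Delta>\<^sub>\<phi>(P)\<close> on \<open>B\<close>:\<close>

definition Delta_act ::
    "('g, 'n) monoid_scheme \<Rightarrow> ('k, 'a, 'g) interior_alg \<Rightarrow> ('g \<Rightarrow> 'g) \<Rightarrow> 'g \<Rightarrow> 'a \<Rightarrow> 'a" where
  "Delta_act G B \<phi> u b = emb B (\<phi> u \<otimes>\<^bsub>G\<^esub> inv\<^bsub>G\<^esub> u) \<otimes>\<^bsub>B\<^esub> act B u b"

definition Delta_fixed ::
    "('g, 'n) monoid_scheme \<Rightarrow> ('k, 'a, 'g) interior_alg \<Rightarrow> ('g \<Rightarrow> 'g) \<Rightarrow> 'g set \<Rightarrow> 'a set" where
  "Delta_fixed G B \<phi> R = {b \<in> carrier B. \<forall>u\<in>R. Delta_act G B \<phi> u b = b}"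

text \<open>
  The choice of the representative of a coset does not matter, as the trace is only used for
  \<open>c \<in> Delta_fixed G B \<phi> R\<close>.
\<close>

definition Delta_trace ::
    "('g, 'n) monoid_scheme \<Rightarrow> ('k, 'a, 'g) interior_alg \<Rightarrow> 'g set \<Rightarrow> ('g \<Rightarrow> 'g) \<Rightarrow> 'g set
      \<Rightarrow> 'a \<Rightarrow> 'a" where
  "Delta_trace G B P \<phi> R c =
     (\<Oplus>\<^bsub>B\<^esub>C\<in>lcosets\<^bsub>G\<lparr>carrier := P\<rparr>\<^esub> R. Delta_act G B \<phi> (SOME u. u \<in> C) c)"

definition Brauer_kernel ::
    "('g, 'n) monoid_scheme \<Rightarrow> ('k, 'a, 'g) interior_alg \<Rightarrow> 'g set \<Rightarrow> ('g \<Rightarrow> 'g) \<Rightarrow> 'a set" where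
  "Brauer_kernel G B P \<phi> = generate (add_monoid B)
     (\<Union>R\<in>{R. subgroup R G \<and> R \<subset> P}. Delta_trace G B P \<phi> R ` Delta_fixed G B \<phi> R)"

text \<open>
  The direct sum over the finite set \<open>T\<close> consists of the families indexed by \<open>T\<close>.
\<close>

definition Brauer_sum ::
    "('g, 'n) monoid_scheme \<Rightarrow> ('k, 'a, 'g) interior_alg \<Rightarrow> 'g set \<Rightarrow> ('g \<Rightarrow> 'g) set
      \<Rightarrow> ('k, ('g \<Rightarrow> 'g) \<Rightarrow> 'a, 'g) interior_alg" where
  "Brauer_sum G B P T =
     \<lparr>carrier = (\<Pi>\<^sub>E \<phi>\<in>T. Delta_fixed G B \<phi> P),
      monoid.mult = \<lambda>f f'. \<lambda>\<chi>\<in>T. finsum B (\<lambda>(\<psi>, \<phi>). f \<psi> \<otimes>\<^bsub>B\<^esub> f' \<phi>)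
        {(\<psi>, \<phi>) \<in> T \<times> T. compose P \<psi> \<phi> = \<chi>},
      one = \<lambda>\<chi>\<in>T. if \<chi> = (\<lambda>u\<in>P. u) then \<one>\<^bsub>B\<^esub> else \<zero>\<^bsub>B\<^esub>,
      ring.zero = \<lambda>\<chi>\<in>T. \<zero>\<^bsub>B\<^esub>,
      add = \<lambda>f f'. \<lambda>\<chi>\<in>T. f \<chi> \<oplus>\<^bsub>B\<^esub> f' \<chi>,
      smult = \<lambda>c f. \<lambda>\<chi>\<in>T. c \<odot>\<^bsub>B\<^esub> f \<chi>,
      emb = \<lambda>x. \<lambda>\<chi>\<in>T. if \<chi> = conj_on G P x then emb B x else \<zero>\<^bsub>B\<^esub>,
      act = \<lambda>x f. \<lambda>\<chi>\<in>T. act B x (f (conj_aut G P (inv\<^bsub>G\<^esub> x) \<chi>))\<rparr>"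

definition Brauer_quot ::
    "('g, 'n) monoid_scheme \<Rightarrow> ('k, 'a, 'g) interior_alg \<Rightarrow> 'g set \<Rightarrow> ('g \<Rightarrow> 'g) set
      \<Rightarrow> ('k, (('g \<Rightarrow> 'g) \<Rightarrow> 'a) set, 'g) interior_alg" where
  "Brauer_quot G B P T =
     quot_alg (Brauer_sum G B P T) (\<Pi>\<^sub>E \<phi>\<in>T. Brauer_kernel G B P \<phi>)"

end

theory Submission
  imports Defs
begin

text \<open>
  Write \<open>X\<close> for \<open>N_G^T(P)\<close> and \<open>c\<^sub>g\<close> for the conjugation by \<open>g\<close>. Every element of \<open>E\<close> is a unique
  sum of elements \<open>a \<otimes> g\<close> with \<open>g\<close> in a transversal of \<open>N\<close> in \<open>X N\<close>, and the transversal can be taken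
  in \<open>X\<close>. By the choice of \<open>T\<close>, the group \<open>P\<close> commutes with \<open>X\<close> modulo \<open>N\<close>. Therefore each \<open>A \<otimes> g\<close> is
  stable under the action of \<open>\<Delta>\<^sub>\<phi>(P)\<close> on \<open>E\<close>, and moving the elements of \<open>N\<close> to the left of \<open>g\<close> shows that
  \<open>(\<phi>(u), u)\<close> acts on the coefficient of \<open>g\<close> as the element of \<open>\<Delta>\<^sub>\<psi>(P)\<close> over \<open>g u g\<^sup>-\<^sup>1\<close> does, where
  \<open>\<psi> = \<phi> \<circ> c\<^sub>g\<^sup>-\<^sup>1\<close>. So \<open>N_E^\<phi>(P)\<close> is the direct sum of the \<open>N_A^\<psi>(P) \<otimes> g\<close>, traces correspond to
  traces, and the same decomposition holds for the Brauer quotients. Summed over \<open>\<phi>\<close> and read for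
  a fixed \<open>g\<close>, it says that the coefficients of \<open>g\<close> range over all of the extended Brauer quotient
  of \<open>A\<close>, with \<open>g\<close> now in a transversal of \<open>N \<inter> X\<close> in \<open>X\<close>. That is the right hand side.

  The homomorphism comes from the universal property of the tensor product, applied to the map that
  \<open>a \<mapsto> a \<otimes> 1\<close> induces on Brauer quotients; so multiplicativity and compatibility with the group
  actions hold for general reasons. Bijectivity is checked on coefficients. To keep them free of
  choices, there is a coordinate for every group element \<open>g\<close>, not only for those of a transversal;
  the coordinates of \<open>n g\<close> and of \<open>g\<close> determine each other for \<open>n \<in> N\<close>. The relations that define the
  tensor product generate exactly the common kernel of the coordinates (\<open>balancing_eq\<close>). The identity of
  the first paragraph is \<open>coord_D\<close>, and the lemma on traces that it feeds is \<open>kernel_transport\<close>.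
\<close>

section \<open>Finite sums and cosets in abelian groups\<close>

lemma (in abelian_monoid) finsum_swap:
  assumes "finite I" "finite J" "\<And>i j. \<lbrakk>i \<in> I; j \<in> J\<rbrakk> \<Longrightarrow> f i j \<in> carrier G"
  shows "(\<Oplus>i\<in>I. \<Oplus>j\<in>J. f i j) = (\<Oplus>j\<in>J. \<Oplus>i\<in>I. f i j)"
  using assms(1,3)
proof (induction I rule: finite_induct)
  case empty
  then show ?case by simp
next
  case (insert x I)
  have 1: "f x j \<in> carrier G" "(\<Oplus>i\<in>I. f i j) \<in> carrier G" if "j \<in> J" for j
    using insert that by (auto intro!: finsum_closed)
  have "(\<Oplus>i\<in>insert x I. \<Oplus>j\<in>J. f i j) = (\<Oplus>j\<in>J. f x j) \<oplus> (\<Oplus>j\<in>J. \<Oplus>i\<in>I. f i j)"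
    using insert by (subst finsum_insert) (auto intro!: finsum_closed)
  also have "\<dots> = (\<Oplus>j\<in>J. f x j \<oplus> (\<Oplus>i\<in>I. f i j))"
    using 1 by (subst finsum_addf) auto
  also have "\<dots> = (\<Oplus>j\<in>J. \<Oplus>i\<in>insert x I. f i j)"
    using insert 1 by (intro finsum_cong') (auto intro!: finsum_insert[symmetric])
  finally show ?case .
qed

lemma (in abelian_monoid) finsum_bij:
  assumes "bij_betw h I J" "\<And>j. j \<in> J \<Longrightarrow> f j \<in> carrier G"
  shows "(\<Oplus>i\<in>I. f (h i)) = (\<Oplus>j\<in>J. f j)"
  using finsum_reindex[of f h I] assms by (auto simp: bij_betw_def)

lemma (in abelian_monoid) finsum_delta:
  assumes "finite I" "i \<in> I" "a \<in> carrier G"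
  shows "(\<Oplus>j\<in>I. if j = i then a else \<zero>) = a"
  using add.finprod_singleton_swap[of i I "\<lambda>_. a"] assms by auto

lemma (in abelian_monoid) finsum_eq_single:
  assumes "finite I" "i \<in> I" "f i \<in> carrier G" "\<And>j. j \<in> I \<Longrightarrow> j \<noteq> i \<Longrightarrow> f j = \<zero>"
  shows "finsum G f I = f i"
proof -
  have "finsum G f I = (\<Oplus>j\<in>I. if j = i then f i else \<zero>)"
    using assms by (intro finsum_cong') auto
  then show ?thesis using assms by (simp add: finsum_delta)
qed

lemma (in abelian_group) finsum_in_subgroup:
  assumes "subgroup J (add_monoid G)" "\<And>i. i \<in> I \<Longrightarrow> s i \<in> J"
  shows "finsum G s I \<in> J"
proof -
  have "J \<subseteq> carrier G" "\<zero> \<in> J" using assms(1) by (auto simp: subgroup_def)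
  moreover have "x \<oplus> y \<in> J" if "x \<in> J" "y \<in> J" for x y
    using assms(1) that by (auto simp: subgroup_def)
  ultimately show ?thesis using assms(2)
  proof (induction I rule: infinite_finite_induct)
    case (insert x F)
    moreover have "s \<in> F \<rightarrow> carrier G" "s x \<in> carrier G" using insert by auto
    ultimately show ?case by simp
  qed auto
qed

text \<open>
  The maps that have to be moved through finite sums, cosets and generated subgroups are of several
  kinds: ring homomorphisms, scalar multiplications, group actions, multiplications by one element,
  coordinates. Additivity is what they share.
\<close>

definition additive_map where
  "additive_map A B h \<longleftrightarrow> abelian_group A \<and> abelian_group B \<and> h \<in> carrier A \<rightarrow> carrier B \<and>
     (\<forall>x\<in>carrier A. \<forall>y\<in>carrier A. h (x \<oplus>\<^bsub>A\<^esub> y) = h x \<oplus>\<^bsub>B\<^esub> h y)"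

lemma additive_mapI:
  assumes "abelian_group A" "abelian_group B" "\<And>x. x \<in> carrier A \<Longrightarrow> h x \<in> carrier B"
    "\<And>x y. \<lbrakk>x \<in> carrier A; y \<in> carrier A\<rbrakk> \<Longrightarrow> h (x \<oplus>\<^bsub>A\<^esub> y) = h x \<oplus>\<^bsub>B\<^esub> h y"
  shows "additive_map A B h"
  using assms by (auto simp: additive_map_def)

context
  fixes A B h
  assumes add: "additive_map A B h"
begin

lemma additive_map_closed: "x \<in> carrier A \<Longrightarrow> h x \<in> carrier B"
  using add by (auto simp: additive_map_def)

lemma additive_map_add:
  "\<lbrakk>x \<in> carrier A; y \<in> carrier A\<rbrakk> \<Longrightarrow> h (x \<oplus>\<^bsub>A\<^esub> y) = h x \<oplus>\<^bsub>B\<^esub> h y"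
  using add by (auto simp: additive_map_def)

lemma additive_map_abelian: "abelian_group A" "abelian_group B"
  using add by (auto simp: additive_map_def)

lemma additive_map_group_hom: "group_hom (add_monoid A) (add_monoid B) h"
  using additive_map_abelian
  by (intro group_hom.intro group_hom_axioms.intro)
    (auto intro: abelian_group.a_group additive_map_closed simp: hom_def additive_map_add)

lemma additive_map_zero: "h \<zero>\<^bsub>A\<^esub> = \<zero>\<^bsub>B\<^esub>"
  using group_hom.hom_one[OF additive_map_group_hom] by simp

lemma additive_map_neg: "x \<in> carrier A \<Longrightarrow> h (\<ominus>\<^bsub>A\<^esub> x) = \<ominus>\<^bsub>B\<^esub> h x"
  using group_hom.hom_inv[OF additive_map_group_hom] by (simp add: a_inv_def)

lemma additive_map_minus:
  "\<lbrakk>x \<in> carrier A; y \<in> carrier A\<rbrakk> \<Longrightarrow> h (x \<ominus>\<^bsub>A\<^esub> y) = h x \<ominus>\<^bsub>B\<^esub> h y"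
  using additive_map_abelian
  by (simp add: a_minus_def additive_map_add additive_map_neg abelian_group.a_inv_closed)

lemma additive_map_finsum:
  assumes "\<And>i. i \<in> I \<Longrightarrow> s i \<in> carrier A"
  shows "h (finsum A s I) = finsum B (\<lambda>i. h (s i)) I"
proof -
  interpret A: abelian_group A by (rule additive_map_abelian)
  interpret B: abelian_group B by (rule additive_map_abelian)
  show ?thesis using assms
  proof (induction I rule: infinite_finite_induct)
    case (insert x F)
    then show ?case
      by (simp add: Pi_iff additive_map_add additive_map_closed)
  qed (auto simp: additive_map_zero)
qed

lemma additive_map_vimage:
  assumes "subgroup J (add_monoid B)"
  shows "subgroup {x \<in> carrier A. h x \<in> J} (add_monoid A)"
proof -
  interpret A: abelian_group A by (rule additive_map_abelian)
  interpret J: subgroup J "add_monoid B" by fact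
  show ?thesis
    using J.m_closed J.m_inv_closed J.one_closed additive_map_neg
    by (intro A.add.subgroupI)
      (auto simp: additive_map_add additive_map_zero a_inv_def[symmetric] intro!: exI[of _ "\<zero>\<^bsub>A\<^esub>"])
qed

lemma additive_map_generate:
  assumes "S \<subseteq> carrier A" "subgroup J (add_monoid B)" "\<And>x. x \<in> S \<Longrightarrow> h x \<in> J"
    and "x \<in> generate (add_monoid A) S"
  shows "h x \<in> J"
proof -
  have "generate (add_monoid A) S \<subseteq> {x \<in> carrier A. h x \<in> J}"
    using assms additive_map_abelian
    by (intro group.generate_subgroup_incl additive_map_vimage) (auto intro: abelian_group.a_group)
  then show ?thesis using assms(4) by auto
qed

text \<open>A map that respects subgroups descends to cosets, here in the form of a union over all
  representatives, as in \<^const>\<open>quot_alg\<close>.\<close>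

lemma UN_coset_image:
  assumes I: "subgroup I (add_monoid A)" and J: "subgroup J (add_monoid B)"
    and h: "\<And>x. x \<in> I \<Longrightarrow> h x \<in> J" and a: "a \<in> carrier A"
  shows "(\<Union>x\<in>I +>\<^bsub>A\<^esub> a. J +>\<^bsub>B\<^esub> h x) = J +>\<^bsub>B\<^esub> h a"
proof -
  interpret A: abelian_group A by (rule additive_map_abelian)
  interpret B: abelian_group B by (rule additive_map_abelian)
  have "J +>\<^bsub>B\<^esub> h x = J +>\<^bsub>B\<^esub> h a" if x: "x \<in> I +>\<^bsub>A\<^esub> a" for x
  proof -
    obtain i where i: "i \<in> I" "x = i \<oplus>\<^bsub>A\<^esub> a"
      using x by (auto simp: a_r_coset_def r_coset_def)
    have "i \<in> carrier A" using i I by (auto simp: subgroup_def)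
    then have "h x \<in> J +>\<^bsub>B\<^esub> h a"
      using i a h by (auto simp: additive_map_add a_r_coset_def r_coset_def)
    then show ?thesis
      using B.a_repr_independence[OF _ _ J] a additive_map_closed by metis
  qed
  then have "(\<Union>x\<in>I +>\<^bsub>A\<^esub> a. J +>\<^bsub>B\<^esub> h x) = (\<Union>x\<in>I +>\<^bsub>A\<^esub> a. J +>\<^bsub>B\<^esub> h a)"
    by (rule SUP_cong[OF refl])
  moreover have "a \<in> I +>\<^bsub>A\<^esub> a"
    using subgroup.one_closed[OF I] a
    by (simp add: a_r_coset_def r_coset_def) (rule bexI[of _ "\<zero>\<^bsub>A\<^esub>"], simp_all)
  then have "I +>\<^bsub>A\<^esub> a \<noteq> {}" by blast
  ultimately show ?thesis by simp
qed

end

lemma (in abelian_group) coset_eq_iff: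
  assumes "subgroup J (add_monoid G)" "a \<in> carrier G" "b \<in> carrier G"
  shows "J +> a = J +> b \<longleftrightarrow> a \<ominus> b \<in> J"
proof -
  interpret J: abelian_subgroup J G
    using assms(1) by (simp add: abelian_group_axioms abelian_subgroupI3 additive_subgroup_def)
  have "J +> a = J +> b \<longleftrightarrow> a \<in> J +> b"
    using assms J.a_repr_independence' J.a_rcos_self by metis
  also have "\<dots> \<longleftrightarrow> a \<ominus> b \<in> J"
    using J.a_rcos_module_minus[OF _ assms(3,2)] assms
    using J.a_rcos_module assms(2) assms(3) minus_eq by auto
  finally show ?thesis .
qed

section \<open>Interior algebras\<close>

lemma (in group) normal_in_subgroup_iff:
  assumes "subgroup L G"
  shows "M \<lhd> G\<lparr>carrier := L\<rparr> \<longleftrightarrow>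
    subgroup M G \<and> M \<subseteq> L \<and> (\<forall>g\<in>L. \<forall>n\<in>M. g \<otimes> n \<otimes> inv g \<in> M)"
proof -
  interpret L: group "G\<lparr>carrier := L\<rparr>"
    using assms subgroup_imp_group by blast
  have inv: "inv\<^bsub>G\<lparr>carrier := L\<rparr>\<^esub> g = inv g" if "g \<in> L" for g
    using m_inv_consistent[OF assms that] .
  have "subgroup M (G\<lparr>carrier := L\<rparr>) \<longleftrightarrow> subgroup M G \<and> M \<subseteq> L"
  proof safe
    assume M: "subgroup M (G\<lparr>carrier := L\<rparr>)"
    show "subgroup M G" by (rule incl_subgroup[OF assms M])
    show "x \<in> L" if "x \<in> M" for x using subgroup.subset[OF M] that by auto
  next
    assume "subgroup M G" "M \<subseteq> L"
    then show "subgroup M (G\<lparr>carrier := L\<rparr>)" by (intro subgroup_incl assms)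
  qed
  then show ?thesis
    by (auto simp: L.normal_inv_iff inv)
qed

lemma (in group) inv_cancel_left:
  "\<lbrakk>x \<in> carrier G; y \<in> carrier G\<rbrakk> \<Longrightarrow> inv x \<otimes> (x \<otimes> y) = y"
  "\<lbrakk>x \<in> carrier G; y \<in> carrier G\<rbrakk> \<Longrightarrow> x \<otimes> (inv x \<otimes> y) = y"
  by (simp_all flip: m_assoc)

text \<open>These rules rewrite a term in group elements to its reduced word.\<close>

lemmas (in group) group_word = m_assoc inv_mult_group inv_cancel_left

lemma (in group) bij_betw_conj:
  assumes "g \<in> carrier G" "S \<subseteq> carrier G"
    and "\<And>x. x \<in> S \<Longrightarrow> g \<otimes> x \<otimes> inv g \<in> S" "\<And>x. x \<in> S \<Longrightarrow> inv g \<otimes> x \<otimes> g \<in> S"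
  shows "bij_betw (\<lambda>x. g \<otimes> x \<otimes> inv g) S S"
proof (rule bij_betw_byWitness[where f' = "\<lambda>x. inv g \<otimes> x \<otimes> g"])
  show "\<forall>x\<in>S. inv g \<otimes> (g \<otimes> x \<otimes> inv g) \<otimes> g = x" "\<forall>x\<in>S. g \<otimes> (inv g \<otimes> x \<otimes> g) \<otimes> inv g = x"
    using assms(1,2) by (auto simp: group_word subset_iff)
qed (use assms(3,4) in auto)

lemma (in group) bij_betw_translate:
  assumes "subgroup S G" "g \<in> S"
  shows "bij_betw (\<lambda>x. g \<otimes> x) S S" "bij_betw (\<lambda>x. x \<otimes> g) S S"
proof -
  note S = subgroup.m_closed[OF assms(1)] subgroup.m_inv_closed[OF assms(1)]
    subgroup.mem_carrier[OF assms(1)]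
  show "bij_betw (\<lambda>x. g \<otimes> x) S S"
    using assms(2) S by (intro bij_betw_byWitness[where f' = "\<lambda>x. inv g \<otimes> x"]) (auto simp: group_word)
  show "bij_betw (\<lambda>x. x \<otimes> g) S S"
    using assms(2) S by (intro bij_betw_byWitness[where f' = "\<lambda>x. x \<otimes> inv g"]) (auto simp: group_word)
qed

locale int_alg = group G for G :: "('g, 'n) monoid_scheme" (structure) +
  fixes K :: "('k, 'm) ring_scheme" and M L :: "'g set" and A :: "('k, 'a, 'g) interior_alg"
  assumes interior: "interior_algebra K G M L A"
begin

lemma subgroup_L: "subgroup L G"
  and assoc: "assoc_algebra K A"
  using interior by (auto simp: interior_algebra_def)

lemma subgroup_M: "subgroup M G"
  and M_subset: "M \<subseteq> L"
  and M_normal: "\<lbrakk>g \<in> L; n \<in> M\<rbrakk> \<Longrightarrow> g \<otimes> n \<otimes> inv g \<in> M"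
  using interior normal_in_subgroup_iff[of L M] by (auto simp: interior_algebra_def)

sublocale A: ring A
  using assoc by (simp add: assoc_algebra_def)

lemma module: "module K A"
  using assoc by (simp add: assoc_algebra_def)

lemma L_carrier: "g \<in> L \<Longrightarrow> g \<in> carrier G"
  using subgroup_L by (auto dest: subgroup.subset)

lemma M_carrier: "g \<in> M \<Longrightarrow> g \<in> carrier G"
  using L_carrier M_subset by blast

lemma
  assumes "c \<in> carrier K"
  shows smult_closed: "x \<in> carrier A \<Longrightarrow> c \<odot>\<^bsub>A\<^esub> x \<in> carrier A"
    and smult_add: "\<lbrakk>x \<in> carrier A; y \<in> carrier A\<rbrakk> \<Longrightarrow> c \<odot>\<^bsub>A\<^esub> (x \<oplus>\<^bsub>A\<^esub> y) = c \<odot>\<^bsub>A\<^esub> x \<oplus>\<^bsub>A\<^esub> c \<odot>\<^bsub>A\<^esub> y"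
    and smult_mult: "\<lbrakk>x \<in> carrier A; y \<in> carrier A\<rbrakk> \<Longrightarrow> (c \<odot>\<^bsub>A\<^esub> x) \<otimes>\<^bsub>A\<^esub> y = c \<odot>\<^bsub>A\<^esub> (x \<otimes>\<^bsub>A\<^esub> y)"
    and mult_smult: "\<lbrakk>x \<in> carrier A; y \<in> carrier A\<rbrakk> \<Longrightarrow> x \<otimes>\<^bsub>A\<^esub> (c \<odot>\<^bsub>A\<^esub> y) = c \<odot>\<^bsub>A\<^esub> (x \<otimes>\<^bsub>A\<^esub> y)"
  using assoc assms
  by (auto simp: assoc_algebra_def intro: module.smult_closed module.smult_r_distr[OF module])

lemma additive_smult: "c \<in> carrier K \<Longrightarrow> additive_map A A (\<lambda>x. c \<odot>\<^bsub>A\<^esub> x)"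
  by (intro additive_mapI) (auto simp: smult_closed smult_add A.abelian_group_axioms)

lemma
  assumes "g \<in> L"
  shows act_closed: "a \<in> carrier A \<Longrightarrow> act A g a \<in> carrier A"
    and act_mult: "\<lbrakk>a \<in> carrier A; b \<in> carrier A\<rbrakk> \<Longrightarrow>
      act A g (a \<otimes>\<^bsub>A\<^esub> b) = act A g a \<otimes>\<^bsub>A\<^esub> act A g b"
    and act_add: "\<lbrakk>a \<in> carrier A; b \<in> carrier A\<rbrakk> \<Longrightarrow>
      act A g (a \<oplus>\<^bsub>A\<^esub> b) = act A g a \<oplus>\<^bsub>A\<^esub> act A g b"
    and act_one: "act A g \<one>\<^bsub>A\<^esub> = \<one>\<^bsub>A\<^esub>"
    and act_smult: "\<lbrakk>c \<in> carrier K; a \<in> carrier A\<rbrakk> \<Longrightarrow> act A g (c \<odot>\<^bsub>A\<^esub> a) = c \<odot>\<^bsub>A\<^esub> act A g a"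
  using interior assms by (auto simp: interior_algebra_def ring_hom_def)

lemma additive_act: "g \<in> L \<Longrightarrow> additive_map A A (act A g)"
  by (intro additive_mapI) (auto simp: act_closed act_add A.abelian_group_axioms)

lemma
  shows act_act: "\<lbrakk>g \<in> L; h \<in> L; a \<in> carrier A\<rbrakk> \<Longrightarrow> act A g (act A h a) = act A (g \<otimes> h) a"
    and act_group_one: "a \<in> carrier A \<Longrightarrow> act A \<one> a = a"
proof -
  let ?r = "\<lambda>g. restrict (act A g) (carrier A)"
  interpret group_action "G\<lparr>carrier := L\<rparr>" "carrier A" ?r
    using interior by (simp add: interior_algebra_def)
  interpret hom: group_hom "G\<lparr>carrier := L\<rparr>" "BijGroup (carrier A)" ?r
    by (rule group_hom)
  show "act A g (act A h a) = act A (g \<otimes> h) a" if "g \<in> L" "h \<in> L" "a \<in> carrier A" for g h a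
    using composition_rule[of a g h] that by (simp add: act_closed)
  show "act A \<one> a = a" if "a \<in> carrier A" for a
    using hom.hom_one that by (simp add: BijGroup_def restrict_def fun_eq_iff) metis
qed

lemma
  shows emb_closed: "n \<in> M \<Longrightarrow> emb A n \<in> carrier A"
    and emb_Units: "n \<in> M \<Longrightarrow> emb A n \<in> Units A"
    and emb_mult: "\<lbrakk>n \<in> M; m \<in> M\<rbrakk> \<Longrightarrow> emb A (n \<otimes> m) = emb A n \<otimes>\<^bsub>A\<^esub> emb A m"
  using interior by (auto simp: interior_algebra_def hom_def units_of_def Units_def)

lemma emb_one: "emb A \<one> = \<one>\<^bsub>A\<^esub>"
  using emb_mult[of \<one> \<one>] subgroup.one_closed[OF subgroup_M] emb_Units[of \<one>]
  by (metis A.Units_closed A.Units_l_cancel A.one_closed A.r_one r_one one_closed)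

lemma act_emb: "\<lbrakk>g \<in> L; n \<in> M\<rbrakk> \<Longrightarrow> act A g (emb A n) = emb A (g \<otimes> n \<otimes> inv g)"
  using interior by (auto simp: interior_algebra_def)

lemma act_inner:
  assumes "n \<in> M" "a \<in> carrier A"
  shows "act A n a \<otimes>\<^bsub>A\<^esub> emb A n = emb A n \<otimes>\<^bsub>A\<^esub> a"
proof -
  have "act A n a = emb A n \<otimes>\<^bsub>A\<^esub> a \<otimes>\<^bsub>A\<^esub> inv\<^bsub>A\<^esub> (emb A n)"
    using interior assms by (auto simp: interior_algebra_def)
  then show ?thesis
    using assms emb_closed emb_Units by (simp add: A.m_assoc)
qed

end

lemma (in group) int_algI:
  assumes "interior_algebra K G M L A" shows "int_alg G K M L A"
  using assms by unfold_locales

text \<open>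
  \<open>M\<close> is sent to units, and \<open>L\<close> fixes the unit element, because the unit element is the image of the
  neutral element. Conjugation by \<open>n\<close> is stated without the inverse, which is the form in which it
  is verified.
\<close>

lemma (in group) interior_algebraI:
  assumes L: "subgroup L G" and M: "subgroup M G" "M \<subseteq> L" "\<And>g n. \<lbrakk>g \<in> L; n \<in> M\<rbrakk> \<Longrightarrow> g \<otimes> n \<otimes> inv g \<in> M"
    and A: "assoc_algebra K A"
    and emb_closed: "\<And>n. n \<in> M \<Longrightarrow> emb A n \<in> carrier A"
    and emb_mult: "\<And>n m. \<lbrakk>n \<in> M; m \<in> M\<rbrakk> \<Longrightarrow> emb A (n \<otimes> m) = emb A n \<otimes>\<^bsub>A\<^esub> emb A m"
    and emb_one: "emb A \<one> = \<one>\<^bsub>A\<^esub>"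
    and act_closed: "\<And>g a. \<lbrakk>g \<in> L; a \<in> carrier A\<rbrakk> \<Longrightarrow> act A g a \<in> carrier A"
    and act_add: "\<And>g a b. \<lbrakk>g \<in> L; a \<in> carrier A; b \<in> carrier A\<rbrakk> \<Longrightarrow>
        act A g (a \<oplus>\<^bsub>A\<^esub> b) = act A g a \<oplus>\<^bsub>A\<^esub> act A g b"
    and act_mult: "\<And>g a b. \<lbrakk>g \<in> L; a \<in> carrier A; b \<in> carrier A\<rbrakk> \<Longrightarrow>
        act A g (a \<otimes>\<^bsub>A\<^esub> b) = act A g a \<otimes>\<^bsub>A\<^esub> act A g b"
    and act_smult: "\<And>g c a. \<lbrakk>g \<in> L; c \<in> carrier K; a \<in> carrier A\<rbrakk> \<Longrightarrow>
        act A g (c \<odot>\<^bsub>A\<^esub> a) = c \<odot>\<^bsub>A\<^esub> act A g a"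
    and act_act: "\<And>g h a. \<lbrakk>g \<in> L; h \<in> L; a \<in> carrier A\<rbrakk> \<Longrightarrow> act A g (act A h a) = act A (g \<otimes> h) a"
    and act_group_one: "\<And>a. a \<in> carrier A \<Longrightarrow> act A \<one> a = a"
    and act_inner: "\<And>n a. \<lbrakk>n \<in> M; a \<in> carrier A\<rbrakk> \<Longrightarrow> act A n a \<otimes>\<^bsub>A\<^esub> emb A n = emb A n \<otimes>\<^bsub>A\<^esub> a"
    and act_emb: "\<And>g n. \<lbrakk>g \<in> L; n \<in> M\<rbrakk> \<Longrightarrow> act A g (emb A n) = emb A (g \<otimes> n \<otimes> inv g)"
  shows "interior_algebra K G M L A"
proof -
  interpret A: ring A using A by (simp add: assoc_algebra_def)
  have Lc: "g \<in> carrier G" if "g \<in> L" for g using L that subgroup.subset by blast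
  have inv_M: "inv n \<in> M" if "n \<in> M" for n using M that by (simp add: subgroup.m_inv_closed)
  have Mc: "n \<in> carrier G" if "n \<in> M" for n using M Lc that by blast
  have emb_inv: "emb A (inv n) \<otimes>\<^bsub>A\<^esub> emb A n = \<one>\<^bsub>A\<^esub>" "emb A n \<otimes>\<^bsub>A\<^esub> emb A (inv n) = \<one>\<^bsub>A\<^esub>" if "n \<in> M" for n
    using that inv_M emb_mult[of n "inv n"] emb_mult[of "inv n" n] Mc emb_one by auto
  have emb_Units: "emb A n \<in> Units A" if "n \<in> M" for n
    using that inv_M emb_inv emb_closed by (auto simp: Units_def intro: bexI[of _ "emb A (inv n)"])
  have act_one: "act A g \<one>\<^bsub>A\<^esub> = \<one>\<^bsub>A\<^esub>" if "g \<in> L" for g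
    using act_emb[OF that, of \<one>] M that Lc by (simp add: subgroup.one_closed emb_one)
  have inv_L: "inv g \<in> L" if "g \<in> L" for g using L that by (simp add: subgroup.m_inv_closed)
  interpret GL: group "G\<lparr>carrier := L\<rparr>"
    using L subgroup_imp_group by blast
  have action: "group_action (G\<lparr>carrier := L\<rparr>) (carrier A) (\<lambda>g. restrict (act A g) (carrier A))"
  proof (intro group_action.intro group_hom.intro group_hom_axioms.intro homI)
    show "group (BijGroup (carrier A))" by (rule group_BijGroup)
    show Bij: "restrict (act A g) (carrier A) \<in> carrier (BijGroup (carrier A))"
      if "g \<in> carrier (G\<lparr>carrier := L\<rparr>)" for g
    proof -
      have g: "g \<in> L" using that by simp
      have "bij_betw (act A g) (carrier A) (carrier A)"
        using g inv_L[OF g] Lc[OF g]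
        by (intro bij_betw_byWitness[where f' = "act A (inv g)"])
          (auto simp: act_act act_closed act_group_one)
      then show ?thesis
        by (auto simp: BijGroup_def Bij_def bij_betw_def)
    qed
    show "restrict (act A (g \<otimes>\<^bsub>G\<lparr>carrier := L\<rparr>\<^esub> h)) (carrier A) =
        restrict (act A g) (carrier A) \<otimes>\<^bsub>BijGroup (carrier A)\<^esub> restrict (act A h) (carrier A)"
      if "g \<in> carrier (G\<lparr>carrier := L\<rparr>)" "h \<in> carrier (G\<lparr>carrier := L\<rparr>)" for g h
      using that Bij[OF that(1)] Bij[OF that(2)]
      by (auto simp: BijGroup_def compose_def restrict_def fun_eq_iff act_closed act_act)
  qed (use GL.group_axioms in auto)
  have inner: "act A n a = emb A n \<otimes>\<^bsub>A\<^esub> a \<otimes>\<^bsub>A\<^esub> inv\<^bsub>A\<^esub> (emb A n)" if "n \<in> M" "a \<in> carrier A" for n a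
  proof -
    have "act A n a = act A n a \<otimes>\<^bsub>A\<^esub> (emb A n \<otimes>\<^bsub>A\<^esub> inv\<^bsub>A\<^esub> (emb A n))"
      using emb_Units that M act_closed by auto
    also have "\<dots> = act A n a \<otimes>\<^bsub>A\<^esub> emb A n \<otimes>\<^bsub>A\<^esub> inv\<^bsub>A\<^esub> (emb A n)"
      using emb_Units[OF that(1)] that M act_closed emb_closed
      by (subst A.m_assoc) auto
    finally show ?thesis using act_inner that by simp
  qed
  show ?thesis
    unfolding interior_algebra_def
    using L M A action inner act_emb act_smult
    by (auto simp: normal_in_subgroup_iff ring_hom_def hom_def units_of_def emb_Units emb_mult act_closed
        act_add act_mult act_one)
qed

section \<open>Quotients and homomorphisms\<close>

locale int_alg_ideal = int_alg +
  fixes I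
  assumes ideal: "ideal I A"
    and smult_ideal: "\<lbrakk>c \<in> carrier K; x \<in> I\<rbrakk> \<Longrightarrow> c \<odot>\<^bsub>A\<^esub> x \<in> I"
    and act_ideal: "\<lbrakk>g \<in> L; x \<in> I\<rbrakk> \<Longrightarrow> act A g x \<in> I"
begin

sublocale I: ideal I A by (rule ideal)

lemma ideal_subgroup: "subgroup I (add_monoid A)"
  by (rule I.a_subgroup)

abbreviation cls where "cls a \<equiv> I +>\<^bsub>A\<^esub> a"

lemma quot_carrier: "carrier (quot_alg A I) = cls ` carrier A"
  by (auto simp: quot_alg_def FactRing_def A_RCOSETS_def')

lemma quot_carrierE:
  assumes "C \<in> carrier (quot_alg A I)" obtains a where "a \<in> carrier A" "C = cls a"
  using assms by (auto simp: quot_carrier)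

lemma quot_ops:
  shows "\<lbrakk>a \<in> carrier A; b \<in> carrier A\<rbrakk> \<Longrightarrow> cls a \<otimes>\<^bsub>quot_alg A I\<^esub> cls b = cls (a \<otimes>\<^bsub>A\<^esub> b)"
    and "\<lbrakk>a \<in> carrier A; b \<in> carrier A\<rbrakk> \<Longrightarrow> cls a \<oplus>\<^bsub>quot_alg A I\<^esub> cls b = cls (a \<oplus>\<^bsub>A\<^esub> b)"
    and "\<one>\<^bsub>quot_alg A I\<^esub> = cls \<one>\<^bsub>A\<^esub>"
    and "emb (quot_alg A I) n = cls (emb A n)"
  by (simp_all add: quot_alg_def FactRing_def I.rcoset_mult_add I.a_rcos_sum)

lemma quot_zero: "\<zero>\<^bsub>quot_alg A I\<^esub> = cls \<zero>\<^bsub>A\<^esub>"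
  using A.a_coset_add_zero[of I] I.a_subset by (simp add: quot_alg_def FactRing_def)

lemma quot_smult: "\<lbrakk>c \<in> carrier K; a \<in> carrier A\<rbrakk> \<Longrightarrow> c \<odot>\<^bsub>quot_alg A I\<^esub> cls a = cls (c \<odot>\<^bsub>A\<^esub> a)"
  using UN_coset_image[OF additive_smult ideal_subgroup ideal_subgroup] smult_ideal
  by (simp add: quot_alg_def)

lemma quot_act: "\<lbrakk>g \<in> L; a \<in> carrier A\<rbrakk> \<Longrightarrow> act (quot_alg A I) g (cls a) = cls (act A g a)"
  using UN_coset_image[OF additive_act ideal_subgroup ideal_subgroup] act_ideal
  by (simp add: quot_alg_def)

lemma cls_eq_iff: "\<lbrakk>a \<in> carrier A; b \<in> carrier A\<rbrakk> \<Longrightarrow> cls a = cls b \<longleftrightarrow> a \<ominus>\<^bsub>A\<^esub> b \<in> I"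
  by (rule A.coset_eq_iff[OF ideal_subgroup])

lemma cls_zero_iff: "a \<in> carrier A \<Longrightarrow> cls a = \<zero>\<^bsub>quot_alg A I\<^esub> \<longleftrightarrow> a \<in> I"
  by (simp add: quot_zero cls_eq_iff A.minus_eq)

lemma ring_quot: "ring (quot_alg A I)"
proof (rule ringI)
  show "abelian_group (quot_alg A I)"
  proof (rule abelian_groupI)
    show "\<exists>y\<in>carrier (quot_alg A I). y \<oplus>\<^bsub>quot_alg A I\<^esub> x = \<zero>\<^bsub>quot_alg A I\<^esub>"
      if "x \<in> carrier (quot_alg A I)" for x
    proof -
      from that obtain a where "a \<in> carrier A" "x = cls a" by (rule quot_carrierE)
      then show ?thesis
        by (intro bexI[of _ "cls (\<ominus>\<^bsub>A\<^esub> a)"]) (simp_all add: quot_ops quot_zero A.l_neg quot_carrier)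
    qed
  qed (auto elim!: quot_carrierE simp: quot_ops quot_zero quot_carrier A.a_ac)
  show "Group.monoid (quot_alg A I)"
    by (rule monoidI) (auto elim!: quot_carrierE simp: quot_ops quot_carrier A.m_assoc)
qed (auto elim!: quot_carrierE simp: quot_ops quot_carrier A.l_distr A.r_distr)

lemma additive_cls: "additive_map A (quot_alg A I) cls"
  using ring_quot
  by (intro additive_mapI) (auto simp: A.abelian_group_axioms ring_def quot_ops quot_carrier)

lemma interior_quot: "interior_algebra K G M L (quot_alg A I)"
proof -
  interpret Q: ring "quot_alg A I" by (rule ring_quot)
  interpret KA: module K A by (rule module)
  have "module K (quot_alg A I)"
    by (intro moduleI KA.R.is_cring Q.abelian_group_axioms)
      (auto elim!: quot_carrierE simp: quot_smult smult_closed quot_carrier quot_ops smult_add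
        KA.smult_l_distr KA.smult_assoc1)
  then have assoc: "assoc_algebra K (quot_alg A I)"
    using Q.ring_axioms
    by (auto simp: assoc_algebra_def quot_ops quot_smult smult_closed smult_mult mult_smult
        elim!: quot_carrierE)
  show ?thesis
    by (rule interior_algebraI[OF subgroup_L subgroup_M M_subset M_normal assoc])
      (auto elim!: quot_carrierE simp: quot_ops quot_act quot_smult quot_carrier emb_closed emb_mult emb_one
        act_closed act_add act_mult act_smult smult_closed act_act act_group_one act_inner act_emb
        subgroup.m_closed[OF subgroup_L] subgroup.one_closed[OF subgroup_L] rev_subsetD[OF _ M_subset])
qed

end

text \<open>
  The groups \<open>M\<close> and \<open>L\<close> are parameters of the homomorphism and not of the algebras, because the same
  algebra is considered with larger groups in one place and smaller ones in another.
\<close>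

definition interior_hom ::
    "('k, 'm) ring_scheme \<Rightarrow> 'g set \<Rightarrow> 'g set
      \<Rightarrow> ('k, 'a, 'g) interior_alg \<Rightarrow> ('k, 'b, 'g) interior_alg \<Rightarrow> ('a \<Rightarrow> 'b) \<Rightarrow> bool" where
  "interior_hom K M L A B h \<longleftrightarrow> h \<in> ring_hom A B \<and>
     (\<forall>c \<in> carrier K. \<forall>a \<in> carrier A. h (c \<odot>\<^bsub>A\<^esub> a) = c \<odot>\<^bsub>B\<^esub> h a) \<and>
     (\<forall>n \<in> M. h (emb A n) = emb B n) \<and>
     (\<forall>g \<in> L. \<forall>a \<in> carrier A. h (act A g a) = act B g (h a))"

lemma interior_homD:
  assumes "interior_hom K M L A B h"
  shows "a \<in> carrier A \<Longrightarrow> h a \<in> carrier B"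
    "\<lbrakk>a \<in> carrier A; b \<in> carrier A\<rbrakk> \<Longrightarrow> h (a \<oplus>\<^bsub>A\<^esub> b) = h a \<oplus>\<^bsub>B\<^esub> h b"
    "\<lbrakk>a \<in> carrier A; b \<in> carrier A\<rbrakk> \<Longrightarrow> h (a \<otimes>\<^bsub>A\<^esub> b) = h a \<otimes>\<^bsub>B\<^esub> h b"
    "h \<one>\<^bsub>A\<^esub> = \<one>\<^bsub>B\<^esub>"
    "\<lbrakk>c \<in> carrier K; a \<in> carrier A\<rbrakk> \<Longrightarrow> h (c \<odot>\<^bsub>A\<^esub> a) = c \<odot>\<^bsub>B\<^esub> h a"
    "n \<in> M \<Longrightarrow> h (emb A n) = emb B n"
    "\<lbrakk>g \<in> L; a \<in> carrier A\<rbrakk> \<Longrightarrow> h (act A g a) = act B g (h a)"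
  using assms by (auto simp: interior_hom_def ring_hom_def)

lemma interior_homI:
  assumes "\<And>a. a \<in> carrier A \<Longrightarrow> h a \<in> carrier B"
    "\<And>a b. \<lbrakk>a \<in> carrier A; b \<in> carrier A\<rbrakk> \<Longrightarrow> h (a \<oplus>\<^bsub>A\<^esub> b) = h a \<oplus>\<^bsub>B\<^esub> h b"
    "\<And>a b. \<lbrakk>a \<in> carrier A; b \<in> carrier A\<rbrakk> \<Longrightarrow> h (a \<otimes>\<^bsub>A\<^esub> b) = h a \<otimes>\<^bsub>B\<^esub> h b"
    "h \<one>\<^bsub>A\<^esub> = \<one>\<^bsub>B\<^esub>"
    "\<And>c a. \<lbrakk>c \<in> carrier K; a \<in> carrier A\<rbrakk> \<Longrightarrow> h (c \<odot>\<^bsub>A\<^esub> a) = c \<odot>\<^bsub>B\<^esub> h a"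
    "\<And>n. n \<in> M \<Longrightarrow> h (emb A n) = emb B n"
    "\<And>g a. \<lbrakk>g \<in> L; a \<in> carrier A\<rbrakk> \<Longrightarrow> h (act A g a) = act B g (h a)"
  shows "interior_hom K M L A B h"
  using assms by (auto simp: interior_hom_def ring_hom_def)

lemma interior_hom_additive:
  assumes "interior_hom K M L A B h" "ring A" "ring B"
  shows "additive_map A B h"
  using assms by (intro additive_mapI) (auto simp: ring_def interior_homD)

lemma (in group) interior_hom_quotients:
  assumes "int_alg_ideal G K M L A I" "int_alg_ideal G K M' L' B J" "L'' \<subseteq> L" "L'' \<subseteq> L'" "M'' \<subseteq> M"
    and h: "interior_hom K M'' L'' A B h" and IJ: "\<And>x. x \<in> I \<Longrightarrow> h x \<in> J"
  defines "h' \<equiv> \<lambda>C. \<Union>a\<in>C. J +>\<^bsub>B\<^esub> h a"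
  shows "interior_hom K M'' L'' (quot_alg A I) (quot_alg B J) h'"
    and "a \<in> carrier A \<Longrightarrow> h' (I +>\<^bsub>A\<^esub> a) = J +>\<^bsub>B\<^esub> h a"
proof -
  interpret A: int_alg_ideal G K M L A I by fact
  interpret B: int_alg_ideal G K M' L' B J by fact
  have add: "additive_map A B h"
    using interior_hom_additive[OF h] A.A.ring_axioms B.A.ring_axioms by blast
  have h': "h' (I +>\<^bsub>A\<^esub> a) = J +>\<^bsub>B\<^esub> h a" if "a \<in> carrier A" for a
    unfolding h'_def using UN_coset_image[OF add A.ideal_subgroup B.ideal_subgroup IJ that] .
  then show "a \<in> carrier A \<Longrightarrow> h' (I +>\<^bsub>A\<^esub> a) = J +>\<^bsub>B\<^esub> h a" .
  note hD = interior_homD[OF h]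
  have emb: "h' (emb (quot_alg A I) n) = emb (quot_alg B J) n" if "n \<in> M''" for n
    using that assms(5) by (simp add: A.quot_ops B.quot_ops A.emb_closed h' hD subset_iff)
  show "interior_hom K M'' L'' (quot_alg A I) (quot_alg B J) h'"
    using assms(3,4)
    by (intro interior_homI)
      (auto elim!: A.quot_carrierE simp: h' hD A.quot_ops(1-3) A.quot_smult A.smult_closed B.quot_ops(1-3)
        B.quot_smult B.quot_carrier A.quot_act B.quot_act A.act_closed subset_iff emb)
qed

text \<open>
  The isomorphism is the inverse of the map induced by \<open>h\<close>: it sends an element to the class of any of
  its preimages, and two preimages differ by an element of the kernel.
\<close>

lemma (in group) isomorphic_to_quotient:
  assumes A: "int_alg_ideal G K M L A I" and B: "interior_algebra K G M L B"
    and h: "interior_hom K M L A B h" and surj: "h ` carrier A = carrier B"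
    and ker: "\<And>a. a \<in> carrier A \<Longrightarrow> h a = \<zero>\<^bsub>B\<^esub> \<longleftrightarrow> a \<in> I"
  shows "isomorphic_interior_algebras K G M L B (quot_alg A I)"
proof -
  interpret A: int_alg_ideal G K M L A I by (rule A)
  interpret B: int_alg G K M L B by (rule int_algI[OF B])
  note hD = interior_homD[OF h]
  have add: "additive_map A B h"
    using interior_hom_additive[OF h] A.A.ring_axioms B.A.ring_axioms by blast
  define k where "k b = I +>\<^bsub>A\<^esub> inv_into (carrier A) h b" for b
  have k: "k (h a) = I +>\<^bsub>A\<^esub> a" if a: "a \<in> carrier A" for a
  proof -
    let ?a = "inv_into (carrier A) h (h a)"
    have "h ?a = h a" "?a \<in> carrier A"
      using a by (auto intro: f_inv_into_f inv_into_into)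
    then have "h (?a \<ominus>\<^bsub>A\<^esub> a) = \<zero>\<^bsub>B\<^esub>" "?a \<ominus>\<^bsub>A\<^esub> a \<in> carrier A"
      using a by (simp_all add: additive_map_minus[OF add] hD)
    then show ?thesis
      using ker a \<open>?a \<in> carrier A\<close> by (simp add: k_def A.cls_eq_iff)
  qed
  have "k \<in> interior_iso K M L B (quot_alg A I)"
  proof -
    have B_eq: "carrier B = h ` carrier A" using surj by simp
    have inj: "inj_on k (carrier B)"
    proof (rule inj_onI)
      fix x y assume "x \<in> carrier B" "y \<in> carrier B" and eq: "k x = k y"
      then obtain a b where ab: "a \<in> carrier A" "x = h a" "b \<in> carrier A" "y = h b"
        by (auto simp: B_eq)
      then have "a \<ominus>\<^bsub>A\<^esub> b \<in> I" using eq k by (simp add: A.cls_eq_iff)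
      then have "h a \<ominus>\<^bsub>B\<^esub> h b = \<zero>\<^bsub>B\<^esub>"
        using ab ker[of "a \<ominus>\<^bsub>A\<^esub> b"] by (simp add: additive_map_minus[OF add])
      then show "x = y" using ab by (simp add: hD)
    qed
    have "k \<one>\<^bsub>B\<^esub> = \<one>\<^bsub>quot_alg A I\<^esub>" "\<And>n. n \<in> M \<Longrightarrow> k (emb B n) = emb (quot_alg A I) n"
      using k[OF A.A.one_closed] k[OF A.emb_closed] by (simp_all add: hD A.quot_ops)
    moreover have "bij_betw k (carrier B) (carrier (quot_alg A I))"
      using inj by (auto simp: bij_betw_def B_eq A.quot_carrier k image_iff)
    moreover have "k (h a \<otimes>\<^bsub>B\<^esub> h b) = k (h a) \<otimes>\<^bsub>quot_alg A I\<^esub> k (h b)"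
      "k (h a \<oplus>\<^bsub>B\<^esub> h b) = k (h a) \<oplus>\<^bsub>quot_alg A I\<^esub> k (h b)"
      if "a \<in> carrier A" "b \<in> carrier A" for a b
      using that k[of "a \<otimes>\<^bsub>A\<^esub> b"] k[of "a \<oplus>\<^bsub>A\<^esub> b"] by (simp_all add: hD k A.quot_ops)
    moreover have "k (c \<odot>\<^bsub>B\<^esub> h a) = c \<odot>\<^bsub>quot_alg A I\<^esub> k (h a)" if "c \<in> carrier K" "a \<in> carrier A" for c a
      using that k[of "c \<odot>\<^bsub>A\<^esub> a"] by (simp add: hD k A.quot_smult A.smult_closed)
    moreover have "k (act B g (h a)) = act (quot_alg A I) g (k (h a))" if "g \<in> L" "a \<in> carrier A" for g a
      using that k[of "act A g a"] by (simp add: hD k A.quot_act A.act_closed)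
    ultimately show ?thesis
      by (auto simp: interior_iso_def ring_iso_def ring_hom_def B_eq A.quot_carrier k)
  qed
  then show ?thesis
    using B A.interior_quot by (auto simp: isomorphic_interior_algebras_def)
qed

section \<open>Crossed products and their graded pieces\<close>

text \<open>
  The twisted group ring \<open>A * \<Gamma>\<close> of a finite group \<open>\<Gamma>\<close> acting on \<open>A\<close> consists of the functions
  \<open>f\<close> on \<open>\<Gamma>\<close>, read as the sum of the \<open>f x \<cdot> x\<close>, with \<open>x \<cdot> a = \<sigma> x a \<cdot> x\<close>. Both \<open>A \<otimes>\<^bsub>k\<^esub> kH\<close> and the direct sum of
  the \<open>N_B^\<phi>(P)\<close> are the part \<open>\<Oplus> C x \<cdot> x\<close> of such a ring, for additive subgroups \<open>C x\<close> with
  \<open>C x \<cdot> \<sigma> x (C y) \<subseteq> C (x y)\<close>; in the latter case \<open>\<Gamma> = T\<close> acts trivially.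
\<close>

locale crossed_product = \<Gamma>: group \<Gamma>
  for \<Gamma> :: "('h, 'n) monoid_scheme" (structure) +
  fixes K :: "('k, 'm) ring_scheme" and A :: "('k, 'a, 'c) module_scheme"
    and \<sigma> :: "'h \<Rightarrow> 'a \<Rightarrow> 'a" and C :: "'h \<Rightarrow> 'a set"
    and F :: "('k, 'h \<Rightarrow> 'a, 'd) module_scheme"
  assumes finite: "finite (carrier \<Gamma>)" and assoc_A: "assoc_algebra K A"
    and \<sigma>_hom: "x \<in> carrier \<Gamma> \<Longrightarrow> \<sigma> x \<in> ring_hom A A"
    and \<sigma>_smult: "\<lbrakk>x \<in> carrier \<Gamma>; c \<in> carrier K; a \<in> carrier A\<rbrakk> \<Longrightarrow> \<sigma> x (c \<odot>\<^bsub>A\<^esub> a) = c \<odot>\<^bsub>A\<^esub> \<sigma> x a"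
    and \<sigma>_mult: "\<lbrakk>x \<in> carrier \<Gamma>; y \<in> carrier \<Gamma>; a \<in> carrier A\<rbrakk> \<Longrightarrow> \<sigma> (x \<otimes> y) a = \<sigma> x (\<sigma> y a)"
    and \<sigma>_one: "a \<in> carrier A \<Longrightarrow> \<sigma> \<one> a = a"
    and C_subgroup: "x \<in> carrier \<Gamma> \<Longrightarrow> subgroup (C x) (add_monoid A)"
    and C_smult: "\<lbrakk>x \<in> carrier \<Gamma>; c \<in> carrier K; a \<in> C x\<rbrakk> \<Longrightarrow> c \<odot>\<^bsub>A\<^esub> a \<in> C x"
    and C_mult: "\<lbrakk>x \<in> carrier \<Gamma>; y \<in> carrier \<Gamma>; a \<in> C x; b \<in> C y\<rbrakk> \<Longrightarrow> a \<otimes>\<^bsub>A\<^esub> \<sigma> x b \<in> C (x \<otimes> y)"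
    and C_one: "\<one>\<^bsub>A\<^esub> \<in> C \<one>"
    and F_carrier: "carrier F = (\<Pi>\<^sub>E x\<in>carrier \<Gamma>. C x)"
    and F_zero: "\<zero>\<^bsub>F\<^esub> = (\<lambda>x\<in>carrier \<Gamma>. \<zero>\<^bsub>A\<^esub>)"
    and F_one: "\<one>\<^bsub>F\<^esub> = (\<lambda>x\<in>carrier \<Gamma>. if x = \<one> then \<one>\<^bsub>A\<^esub> else \<zero>\<^bsub>A\<^esub>)"
    and F_add: "\<And>f f'. f \<oplus>\<^bsub>F\<^esub> f' = (\<lambda>x\<in>carrier \<Gamma>. f x \<oplus>\<^bsub>A\<^esub> f' x)"
    and F_smult: "\<And>c f. c \<odot>\<^bsub>F\<^esub> f = (\<lambda>x\<in>carrier \<Gamma>. c \<odot>\<^bsub>A\<^esub> f x)"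
    and F_mult: "\<And>f f'. \<lbrakk>f \<in> carrier F; f' \<in> carrier F\<rbrakk> \<Longrightarrow> f \<otimes>\<^bsub>F\<^esub> f' =
      (\<lambda>z\<in>carrier \<Gamma>. \<Oplus>\<^bsub>A\<^esub>x\<in>carrier \<Gamma>. f x \<otimes>\<^bsub>A\<^esub> \<sigma> x (f' (inv x \<otimes> z)))"
begin

sublocale A: ring A
  using assoc_A by (simp add: assoc_algebra_def)

lemma module_A: "module K A"
  using assoc_A by (simp add: assoc_algebra_def)

lemma C_closed: "\<lbrakk>x \<in> carrier \<Gamma>; a \<in> C x\<rbrakk> \<Longrightarrow> a \<in> carrier A"
  using C_subgroup subgroup.subset by fastforce

lemma C_zero: "x \<in> carrier \<Gamma> \<Longrightarrow> \<zero>\<^bsub>A\<^esub> \<in> C x"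
  using subgroup.one_closed[OF C_subgroup] by simp

lemma C_add: "\<lbrakk>x \<in> carrier \<Gamma>; a \<in> C x; b \<in> C x\<rbrakk> \<Longrightarrow> a \<oplus>\<^bsub>A\<^esub> b \<in> C x"
  using subgroup.m_closed[OF C_subgroup] by simp

lemma C_neg: "\<lbrakk>x \<in> carrier \<Gamma>; a \<in> C x\<rbrakk> \<Longrightarrow> \<ominus>\<^bsub>A\<^esub> a \<in> C x"
  using subgroup.m_inv_closed[OF C_subgroup] by (simp add: a_inv_def)

lemma F_in: "\<lbrakk>f \<in> carrier F; x \<in> carrier \<Gamma>\<rbrakk> \<Longrightarrow> f x \<in> C x"
  by (auto simp: F_carrier)

lemma F_closed: "\<lbrakk>f \<in> carrier F; x \<in> carrier \<Gamma>\<rbrakk> \<Longrightarrow> f x \<in> carrier A"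
  using C_closed F_in by blast

lemma \<sigma>_closed: "\<lbrakk>x \<in> carrier \<Gamma>; a \<in> carrier A\<rbrakk> \<Longrightarrow> \<sigma> x a \<in> carrier A"
  using \<sigma>_hom by (auto simp: ring_hom_def)

lemma \<sigma>_add: "\<lbrakk>x \<in> carrier \<Gamma>; a \<in> carrier A; b \<in> carrier A\<rbrakk> \<Longrightarrow> \<sigma> x (a \<oplus>\<^bsub>A\<^esub> b) = \<sigma> x a \<oplus>\<^bsub>A\<^esub> \<sigma> x b"
  and \<sigma>_times: "\<lbrakk>x \<in> carrier \<Gamma>; a \<in> carrier A; b \<in> carrier A\<rbrakk> \<Longrightarrow> \<sigma> x (a \<otimes>\<^bsub>A\<^esub> b) = \<sigma> x a \<otimes>\<^bsub>A\<^esub> \<sigma> x b"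
  and \<sigma>_unit: "x \<in> carrier \<Gamma> \<Longrightarrow> \<sigma> x \<one>\<^bsub>A\<^esub> = \<one>\<^bsub>A\<^esub>"
  using \<sigma>_hom by (auto simp: ring_hom_def)

lemma additive_\<sigma>: "x \<in> carrier \<Gamma> \<Longrightarrow> additive_map A A (\<sigma> x)"
  by (intro additive_mapI) (auto simp: \<sigma>_closed \<sigma>_add A.abelian_group_axioms)

lemma F_eqI:
  assumes "f \<in> carrier F" "f' \<in> carrier F" "\<And>x. x \<in> carrier \<Gamma> \<Longrightarrow> f x = f' x"
  shows "f = f'"
  using assms unfolding F_carrier by (blast intro: PiE_ext)

lemma F_add_app: "x \<in> carrier \<Gamma> \<Longrightarrow> (f \<oplus>\<^bsub>F\<^esub> f') x = f x \<oplus>\<^bsub>A\<^esub> f' x"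
  and F_smult_app: "x \<in> carrier \<Gamma> \<Longrightarrow> (c \<odot>\<^bsub>F\<^esub> f) x = c \<odot>\<^bsub>A\<^esub> f x"
  by (simp_all add: F_add F_smult)

lemma F_mult_app: "\<lbrakk>f \<in> carrier F; f' \<in> carrier F; z \<in> carrier \<Gamma>\<rbrakk> \<Longrightarrow>
    (f \<otimes>\<^bsub>F\<^esub> f') z = (\<Oplus>\<^bsub>A\<^esub>x\<in>carrier \<Gamma>. f x \<otimes>\<^bsub>A\<^esub> \<sigma> x (f' (inv x \<otimes> z)))"
  by (simp add: F_mult)

lemma F_add_closed: "\<lbrakk>f \<in> carrier F; f' \<in> carrier F\<rbrakk> \<Longrightarrow> f \<oplus>\<^bsub>F\<^esub> f' \<in> carrier F"
  by (auto simp: F_carrier F_add intro!: C_add)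

lemma F_smult_closed: "\<lbrakk>c \<in> carrier K; f \<in> carrier F\<rbrakk> \<Longrightarrow> c \<odot>\<^bsub>F\<^esub> f \<in> carrier F"
  by (auto simp: F_carrier F_smult intro!: C_smult)

lemma abelian_group_F: "abelian_group F"
proof (rule abelian_groupI)
  show "\<exists>f'\<in>carrier F. f' \<oplus>\<^bsub>F\<^esub> f = \<zero>\<^bsub>F\<^esub>" if "f \<in> carrier F" for f
    using that C_neg C_closed
    by (intro bexI[of _ "\<lambda>x\<in>carrier \<Gamma>. \<ominus>\<^bsub>A\<^esub> f x"])
      (auto simp: F_carrier F_add F_zero fun_eq_iff PiE_iff A.l_neg)
  show "\<zero>\<^bsub>F\<^esub> \<in> carrier F" by (auto simp: F_carrier F_zero C_zero)
  show "\<zero>\<^bsub>F\<^esub> \<oplus>\<^bsub>F\<^esub> f = f" if "f \<in> carrier F" for f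
    using that C_closed by (auto simp: F_carrier F_add F_zero fun_eq_iff PiE_iff extensional_def)
qed (auto intro!: F_add_closed F_eqI simp: F_add_app F_closed A.a_ac)

sublocale F: abelian_group F by (rule abelian_group_F)

lemma additive_eval: "x \<in> carrier \<Gamma> \<Longrightarrow> additive_map F A (\<lambda>f. f x)"
  by (intro additive_mapI) (auto simp: F.abelian_group_axioms A.abelian_group_axioms F_closed F_add)

lemma finsum_eval:
  assumes "x \<in> carrier \<Gamma>" "\<And>i. i \<in> I \<Longrightarrow> s i \<in> carrier F"
  shows "finsum F s I x = (\<Oplus>\<^bsub>A\<^esub>i\<in>I. s i x)"
  using additive_map_finsum[OF additive_eval] assms by blast

lemma module_F: "module K F"
proof -
  interpret KA: module K A by (rule module_A)
  show ?thesis
    by (intro moduleI KA.R.is_cring F.abelian_group_axioms F_smult_closed)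
      (auto intro!: F_eqI simp: F_add_app F_smult_app F_smult_closed F_add_closed F_closed
        KA.smult_l_distr KA.smult_r_distr KA.smult_assoc1 KA.R.a_closed KA.R.m_closed)
qed

lemma F_mult_closed:
  assumes "f \<in> carrier F" "f' \<in> carrier F" shows "f \<otimes>\<^bsub>F\<^esub> f' \<in> carrier F"
proof -
  have "f x \<otimes>\<^bsub>A\<^esub> \<sigma> x (f' (inv x \<otimes> z)) \<in> C z" if "x \<in> carrier \<Gamma>" "z \<in> carrier \<Gamma>" for x z
    using C_mult[of x "inv x \<otimes> z"] F_in assms that by (simp add: \<Gamma>.inv_cancel_left)
  then show ?thesis
    using assms by (auto simp: F_mult F_carrier intro!: A.finsum_in_subgroup[OF C_subgroup])
qed

text \<open>
  Both sides are the double sum of \<open>f x \<cdot> \<sigma> x (g (x\<^sup>-\<^sup>1 v)) \<cdot> \<sigma> v (h (v\<^sup>-\<^sup>1 w))\<close> over \<open>x\<close> and \<open>v\<close>; the right hand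
  side is in this form after the substitution \<open>v = x y\<close>.
\<close>

lemma F_assoc:
  assumes f: "f \<in> carrier F" and g: "g \<in> carrier F" and h: "h \<in> carrier F"
  shows "f \<otimes>\<^bsub>F\<^esub> g \<otimes>\<^bsub>F\<^esub> h = f \<otimes>\<^bsub>F\<^esub> (g \<otimes>\<^bsub>F\<^esub> h)"
proof (rule F_eqI)
  fix w assume w: "w \<in> carrier \<Gamma>"
  note [simp] = F_closed[OF f] F_closed[OF g] F_closed[OF h] \<sigma>_closed finite
  let ?inv = "m_inv \<Gamma>"
  let ?t = "\<lambda>x v. f x \<otimes>\<^bsub>A\<^esub> \<sigma> x (g (?inv x \<otimes> v)) \<otimes>\<^bsub>A\<^esub> \<sigma> v (h (?inv v \<otimes> w))"
  have t: "?t x v \<in> carrier A" if "x \<in> carrier \<Gamma>" "v \<in> carrier \<Gamma>" for x v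
    using that w by simp
  have "(f \<otimes>\<^bsub>F\<^esub> g \<otimes>\<^bsub>F\<^esub> h) w = (\<Oplus>\<^bsub>A\<^esub>v\<in>carrier \<Gamma>. \<Oplus>\<^bsub>A\<^esub>x\<in>carrier \<Gamma>. ?t x v)"
    using w F_mult_closed[OF f g] h f g
    by (simp add: F_mult) (intro A.finsum_cong', auto intro!: A.finsum_ldistr A.finsum_closed)
  also have "\<dots> = (\<Oplus>\<^bsub>A\<^esub>x\<in>carrier \<Gamma>. \<Oplus>\<^bsub>A\<^esub>v\<in>carrier \<Gamma>. ?t x v)"
    using t by (intro A.finsum_swap) auto
  also have "\<dots> = (\<Oplus>\<^bsub>A\<^esub>x\<in>carrier \<Gamma>. f x \<otimes>\<^bsub>A\<^esub> \<sigma> x ((g \<otimes>\<^bsub>F\<^esub> h) (?inv x \<otimes> w)))"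
  proof (intro A.finsum_cong' refl)
    fix x assume x: "x \<in> carrier \<Gamma>"
    let ?s = "\<lambda>y. g y \<otimes>\<^bsub>A\<^esub> \<sigma> y (h (?inv y \<otimes> (?inv x \<otimes> w)))"
    have s: "?s y \<in> carrier A" if "y \<in> carrier \<Gamma>" for y using that x w by simp
    have "bij_betw (\<lambda>v. ?inv x \<otimes> v) (carrier \<Gamma>) (carrier \<Gamma>)"
      using x by (intro bij_betw_byWitness[where f' = "\<lambda>v. x \<otimes> v"]) (auto simp: \<Gamma>.inv_cancel_left)
    then have "(\<Oplus>\<^bsub>A\<^esub>v\<in>carrier \<Gamma>. f x \<otimes>\<^bsub>A\<^esub> \<sigma> x (?s (?inv x \<otimes> v))) =
        (\<Oplus>\<^bsub>A\<^esub>y\<in>carrier \<Gamma>. f x \<otimes>\<^bsub>A\<^esub> \<sigma> x (?s y))"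
      using x s by (intro A.finsum_bij[where f = "\<lambda>y. f x \<otimes>\<^bsub>A\<^esub> \<sigma> x (?s y)"]) auto
    also have "\<dots> = f x \<otimes>\<^bsub>A\<^esub> \<sigma> x (\<Oplus>\<^bsub>A\<^esub>y\<in>carrier \<Gamma>. ?s y)"
      using x s additive_map_finsum[OF additive_\<sigma>[OF x], of "carrier \<Gamma>" ?s]
      by (simp add: A.finsum_rdistr)
    also have "(\<Oplus>\<^bsub>A\<^esub>y\<in>carrier \<Gamma>. ?s y) = (g \<otimes>\<^bsub>F\<^esub> h) (?inv x \<otimes> w)"
      using x w g h by (simp add: F_mult)
    finally have "(\<Oplus>\<^bsub>A\<^esub>v\<in>carrier \<Gamma>. f x \<otimes>\<^bsub>A\<^esub> \<sigma> x (?s (?inv x \<otimes> v))) =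
        f x \<otimes>\<^bsub>A\<^esub> \<sigma> x ((g \<otimes>\<^bsub>F\<^esub> h) (?inv x \<otimes> w))" .
    moreover have eq: "?t x v = f x \<otimes>\<^bsub>A\<^esub> \<sigma> x (?s (?inv x \<otimes> v))" if v: "v \<in> carrier \<Gamma>" for v
    proof -
      have "x \<otimes> (?inv x \<otimes> v) = v" "?inv (?inv x \<otimes> v) \<otimes> (?inv x \<otimes> w) = ?inv v \<otimes> w"
        using x v w by (simp_all add: \<Gamma>.group_word)
      then show ?thesis
        using x v w by (simp add: \<sigma>_times A.m_assoc flip: \<sigma>_mult)
    qed
    have "(\<Oplus>\<^bsub>A\<^esub>v\<in>carrier \<Gamma>. ?t x v) = (\<Oplus>\<^bsub>A\<^esub>v\<in>carrier \<Gamma>. f x \<otimes>\<^bsub>A\<^esub> \<sigma> x (?s (?inv x \<otimes> v)))"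
      by (rule A.finsum_cong'[OF refl _ eq]) (use x s in auto)
    ultimately show "(\<Oplus>\<^bsub>A\<^esub>v\<in>carrier \<Gamma>. ?t x v) = f x \<otimes>\<^bsub>A\<^esub> \<sigma> x ((g \<otimes>\<^bsub>F\<^esub> h) (?inv x \<otimes> w))"
      by (simp only:)
  qed (use w F_mult_closed[OF g h] in \<open>auto simp: F_closed\<close>)
  also have "\<dots> = (f \<otimes>\<^bsub>F\<^esub> (g \<otimes>\<^bsub>F\<^esub> h)) w"
    using w f F_mult_closed[OF g h] by (simp add: F_mult)
  finally show "(f \<otimes>\<^bsub>F\<^esub> g \<otimes>\<^bsub>F\<^esub> h) w = (f \<otimes>\<^bsub>F\<^esub> (g \<otimes>\<^bsub>F\<^esub> h)) w" .
qed (intro F_mult_closed f g h)+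

lemma F_one_closed: "\<one>\<^bsub>F\<^esub> \<in> carrier F"
  by (auto simp: F_carrier F_one C_zero C_one)

lemma F_l_one:
  assumes f: "f \<in> carrier F" shows "\<one>\<^bsub>F\<^esub> \<otimes>\<^bsub>F\<^esub> f = f"
proof (rule F_eqI[OF F_mult_closed[OF F_one_closed f] f])
  fix z assume z: "z \<in> carrier \<Gamma>"
  have "(\<one>\<^bsub>F\<^esub> \<otimes>\<^bsub>F\<^esub> f) z = (\<Oplus>\<^bsub>A\<^esub>x\<in>carrier \<Gamma>. \<one>\<^bsub>F\<^esub> x \<otimes>\<^bsub>A\<^esub> \<sigma> x (f (inv x \<otimes> z)))"
    using z f F_one_closed by (simp add: F_mult)
  also have "\<dots> = \<one>\<^bsub>F\<^esub> \<one> \<otimes>\<^bsub>A\<^esub> \<sigma> \<one> (f (inv \<one> \<otimes> z))"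
    using z f by (intro A.finsum_eq_single finite) (auto simp: F_one F_closed \<sigma>_closed)
  also have "\<dots> = f z" using z f by (simp add: F_one \<sigma>_one F_closed)
  finally show "(\<one>\<^bsub>F\<^esub> \<otimes>\<^bsub>F\<^esub> f) z = f z" .
qed

lemma F_r_one:
  assumes f: "f \<in> carrier F" shows "f \<otimes>\<^bsub>F\<^esub> \<one>\<^bsub>F\<^esub> = f"
proof (rule F_eqI[OF F_mult_closed[OF f F_one_closed] f])
  fix z assume z: "z \<in> carrier \<Gamma>"
  have eq: "inv x \<otimes> z = \<one> \<longleftrightarrow> x = z" if "x \<in> carrier \<Gamma>" for x
    using that z \<Gamma>.inv_equality[of "inv x" z] by auto
  have "(f \<otimes>\<^bsub>F\<^esub> \<one>\<^bsub>F\<^esub>) z = (\<Oplus>\<^bsub>A\<^esub>x\<in>carrier \<Gamma>. f x \<otimes>\<^bsub>A\<^esub> \<sigma> x (\<one>\<^bsub>F\<^esub> (inv x \<otimes> z)))"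
    using z f F_one_closed by (simp add: F_mult)
  also have "\<dots> = f z \<otimes>\<^bsub>A\<^esub> \<sigma> z (\<one>\<^bsub>F\<^esub> (inv z \<otimes> z))"
    using z f additive_map_zero[OF additive_\<sigma>]
    by (intro A.finsum_eq_single finite) (auto simp: F_one F_closed \<sigma>_unit eq)
  also have "\<dots> = f z" using z f by (simp add: F_one \<sigma>_unit F_closed)
  finally show "(f \<otimes>\<^bsub>F\<^esub> \<one>\<^bsub>F\<^esub>) z = f z" .
qed

lemma ring_F: "ring F"
proof (rule ringI[OF abelian_group_F])
  show "Group.monoid F"
    by (rule monoidI) (auto intro: F_mult_closed F_one_closed F_assoc F_l_one F_r_one)
  fix f g h assume fgh: "f \<in> carrier F" "g \<in> carrier F" "h \<in> carrier F"
  note [simp] = F_closed[OF fgh(1)] F_closed[OF fgh(2)] F_closed[OF fgh(3)] \<sigma>_closed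
    F_add_closed[OF fgh(1,2)]
  show "(f \<oplus>\<^bsub>F\<^esub> g) \<otimes>\<^bsub>F\<^esub> h = f \<otimes>\<^bsub>F\<^esub> h \<oplus>\<^bsub>F\<^esub> g \<otimes>\<^bsub>F\<^esub> h"
    using fgh
    by (intro F_eqI F_add_closed F_mult_closed)
      (auto simp: F_mult_app F_add_app F_add_closed A.l_distr
        simp flip: A.finsum_addf intro!: A.finsum_cong')
  show "h \<otimes>\<^bsub>F\<^esub> (f \<oplus>\<^bsub>F\<^esub> g) = h \<otimes>\<^bsub>F\<^esub> f \<oplus>\<^bsub>F\<^esub> h \<otimes>\<^bsub>F\<^esub> g"
    using fgh
    by (intro F_eqI F_add_closed F_mult_closed)
      (auto simp: F_mult_app F_add_app F_add_closed A.r_distr \<sigma>_add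
        simp flip: A.finsum_addf intro!: A.finsum_cong')
qed

lemma assoc_algebra_F: "assoc_algebra K F"
proof -
  interpret KA: module K A by (rule module_A)
  have 1: "(c \<odot>\<^bsub>F\<^esub> f) \<otimes>\<^bsub>F\<^esub> g = c \<odot>\<^bsub>F\<^esub> (f \<otimes>\<^bsub>F\<^esub> g)" "f \<otimes>\<^bsub>F\<^esub> (c \<odot>\<^bsub>F\<^esub> g) = c \<odot>\<^bsub>F\<^esub> (f \<otimes>\<^bsub>F\<^esub> g)"
    if c: "c \<in> carrier K" and f: "f \<in> carrier F" and g: "g \<in> carrier F" for c f g
  proof -
    note [simp] = F_closed[OF f] F_closed[OF g] \<sigma>_closed F_smult_closed[OF c f] F_smult_closed[OF c g]
    have smult: "(c \<odot>\<^bsub>A\<^esub> a) \<otimes>\<^bsub>A\<^esub> b = c \<odot>\<^bsub>A\<^esub> (a \<otimes>\<^bsub>A\<^esub> b)" "a \<otimes>\<^bsub>A\<^esub> (c \<odot>\<^bsub>A\<^esub> b) = c \<odot>\<^bsub>A\<^esub> (a \<otimes>\<^bsub>A\<^esub> b)"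
      if "a \<in> carrier A" "b \<in> carrier A" for a b
      using assoc_A c that by (auto simp: assoc_algebra_def)
    have "additive_map A A (\<lambda>a. c \<odot>\<^bsub>A\<^esub> a)"
      using c by (intro additive_mapI) (auto simp: KA.smult_r_distr A.abelian_group_axioms)
    note sum = additive_map_finsum[OF this]
    have r: "(c \<odot>\<^bsub>F\<^esub> (f \<otimes>\<^bsub>F\<^esub> g)) z =
        (\<Oplus>\<^bsub>A\<^esub>x\<in>carrier \<Gamma>. c \<odot>\<^bsub>A\<^esub> (f x \<otimes>\<^bsub>A\<^esub> \<sigma> x (g (inv x \<otimes> z))))" if "z \<in> carrier \<Gamma>" for z
      using that f g by (simp add: F_smult F_mult sum)
    show "(c \<odot>\<^bsub>F\<^esub> f) \<otimes>\<^bsub>F\<^esub> g = c \<odot>\<^bsub>F\<^esub> (f \<otimes>\<^bsub>F\<^esub> g)"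
      using f g c
      by (intro F_eqI F_mult_closed F_smult_closed)
        (auto simp: r F_mult_app F_smult_app[of _ c f] smult intro!: A.finsum_cong')
    show "f \<otimes>\<^bsub>F\<^esub> (c \<odot>\<^bsub>F\<^esub> g) = c \<odot>\<^bsub>F\<^esub> (f \<otimes>\<^bsub>F\<^esub> g)"
      using f g c
      by (intro F_eqI F_mult_closed F_smult_closed)
        (auto simp: r F_mult_app F_smult_app[of _ c g] smult \<sigma>_smult intro!: A.finsum_cong')
  qed
  then show ?thesis
    using ring_F module_F by (auto simp: assoc_algebra_def)
qed

end

section \<open>The tensor product over a normal subgroup\<close>

text \<open>
  In general only the elements of \<open>L\<close> that normalize \<open>H\<close> act on \<open>A \<otimes>\<^bsub>M\<^esub> H\<close>; the subgroup \<open>L'\<close> consists of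
  such elements. It contains \<open>H\<close>, so that \<open>A \<otimes>\<^bsub>M\<^esub> H\<close> is an \<open>H\<close>-interior \<open>L'\<close>-algebra.
\<close>

locale interior_tensor = int_alg G K M L A
  for G :: "('g, 'n) monoid_scheme" (structure) and K :: "('k, 'm) ring_scheme" and M L :: "'g set"
    and A :: "('k, 'a, 'g) interior_alg" +
  fixes H L' :: "'g set"
  assumes finite_H: "finite H" and subgroup_H: "subgroup H G" and subgroup_L': "subgroup L' G"
    and M_H: "M \<subseteq> H" and H_L': "H \<subseteq> L'" and L'_L: "L' \<subseteq> L"
    and H_normal: "\<And>g x. \<lbrakk>g \<in> L'; x \<in> H\<rbrakk> \<Longrightarrow> g \<otimes> x \<otimes> inv g \<in> H"
begin

abbreviation F where "F \<equiv> tensor_over_field G A H"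

lemma H_carrier: "x \<in> H \<Longrightarrow> x \<in> carrier G"
  and L'_carrier: "x \<in> L' \<Longrightarrow> x \<in> carrier G"
  using subgroup_H subgroup_L' subgroup.subset by blast+

lemma H_L: "x \<in> H \<Longrightarrow> x \<in> L"
  using H_L' L'_L by blast

lemma H_simps [simp]: "\<one> \<in> H" "\<lbrakk>x \<in> H; y \<in> H\<rbrakk> \<Longrightarrow> x \<otimes> y \<in> H" "x \<in> H \<Longrightarrow> inv x \<in> H"
  and M_simps [simp]: "\<one> \<in> M" "\<lbrakk>n \<in> M; m \<in> M\<rbrakk> \<Longrightarrow> n \<otimes> m \<in> M" "n \<in> M \<Longrightarrow> inv n \<in> M"
  and L_simps [simp]: "\<one> \<in> L" "\<lbrakk>g \<in> L; h \<in> L\<rbrakk> \<Longrightarrow> g \<otimes> h \<in> L" "g \<in> L \<Longrightarrow> inv g \<in> L"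
  and L'_simps [simp]: "\<one> \<in> L'" "\<lbrakk>g \<in> L'; h \<in> L'\<rbrakk> \<Longrightarrow> g \<otimes> h \<in> L'" "g \<in> L' \<Longrightarrow> inv g \<in> L'"
  using subgroup_H subgroup_M subgroup_L subgroup_L' by (auto simp: subgroup_def)

lemma finite_M: "finite M"
  using finite_H M_H finite_subset by blast

sublocale HG: group "G\<lparr>carrier := H\<rparr>"
  using subgroup_H subgroup_imp_group by blast

lemma inv_HG: "x \<in> H \<Longrightarrow> inv\<^bsub>G\<lparr>carrier := H\<rparr>\<^esub> x = inv x"
  by (rule m_inv_consistent[OF subgroup_H])

sublocale F: crossed_product "G\<lparr>carrier := H\<rparr>" K A "act A" "\<lambda>_. carrier A" F
proof
  show "f \<otimes>\<^bsub>F\<^esub> f' = (\<lambda>z\<in>carrier (G\<lparr>carrier := H\<rparr>). \<Oplus>\<^bsub>A\<^esub>x\<in>carrier (G\<lparr>carrier := H\<rparr>).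
      f x \<otimes>\<^bsub>A\<^esub> act A x (f' (inv\<^bsub>G\<lparr>carrier := H\<rparr>\<^esub> x \<otimes>\<^bsub>G\<lparr>carrier := H\<rparr>\<^esub> z)))"
    if f: "f \<in> carrier F" "f' \<in> carrier F" for f f'
  proof -
    have "f x \<otimes>\<^bsub>A\<^esub> act A x (f' (inv x \<otimes> z)) \<in> carrier A" if "x \<in> H" "z \<in> H" for x z
      using f that by (auto simp: tensor_over_field_def intro!: A.m_closed act_closed H_L)
    then show ?thesis
      by (auto simp: tensor_over_field_def inv_HG intro!: restrict_ext A.finsum_cong')
  qed
qed (auto simp: finite_H assoc act_closed act_mult act_add act_one act_smult act_act act_group_one
    ring_hom_def H_L A.add.group_l_invI tensor_over_field_def pure_tensor_def smult_closed
    intro!: A.add.subgroup_self)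

lemma F_carrier: "carrier F = H \<rightarrow>\<^sub>E carrier A"
  using F.F_carrier by simp

lemma F_closed [simp]: "\<lbrakk>f \<in> carrier F; x \<in> H\<rbrakk> \<Longrightarrow> f x \<in> carrier A"
  using F.F_closed by simp

lemma F_eqI: "\<lbrakk>f \<in> carrier F; f' \<in> carrier F; \<And>x. x \<in> H \<Longrightarrow> f x = f' x\<rbrakk> \<Longrightarrow> f = f'"
  using F.F_eqI by simp

lemma F_ring: "ring F" by (rule F.ring_F)

sublocale FR: ring F by (rule F_ring)

lemma F_mult_app: "\<lbrakk>f \<in> carrier F; f' \<in> carrier F; z \<in> H\<rbrakk> \<Longrightarrow>
    (f \<otimes>\<^bsub>F\<^esub> f') z = (\<Oplus>\<^bsub>A\<^esub>x\<in>H. f x \<otimes>\<^bsub>A\<^esub> act A x (f' (inv x \<otimes> z)))"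
  by (simp add: tensor_over_field_def)

lemma pure_tensor_closed [simp]: "\<lbrakk>a \<in> carrier A; x \<in> H\<rbrakk> \<Longrightarrow> pure_tensor A H a x \<in> carrier F"
  by (auto simp: F_carrier pure_tensor_def)

lemma pure_tensor_app: "z \<in> H \<Longrightarrow> pure_tensor A H a x z = (if z = x then a else \<zero>\<^bsub>A\<^esub>)"
  by (simp add: pure_tensor_def)

lemma emb_F: "emb F x = pure_tensor A H \<one>\<^bsub>A\<^esub> x"
  and act_F: "act F g f = (\<lambda>z\<in>H. act A g (f (inv g \<otimes> z \<otimes> g)))"
  by (simp_all add: tensor_over_field_def)

lemma H_normal': "\<lbrakk>g \<in> L'; x \<in> H\<rbrakk> \<Longrightarrow> inv g \<otimes> x \<otimes> g \<in> H"
  using H_normal[of "inv g" x] by (simp add: L'_carrier)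

lemma act_F_closed: "\<lbrakk>g \<in> L'; f \<in> carrier F\<rbrakk> \<Longrightarrow> act F g f \<in> carrier F"
  using L'_L by (auto simp: F_carrier act_F H_normal' intro!: act_closed)

lemma act_F_app: "z \<in> H \<Longrightarrow> act F g f z = act A g (f (inv g \<otimes> z \<otimes> g))"
  by (simp add: act_F)

lemma act_zero: "g \<in> L \<Longrightarrow> act A g \<zero>\<^bsub>A\<^esub> = \<zero>\<^bsub>A\<^esub>"
  by (rule additive_map_zero[OF additive_act])

lemma pure_tensor_mult_app:
  assumes a: "a \<in> carrier A" and x: "x \<in> H" and f: "f \<in> carrier F" and z: "z \<in> H"
  shows "(pure_tensor A H a x \<otimes>\<^bsub>F\<^esub> f) z = a \<otimes>\<^bsub>A\<^esub> act A x (f (inv x \<otimes> z))"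
proof -
  have "(pure_tensor A H a x \<otimes>\<^bsub>F\<^esub> f) z =
      (\<Oplus>\<^bsub>A\<^esub>y\<in>H. pure_tensor A H a x y \<otimes>\<^bsub>A\<^esub> act A y (f (inv y \<otimes> z)))"
    using assms by (simp add: F_mult_app)
  also have "\<dots> = pure_tensor A H a x x \<otimes>\<^bsub>A\<^esub> act A x (f (inv x \<otimes> z))"
    using assms by (intro A.finsum_eq_single finite_H) (auto simp: pure_tensor_app act_closed H_L)
  finally show ?thesis using x by (simp add: pure_tensor_app)
qed

lemma mult_emb_app:
  assumes x: "x \<in> H" and f: "f \<in> carrier F" and z: "z \<in> H"
  shows "(f \<otimes>\<^bsub>F\<^esub> emb F x) z = f (z \<otimes> inv x)"
proof -
  let ?t = "\<lambda>y. f y \<otimes>\<^bsub>A\<^esub> act A y (pure_tensor A H \<one>\<^bsub>A\<^esub> x (inv y \<otimes> z))"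
  have eq: "inv y \<otimes> z = x \<longleftrightarrow> y = z \<otimes> inv x" if "y \<in> H" for y
  proof
    assume "inv y \<otimes> z = x"
    then show "y = z \<otimes> inv x" using that x z H_carrier by (auto simp: group_word)
  next
    assume "y = z \<otimes> inv x"
    then show "inv y \<otimes> z = x" using that x z H_carrier by (auto simp: group_word)
  qed
  have "(f \<otimes>\<^bsub>F\<^esub> emb F x) z = (\<Oplus>\<^bsub>A\<^esub>y\<in>H. ?t y)"
    using assms by (simp add: F_mult_app emb_F)
  also have "\<dots> = ?t (z \<otimes> inv x)"
    using x f z eq by (intro A.finsum_eq_single finite_H) (auto simp: pure_tensor_app act_closed H_L act_zero)
  also have "\<dots> = f (z \<otimes> inv x)"
    using x z eq[of "z \<otimes> inv x"] f by (simp add: pure_tensor_app act_one H_L)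
  finally show ?thesis .
qed

lemma bij_conj: "g \<in> L' \<Longrightarrow> bij_betw (\<lambda>x. g \<otimes> x \<otimes> inv g) H H"
  by (intro bij_betw_conj) (auto simp: H_normal H_normal' H_carrier L'_carrier)

lemma act_F_mult:
  assumes g: "g \<in> L'" and f: "f \<in> carrier F" and f': "f' \<in> carrier F"
  shows "act F g (f \<otimes>\<^bsub>F\<^esub> f') = act F g f \<otimes>\<^bsub>F\<^esub> act F g f'"
proof (rule F_eqI)
  fix z assume z: "z \<in> H"
  have gL: "g \<in> L" using g L'_L by blast
  note [simp] = L'_carrier[OF g] H_carrier H_normal[OF g] H_normal'[OF g] act_closed gL H_L
  let ?s = "\<lambda>y. act A g (f (inv g \<otimes> y \<otimes> g)) \<otimes>\<^bsub>A\<^esub> act A y (act A g (f' (inv g \<otimes> (inv y \<otimes> z) \<otimes> g)))"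
  have "act F g (f \<otimes>\<^bsub>F\<^esub> f') z =
      (\<Oplus>\<^bsub>A\<^esub>x\<in>H. act A g (f x \<otimes>\<^bsub>A\<^esub> act A x (f' (inv x \<otimes> (inv g \<otimes> z \<otimes> g)))))"
    using z g f f' by (simp add: act_F_app F_mult_app additive_map_finsum[OF additive_act])
  also have "\<dots> = (\<Oplus>\<^bsub>A\<^esub>x\<in>H. ?s (g \<otimes> x \<otimes> inv g))"
  proof (intro A.finsum_cong' refl)
    fix x assume x: "x \<in> H"
    have "inv g \<otimes> (inv (g \<otimes> x \<otimes> inv g) \<otimes> z) \<otimes> g = inv x \<otimes> (inv g \<otimes> z \<otimes> g)"
      "inv g \<otimes> (g \<otimes> x \<otimes> inv g) \<otimes> g = x" "g \<otimes> x \<otimes> inv g \<otimes> g = g \<otimes> x"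
      using x z by (simp_all add: group_word)
    then show "act A g (f x \<otimes>\<^bsub>A\<^esub> act A x (f' (inv x \<otimes> (inv g \<otimes> z \<otimes> g)))) = ?s (g \<otimes> x \<otimes> inv g)"
      using x z f f' by (simp add: act_mult act_act)
  qed (use z f f' in auto)
  also have "\<dots> = (\<Oplus>\<^bsub>A\<^esub>y\<in>H. ?s y)"
    using z f f' by (intro A.finsum_bij[where f = ?s] bij_conj g) simp
  also have "\<dots> = (act F g f \<otimes>\<^bsub>F\<^esub> act F g f') z"
    using z g f f' by (simp add: F_mult_app act_F_closed) (intro A.finsum_cong', auto simp: act_F_app)
  finally show "act F g (f \<otimes>\<^bsub>F\<^esub> f') z = (act F g f \<otimes>\<^bsub>F\<^esub> act F g f') z" .
qed (use assms in \<open>auto intro: act_F_closed\<close>)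

lemma interior_F: "interior_algebra K G H L' F"
proof (rule interior_algebraI[OF subgroup_L' subgroup_H H_L' H_normal F.assoc_algebra_F])
  note [simp] = H_carrier L'_carrier H_normal H_normal' act_closed subsetD[OF L'_L] H_L emb_F act_F_app
    act_F_closed
  show "emb F (n \<otimes> m) = emb F n \<otimes>\<^bsub>F\<^esub> emb F m" if "n \<in> H" "m \<in> H" for n m
  proof (rule F_eqI)
    fix z assume z: "z \<in> H"
    have "z = n \<otimes> m \<longleftrightarrow> inv n \<otimes> z = m"
      using that z by (auto simp: group_word)
    then show "emb F (n \<otimes> m) z = (emb F n \<otimes>\<^bsub>F\<^esub> emb F m) z"
      using that z by (auto simp: pure_tensor_mult_app pure_tensor_app act_one act_zero)
  qed (use that in auto)
  show "act F n f \<otimes>\<^bsub>F\<^esub> emb F n = emb F n \<otimes>\<^bsub>F\<^esub> f" if "n \<in> H" "f \<in> carrier F" for n f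
  proof (rule F_eqI)
    fix z assume z: "z \<in> H"
    have "(act F n f \<otimes>\<^bsub>F\<^esub> emb F n) z = act A n (f (inv n \<otimes> z))"
      using that z H_L' by (subst mult_emb_app) (auto simp: group_word)
    then show "(act F n f \<otimes>\<^bsub>F\<^esub> emb F n) z = (emb F n \<otimes>\<^bsub>F\<^esub> f) z"
      using that z by (simp add: pure_tensor_mult_app)
  qed (use that H_L' in auto)
  show "act F g (emb F n) = emb F (g \<otimes> n \<otimes> inv g)" if "g \<in> L'" "n \<in> H" for g n
  proof (rule F_eqI)
    fix z assume z: "z \<in> H"
    have "inv g \<otimes> z \<otimes> g = n \<longleftrightarrow> z = g \<otimes> n \<otimes> inv g"
      using that z by (auto simp: group_word)
    then show "act F g (emb F n) z = emb F (g \<otimes> n \<otimes> inv g) z"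
      using that z by (simp add: pure_tensor_app act_one act_zero)
  qed (use that in auto)
  show "act F g (act F h f) = act F (g \<otimes> h) f" if "g \<in> L'" "h \<in> L'" "f \<in> carrier F" for g h f
  proof (rule F_eqI)
    fix z assume z: "z \<in> H"
    have "inv h \<otimes> (inv g \<otimes> z \<otimes> g) \<otimes> h = inv (g \<otimes> h) \<otimes> z \<otimes> (g \<otimes> h)"
      using that z by (simp add: group_word)
    then show "act F g (act F h f) z = act F (g \<otimes> h) f z"
      using that z H_normal'[of "g \<otimes> h" z] by (simp add: act_act)
  qed (use that in auto)
  show "act F \<one> f = f" if "f \<in> carrier F" for f
    using that by (intro F_eqI) (auto simp: act_group_one)
  show "act F g (f \<oplus>\<^bsub>F\<^esub> f') = act F g f \<oplus>\<^bsub>F\<^esub> act F g f'"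
    if "g \<in> L'" "f \<in> carrier F" "f' \<in> carrier F" for g f f'
    using that F.F_add_app by (intro F_eqI) (auto simp: act_add)
  show "act F g (c \<odot>\<^bsub>F\<^esub> f) = c \<odot>\<^bsub>F\<^esub> act F g f"
    if "g \<in> L'" "c \<in> carrier K" "f \<in> carrier F" for g c f
    using that F.F_smult_app F.F_smult_closed by (intro F_eqI) (auto simp: act_smult)
  show "act F g (f \<otimes>\<^bsub>F\<^esub> f') = act F g f \<otimes>\<^bsub>F\<^esub> act F g f'"
    if "g \<in> L'" "f \<in> carrier F" "f' \<in> carrier F" for g f f'
    using that by (rule act_F_mult)
  show "emb F \<one> = \<one>\<^bsub>F\<^esub>"
    by (simp add: tensor_over_field_def)
qed (auto simp: emb_F act_F_closed)

subsection \<open>Coordinates\<close>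

text \<open>
  Every element of \<open>A \<otimes>\<^bsub>M\<^esub> H\<close> is a unique sum of \<open>a \<otimes> g\<close> with \<open>g\<close> in a transversal of \<open>M\<close> in \<open>H\<close>;
  as \<open>a \<otimes> n g = a n \<otimes> g\<close>, the coefficient \<open>a\<close> of \<open>g\<close> is the following. Taken for all \<open>g\<close> in \<open>H\<close>,
  these coordinates depend on no choice of a transversal.
\<close>

definition coord :: "'g \<Rightarrow> ('g \<Rightarrow> 'a) \<Rightarrow> 'a" where
  "coord g f = (\<Oplus>\<^bsub>A\<^esub>n\<in>M. f (n \<otimes> g) \<otimes>\<^bsub>A\<^esub> emb A n)"

lemma M_in_H: "n \<in> M \<Longrightarrow> n \<in> H"
  using M_H by blast

lemma coord_closed [simp]: "\<lbrakk>g \<in> H; f \<in> carrier F\<rbrakk> \<Longrightarrow> coord g f \<in> carrier A"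
  by (auto simp: coord_def M_in_H emb_closed intro!: A.finsum_closed)

lemma additive_coord: "g \<in> H \<Longrightarrow> additive_map F A (coord g)"
  using F.F_add_app
  by (intro additive_mapI)
    (auto simp: A.abelian_group_axioms F.abelian_group_F coord_def M_in_H emb_closed A.l_distr
      simp flip: A.finsum_addf intro!: A.finsum_cong')

lemma coord_shift:
  assumes g: "g \<in> H" and m: "m \<in> M" and f: "f \<in> carrier F"
  shows "coord (m \<otimes> g) f \<otimes>\<^bsub>A\<^esub> emb A m = coord g f"
proof -
  note [simp] = M_in_H emb_closed M_carrier H_carrier
  have "coord (m \<otimes> g) f \<otimes>\<^bsub>A\<^esub> emb A m =
      (\<Oplus>\<^bsub>A\<^esub>n\<in>M. f ((n \<otimes> m) \<otimes> g) \<otimes>\<^bsub>A\<^esub> emb A (n \<otimes> m))"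
    using assms by (auto simp: coord_def A.finsum_ldistr finite_M emb_mult A.m_assoc m_assoc
        intro!: A.finsum_cong')
  also have "\<dots> = coord g f"
    unfolding coord_def using assms
    by (intro A.finsum_bij[where f = "\<lambda>n. f (n \<otimes> g) \<otimes>\<^bsub>A\<^esub> emb A n"]
        bij_betw_translate subgroup_M) auto
  finally show ?thesis .
qed

lemma coord_pure_tensor:
  assumes g: "g \<in> H" and x: "x \<in> H" and a: "a \<in> carrier A"
  shows "coord g (pure_tensor A H a x) = (if x \<otimes> inv g \<in> M then a \<otimes>\<^bsub>A\<^esub> emb A (x \<otimes> inv g) else \<zero>\<^bsub>A\<^esub>)"
proof -
  note [simp] = M_in_H emb_closed M_carrier H_carrier
  have eq: "n \<otimes> g = x \<longleftrightarrow> n = x \<otimes> inv g" if "n \<in> M" for n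
    using that g x by (auto simp: group_word)
  show ?thesis
  proof (cases "x \<otimes> inv g \<in> M")
    case True
    then have "coord g (pure_tensor A H a x) = pure_tensor A H a x ((x \<otimes> inv g) \<otimes> g) \<otimes>\<^bsub>A\<^esub> emb A (x \<otimes> inv g)"
      unfolding coord_def using g a eq
      by (intro A.finsum_eq_single finite_M) (auto simp: pure_tensor_app)
    then show ?thesis
      using True g x eq[OF True] by (simp add: pure_tensor_app)
  next
    case False
    then show ?thesis
      using g x a eq by (auto simp: coord_def pure_tensor_app intro!: A.add.finprod_one_eqI)
  qed
qed

text \<open>
  The coordinates of a product are additive expressions in the coordinates of either factor. So the
  common kernel of all coordinates is a two-sided ideal.
\<close>

lemma coord_mult:
  assumes g: "g \<in> H" and f: "f \<in> carrier F" and f': "f' \<in> carrier F"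
  shows "coord g (f \<otimes>\<^bsub>F\<^esub> f') = (\<Oplus>\<^bsub>A\<^esub>x\<in>H. f x \<otimes>\<^bsub>A\<^esub> act A x (coord (inv x \<otimes> g) f'))" (is ?left)
    and "coord g (f \<otimes>\<^bsub>F\<^esub> f') = (\<Oplus>\<^bsub>A\<^esub>x\<in>H. coord x f \<otimes>\<^bsub>A\<^esub> act A x (f' (inv x \<otimes> g)))" (is ?right)
proof -
  note [simp] = M_in_H emb_closed M_carrier H_carrier act_closed H_L g f f' finite_M finite_H
  let ?t = "\<lambda>x n. f x \<otimes>\<^bsub>A\<^esub> act A x (f' (inv x \<otimes> (n \<otimes> g))) \<otimes>\<^bsub>A\<^esub> emb A n"
  have "coord g (f \<otimes>\<^bsub>F\<^esub> f') = (\<Oplus>\<^bsub>A\<^esub>n\<in>M. \<Oplus>\<^bsub>A\<^esub>x\<in>H. ?t x n)"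
    by (auto simp: coord_def F_mult_app A.finsum_ldistr intro!: A.finsum_cong')
  moreover have "(\<Oplus>\<^bsub>A\<^esub>n\<in>M. \<Oplus>\<^bsub>A\<^esub>x\<in>H. ?t x n) = (\<Oplus>\<^bsub>A\<^esub>x\<in>H. \<Oplus>\<^bsub>A\<^esub>n\<in>M. ?t x n)"
    by (intro A.finsum_swap) auto
  moreover have "\<dots> = (\<Oplus>\<^bsub>A\<^esub>x\<in>H. f x \<otimes>\<^bsub>A\<^esub> act A x (coord (inv x \<otimes> g) f'))"
  proof (intro A.finsum_cong' refl)
    fix x assume x: "x \<in> H"
    have bij: "bij_betw (\<lambda>n. x \<otimes> n \<otimes> inv x) M M"
      using x M_normal[of x] M_normal[of "inv x"] by (intro bij_betw_conj) auto
    have "(\<Oplus>\<^bsub>A\<^esub>n\<in>M. ?t x n) = (\<Oplus>\<^bsub>A\<^esub>n\<in>M. ?t x (x \<otimes> n \<otimes> inv x))"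
      using x by (intro A.finsum_bij[OF bij, symmetric, where f = "?t x"]) simp
    also have "\<dots> = (\<Oplus>\<^bsub>A\<^esub>n\<in>M. f x \<otimes>\<^bsub>A\<^esub> act A x (f' (n \<otimes> (inv x \<otimes> g)) \<otimes>\<^bsub>A\<^esub> emb A n))"
    proof (intro A.finsum_cong' refl)
      fix n assume n: "n \<in> M"
      have "inv x \<otimes> (x \<otimes> n \<otimes> inv x \<otimes> g) = n \<otimes> (inv x \<otimes> g)"
        using x n by (simp add: group_word)
      then show "?t x (x \<otimes> n \<otimes> inv x) = f x \<otimes>\<^bsub>A\<^esub> act A x (f' (n \<otimes> (inv x \<otimes> g)) \<otimes>\<^bsub>A\<^esub> emb A n)"
        using x n M_normal[of x n] by (simp add: act_mult act_emb A.m_assoc)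
    qed (use x in auto)
    also have "\<dots> = f x \<otimes>\<^bsub>A\<^esub> act A x (coord (inv x \<otimes> g) f')"
      using x by (simp add: coord_def additive_map_finsum[OF additive_act] A.finsum_rdistr)
    finally show "(\<Oplus>\<^bsub>A\<^esub>n\<in>M. ?t x n) = f x \<otimes>\<^bsub>A\<^esub> act A x (coord (inv x \<otimes> g) f')" .
  qed auto
  ultimately show ?left by simp
  have "(\<Oplus>\<^bsub>A\<^esub>n\<in>M. \<Oplus>\<^bsub>A\<^esub>x\<in>H. ?t x n) = (\<Oplus>\<^bsub>A\<^esub>n\<in>M. \<Oplus>\<^bsub>A\<^esub>x\<in>H. f (n \<otimes> x) \<otimes>\<^bsub>A\<^esub> emb A n \<otimes>\<^bsub>A\<^esub> act A x (f' (inv x \<otimes> g)))"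
  proof (rule A.finsum_cong'[OF refl])
    fix n assume n: "n \<in> M"
    have bij: "bij_betw (\<lambda>x. n \<otimes> x) H H"
      using n by (intro bij_betw_translate subgroup_H) simp
    have "(\<Oplus>\<^bsub>A\<^esub>x\<in>H. ?t x n) = (\<Oplus>\<^bsub>A\<^esub>x\<in>H. ?t (n \<otimes> x) n)"
      using n by (intro A.finsum_bij[OF bij, symmetric, where f = "\<lambda>x. ?t x n"]) simp
    also have "\<dots> = (\<Oplus>\<^bsub>A\<^esub>x\<in>H. f (n \<otimes> x) \<otimes>\<^bsub>A\<^esub> emb A n \<otimes>\<^bsub>A\<^esub> act A x (f' (inv x \<otimes> g)))"
    proof (intro A.finsum_cong' refl)
      fix x assume x: "x \<in> H"
      have "inv (n \<otimes> x) \<otimes> (n \<otimes> g) = inv x \<otimes> g"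
        using x n by (simp add: group_word)
      then show "?t (n \<otimes> x) n = f (n \<otimes> x) \<otimes>\<^bsub>A\<^esub> emb A n \<otimes>\<^bsub>A\<^esub> act A x (f' (inv x \<otimes> g))"
        using x n act_inner[OF n, of "act A x (f' (inv x \<otimes> g))"]
        by (simp add: A.m_assoc flip: act_act)
    qed (use n in auto)
    finally show "(\<Oplus>\<^bsub>A\<^esub>x\<in>H. ?t x n) =
        (\<Oplus>\<^bsub>A\<^esub>x\<in>H. f (n \<otimes> x) \<otimes>\<^bsub>A\<^esub> emb A n \<otimes>\<^bsub>A\<^esub> act A x (f' (inv x \<otimes> g)))" .
  qed auto
  also have "\<dots> = (\<Oplus>\<^bsub>A\<^esub>x\<in>H. \<Oplus>\<^bsub>A\<^esub>n\<in>M. f (n \<otimes> x) \<otimes>\<^bsub>A\<^esub> emb A n \<otimes>\<^bsub>A\<^esub> act A x (f' (inv x \<otimes> g)))"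
    by (intro A.finsum_swap) auto
  also have "\<dots> = (\<Oplus>\<^bsub>A\<^esub>x\<in>H. coord x f \<otimes>\<^bsub>A\<^esub> act A x (f' (inv x \<otimes> g)))"
    by (auto simp: coord_def A.finsum_ldistr intro!: A.finsum_cong')
  finally show ?right
    using \<open>coord g (f \<otimes>\<^bsub>F\<^esub> f') = (\<Oplus>\<^bsub>A\<^esub>n\<in>M. \<Oplus>\<^bsub>A\<^esub>x\<in>H. ?t x n)\<close> by simp
qed

lemma coord_smult:
  assumes g: "g \<in> H" and c: "c \<in> carrier K" and f: "f \<in> carrier F"
  shows "coord g (c \<odot>\<^bsub>F\<^esub> f) = c \<odot>\<^bsub>A\<^esub> coord g f"
  using assms F.F_smult_app
  by (auto simp: coord_def M_in_H smult_mult emb_closed smult_closed additive_map_finsum[OF additive_smult]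
      intro!: A.finsum_cong')

lemma coord_act:
  assumes g: "g \<in> H" and h: "h \<in> L'" and f: "f \<in> carrier F"
  shows "coord g (act F h f) = act A h (coord (inv h \<otimes> g \<otimes> h) f)"
proof -
  have hL: "h \<in> L" "inv h \<in> L" using h L'_L by auto
  note [simp] = M_in_H emb_closed M_carrier H_carrier act_closed H_L g f h hL L'_carrier[OF h]
    H_normal'[OF h] M_normal[OF hL(1)] M_normal[OF hL(2), simplified]
  have bij: "bij_betw (\<lambda>n. h \<otimes> n \<otimes> inv h) M M"
    by (intro bij_betw_conj) auto
  let ?s = "\<lambda>n. act A h (f (inv h \<otimes> (n \<otimes> g) \<otimes> h)) \<otimes>\<^bsub>A\<^esub> emb A n"
  have s: "?s n \<in> carrier A" if "n \<in> M" for n using that by simp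
  have "coord g (act F h f) = (\<Oplus>\<^bsub>A\<^esub>n\<in>M. ?s n)"
    by (auto simp: coord_def act_F_app intro!: A.finsum_cong')
  also have "\<dots> = (\<Oplus>\<^bsub>A\<^esub>n\<in>M. ?s (h \<otimes> n \<otimes> inv h))"
    by (intro A.finsum_bij[OF bij, symmetric, where f = ?s] s)
  also have "\<dots> = (\<Oplus>\<^bsub>A\<^esub>n\<in>M. act A h (f (n \<otimes> (inv h \<otimes> g \<otimes> h)) \<otimes>\<^bsub>A\<^esub> emb A n))"
  proof (intro A.finsum_cong' refl)
    fix n assume n: "n \<in> M"
    have "inv h \<otimes> (h \<otimes> n \<otimes> inv h \<otimes> g) \<otimes> h = n \<otimes> (inv h \<otimes> g \<otimes> h)"
      using n by (simp add: group_word)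
    then show "?s (h \<otimes> n \<otimes> inv h) = act A h (f (n \<otimes> (inv h \<otimes> g \<otimes> h)) \<otimes>\<^bsub>A\<^esub> emb A n)"
      using n by (simp add: act_mult act_emb)
  qed auto
  also have "\<dots> = act A h (coord (inv h \<otimes> g \<otimes> h) f)"
    by (simp add: coord_def additive_map_finsum[OF additive_act])
  finally show ?thesis .
qed

subsection \<open>The balancing ideal\<close>

text \<open>
  A transversal has to be chosen: a sum of \<open>coord x f \<otimes> x\<close> over the whole of \<open>H\<close> counts every coset
  \<open>|M|\<close> times, and this number may be zero in the field.
\<close>

definition rep :: "'g \<Rightarrow> 'g" where
  "rep x = (SOME y. y \<in> M #> x)"

lemma rep_in_coset: "x \<in> H \<Longrightarrow> rep x \<in> M #> x"
  unfolding rep_def by (rule someI[of _ x]) (auto simp: r_coset_def H_carrier intro!: bexI[of _ \<one>])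

lemma
  assumes x: "x \<in> H"
  shows rep_H: "rep x \<in> H" and rep_M: "x \<otimes> inv (rep x) \<in> M"
    and rep_shift: "n \<in> M \<Longrightarrow> rep (n \<otimes> x) = rep x"
proof -
  obtain m where m: "m \<in> M" "rep x = m \<otimes> x"
    using rep_in_coset[OF x] by (auto simp: r_coset_def)
  then show "rep x \<in> H" "x \<otimes> inv (rep x) \<in> M"
    using x by (simp_all add: M_in_H group_word M_carrier H_carrier)
  show "rep (n \<otimes> x) = rep x" if n: "n \<in> M"
  proof -
    have "M #> (n \<otimes> x) = M #> n #> x"
      using n x M_carrier by (simp add: coset_mult_assoc subsetI H_carrier)
    also have "M #> n = M"
      using n by (simp add: coset_join2 M_carrier subgroup_M)
    finally show ?thesis by (simp add: rep_def)
  qed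
qed

lemma rep_rep: "x \<in> H \<Longrightarrow> rep (rep x) = rep x"
  using rep_shift[of "rep x" "x \<otimes> inv (rep x)"] rep_H rep_M by (simp add: group_word H_carrier)

definition balancing_gen :: "'a \<Rightarrow> 'g \<Rightarrow> 'g \<Rightarrow> 'g \<Rightarrow> 'a" where
  "balancing_gen a n x = pure_tensor A H (a \<otimes>\<^bsub>A\<^esub> emb A n) x \<ominus>\<^bsub>F\<^esub> pure_tensor A H a (n \<otimes> x)"

lemma balancing_gen_closed: "\<lbrakk>a \<in> carrier A; n \<in> M; x \<in> H\<rbrakk> \<Longrightarrow> balancing_gen a n x \<in> carrier F"
  by (simp add: balancing_gen_def M_in_H emb_closed)

lemma balancing_generate:
  "balancing G A M H = generate (add_monoid F) {balancing_gen a n x |a n x. a \<in> carrier A \<and> n \<in> M \<and> x \<in> H}"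
  by (simp add: balancing_def balancing_gen_def)

lemma subgroup_balancing: "subgroup (balancing G A M H) (add_monoid F)"
  unfolding balancing_generate
  by (rule F.F.add.generate_is_subgroup) (auto intro: balancing_gen_closed[simplified])

text \<open>
  The coordinates vanish on the relations by a direct calculation. Conversely, modulo the relations,
  \<open>f\<close> is the sum of the \<open>coord x f \<otimes> x\<close> over a transversal, which is zero if the coordinates are.
\<close>

lemma balancing_eq:
  "balancing G A M H = {f \<in> carrier F. \<forall>g\<in>H. coord g f = \<zero>\<^bsub>A\<^esub>}"
proof (intro equalityI subsetI)
  fix f assume f: "f \<in> balancing G A M H"
  have "coord g f = \<zero>\<^bsub>A\<^esub>" if g: "g \<in> H" for g
  proof -
    have 0: "coord g (balancing_gen a n x) = \<zero>\<^bsub>A\<^esub>" if "a \<in> carrier A" "n \<in> M" "x \<in> H" for a n x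
    proof -
      have "n \<otimes> (x \<otimes> inv g) \<in> M \<longleftrightarrow> x \<otimes> inv g \<in> M"
      proof
        assume "n \<otimes> (x \<otimes> inv g) \<in> M"
        then have "inv n \<otimes> (n \<otimes> (x \<otimes> inv g)) \<in> M" using that by simp
        then show "x \<otimes> inv g \<in> M" using that g by (simp add: group_word M_carrier H_carrier)
      qed (use that in simp)
      then show ?thesis
        using that g
        by (auto simp: balancing_gen_def additive_map_minus[OF additive_coord] M_in_H emb_closed
            coord_pure_tensor m_assoc M_carrier H_carrier emb_mult A.m_assoc A.minus_eq A.r_neg)
    qed
    have "coord g f \<in> {\<zero>\<^bsub>A\<^esub>}"
      by (rule additive_map_generate[OF additive_coord[OF g] _ _ _ f[unfolded balancing_generate]])
        (auto simp: 0 balancing_gen_closed A.add.triv_subgroup[simplified])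
    then show ?thesis by simp
  qed
  then show "f \<in> {f \<in> carrier F. \<forall>g\<in>H. coord g f = \<zero>\<^bsub>A\<^esub>}"
    using f subgroup.subset[OF subgroup_balancing] by auto
next
  fix f assume "f \<in> {f \<in> carrier F. \<forall>g\<in>H. coord g f = \<zero>\<^bsub>A\<^esub>}"
  then have f: "f \<in> carrier F" and 0: "\<And>g. g \<in> H \<Longrightarrow> coord g f = \<zero>\<^bsub>A\<^esub>" by auto
  note [simp] = M_in_H emb_closed M_carrier H_carrier f rep_H rep_M
  let ?n = "\<lambda>x. x \<otimes> inv (rep x)"
  let ?s = "\<lambda>x. balancing_gen (f x) (?n x) (rep x)"
  have s: "?s x \<in> carrier F" if "x \<in> H" for x using that by (intro balancing_gen_closed) auto
  have sum: "(\<Oplus>\<^bsub>F\<^esub>x\<in>H. ?s x) \<in> balancing G A M H"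
    unfolding balancing_generate
    by (rule F.F.finsum_in_subgroup[OF subgroup_balancing[unfolded balancing_generate]])
      (auto intro!: generate.incl exI)
  \<comment> \<open>Moving every term \<open>f x \<otimes> x\<close> to the representative of its coset collects the coordinates of \<open>f\<close>.\<close>
  have "(\<Oplus>\<^bsub>F\<^esub>x\<in>H. ?s x) = \<ominus>\<^bsub>F\<^esub> f"
  proof (rule F_eqI)
    fix z assume z: "z \<in> H"
    let ?a = "\<lambda>x. if z = rep x then f x \<otimes>\<^bsub>A\<^esub> emb A (?n x) else \<zero>\<^bsub>A\<^esub>"
    let ?b = "\<lambda>x. if x = z then \<ominus>\<^bsub>A\<^esub> f z else \<zero>\<^bsub>A\<^esub>"
    have eval: "additive_map F A (\<lambda>f. f z)" using F.additive_eval z by simp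
    have term_eq: "?s x z = ?a x \<oplus>\<^bsub>A\<^esub> ?b x" if x: "x \<in> H" for x
      using x z by (auto simp: balancing_gen_def additive_map_minus[OF eval] pure_tensor_app group_word A.minus_eq)
    have "(\<Oplus>\<^bsub>F\<^esub>x\<in>H. ?s x) z = (\<Oplus>\<^bsub>A\<^esub>x\<in>H. ?s x z)"
      using z s by (intro F.finsum_eval) auto
    also have "\<dots> = (\<Oplus>\<^bsub>A\<^esub>x\<in>H. ?a x \<oplus>\<^bsub>A\<^esub> ?b x)"
      by (rule A.finsum_cong'[OF refl _ term_eq]) (use z in auto)
    also have "\<dots> = (\<Oplus>\<^bsub>A\<^esub>x\<in>H. ?a x) \<oplus>\<^bsub>A\<^esub> (\<Oplus>\<^bsub>A\<^esub>x\<in>H. ?b x)"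
      using z by (intro A.finsum_addf) auto
    also have "(\<Oplus>\<^bsub>A\<^esub>x\<in>H. ?b x) = \<ominus>\<^bsub>A\<^esub> f z"
      using z by (simp add: A.finsum_delta finite_H)
    also have "(\<Oplus>\<^bsub>A\<^esub>x\<in>H. ?a x) = \<zero>\<^bsub>A\<^esub>"
    proof (cases "rep z = z")
      case True
      have bij: "bij_betw (\<lambda>n. n \<otimes> z) M {x \<in> H. rep x = z}"
      proof (rule bij_betw_byWitness[where f' = "\<lambda>x. x \<otimes> inv z"])
        show "(\<lambda>n. n \<otimes> z) ` M \<subseteq> {x \<in> H. rep x = z}" using z True by (auto simp: rep_shift)
        show "(\<lambda>x. x \<otimes> inv z) ` {x \<in> H. rep x = z} \<subseteq> M" using rep_M by auto
      qed (use z in \<open>auto simp: group_word\<close>)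
      have "(\<Oplus>\<^bsub>A\<^esub>x\<in>H. ?a x) = (\<Oplus>\<^bsub>A\<^esub>x\<in>{x \<in> H. rep x = z}. ?a x)"
        by (rule A.add.finprod_mono_neutral_cong_right) (auto simp: finite_H)
      also have "\<dots> = (\<Oplus>\<^bsub>A\<^esub>n\<in>M. ?a (n \<otimes> z))"
        by (rule A.finsum_bij[OF bij, symmetric]) auto
      also have "\<dots> = coord z f"
        unfolding coord_def using z True by (intro A.finsum_cong') (auto simp: rep_shift group_word)
      finally show ?thesis using 0 z by simp
    next
      case False
      then have "z \<noteq> rep x" if "x \<in> H" for x using that rep_rep by metis
      then show ?thesis by (intro A.add.finprod_one_eqI) auto
    qed
    finally show "(\<Oplus>\<^bsub>F\<^esub>x\<in>H. ?s x) z = (\<ominus>\<^bsub>F\<^esub> f) z"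
      using z by (simp add: additive_map_neg[OF eval])
  qed (use s in \<open>auto intro!: F.F.finsum_closed\<close>)
  then have "\<ominus>\<^bsub>F\<^esub> f \<in> balancing G A M H" using sum by simp
  then have "\<ominus>\<^bsub>F\<^esub> (\<ominus>\<^bsub>F\<^esub> f) \<in> balancing G A M H"
    unfolding a_inv_def by (rule subgroup.m_inv_closed[OF subgroup_balancing])
  then show "f \<in> balancing G A M H" by simp
qed

sublocale balancing: int_alg_ideal G K H L' F "balancing G A M H"
proof (intro int_alg_ideal.intro int_algI interior_F int_alg_ideal_axioms.intro)
  show "ideal (balancing G A M H) F"
  proof (rule idealI[OF F_ring subgroup_balancing])
    fix f f' assume f: "f \<in> balancing G A M H" and f': "f' \<in> carrier F"
    then have fF: "f \<in> carrier F" and 0: "\<And>g. g \<in> H \<Longrightarrow> coord g f = \<zero>\<^bsub>A\<^esub>" by (auto simp: balancing_eq)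
    show "f' \<otimes>\<^bsub>F\<^esub> f \<in> balancing G A M H"
      using fF f' by (auto simp: balancing_eq coord_mult(1) 0 act_zero H_L intro!: A.add.finprod_one_eqI)
    show "f \<otimes>\<^bsub>F\<^esub> f' \<in> balancing G A M H"
      using fF f' by (auto simp: balancing_eq coord_mult(2) 0 act_closed H_L intro!: A.add.finprod_one_eqI)
  qed
  show "c \<odot>\<^bsub>F\<^esub> f \<in> balancing G A M H" if "c \<in> carrier K" "f \<in> balancing G A M H" for c f
    using that additive_map_zero[OF additive_smult] F.F_smult_closed by (auto simp: balancing_eq coord_smult)
  show "act F g f \<in> balancing G A M H" if "g \<in> L'" "f \<in> balancing G A M H" for g f
    using that L'_L by (auto simp: balancing_eq coord_act act_F_closed H_normal' act_zero)
qed

subsection \<open>The universal property\<close>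

context
  fixes B and \<iota>
  assumes B: "interior_algebra K G H L' B" and \<iota>: "interior_hom K M L' A B \<iota>"
begin

text \<open>
  The homomorphism with \<open>a \<otimes> x \<mapsto> \<iota> a \<cdot> x\<close>, on \<open>A \<otimes>\<^bsub>k\<^esub> kH\<close>. It is multiplicative because \<open>x b = \<^sup>xb x\<close> holds in \<open>B\<close>.
\<close>

definition extend where
  "extend f = (\<Oplus>\<^bsub>B\<^esub>x\<in>H. \<iota> (f x) \<otimes>\<^bsub>B\<^esub> emb B x)"

interpretation B: int_alg G K H L' B by (rule int_algI[OF B])

lemma additive_extend: "additive_map F B extend"
  using F.F_add_app
  by (intro additive_mapI)
    (auto simp: B.A.abelian_group_axioms F.F.abelian_group_axioms extend_def interior_homD[OF \<iota>]
      B.emb_closed B.A.l_distr simp flip: B.A.finsum_addf intro!: B.A.finsum_cong' B.A.finsum_closed)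

lemma extend_pure_tensor:
  assumes a: "a \<in> carrier A" and x: "x \<in> H"
  shows "extend (pure_tensor A H a x) = \<iota> a \<otimes>\<^bsub>B\<^esub> emb B x"
proof -
  have "\<iota> \<zero>\<^bsub>A\<^esub> = \<zero>\<^bsub>B\<^esub>"
    using interior_hom_additive[OF \<iota> A.ring_axioms B.A.ring_axioms] by (rule additive_map_zero)
  then have "extend (pure_tensor A H a x) = \<iota> (pure_tensor A H a x x) \<otimes>\<^bsub>B\<^esub> emb B x"
    unfolding extend_def using assms
    by (intro B.A.finsum_eq_single finite_H) (auto simp: pure_tensor_app interior_homD[OF \<iota>] B.emb_closed)
  then show ?thesis using x by (simp add: pure_tensor_app)
qed

lemma extend_mult:
  assumes f: "f \<in> carrier F" and f': "f' \<in> carrier F"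
  shows "extend (f \<otimes>\<^bsub>F\<^esub> f') = extend f \<otimes>\<^bsub>B\<^esub> extend f'"
proof -
  note \<iota>D = interior_homD[OF \<iota>]
  have add: "additive_map A B \<iota>" by (rule interior_hom_additive[OF \<iota> A.ring_axioms B.A.ring_axioms])
  note [simp] = f f' \<iota>D(1) B.emb_closed act_closed H_L H_carrier finite_H B.act_closed subsetD[OF H_L']
  let ?t = "\<lambda>x z. \<iota> (f x) \<otimes>\<^bsub>B\<^esub> act B x (\<iota> (f' (inv x \<otimes> z))) \<otimes>\<^bsub>B\<^esub> emb B z"
  have "extend (f \<otimes>\<^bsub>F\<^esub> f') = (\<Oplus>\<^bsub>B\<^esub>z\<in>H. \<Oplus>\<^bsub>B\<^esub>x\<in>H. ?t x z)"
    unfolding extend_def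
    by (intro B.A.finsum_cong') (auto simp: F_mult_app additive_map_finsum[OF add] \<iota>D B.A.finsum_ldistr
        intro!: B.A.finsum_cong')
  also have "\<dots> = (\<Oplus>\<^bsub>B\<^esub>x\<in>H. \<Oplus>\<^bsub>B\<^esub>z\<in>H. ?t x z)"
    by (intro B.A.finsum_swap) auto
  also have "\<dots> = (\<Oplus>\<^bsub>B\<^esub>x\<in>H. (\<iota> (f x) \<otimes>\<^bsub>B\<^esub> emb B x) \<otimes>\<^bsub>B\<^esub> extend f')"
  proof (intro B.A.finsum_cong' refl)
    fix x assume x: "x \<in> H"
    have bij: "bij_betw (\<lambda>y. x \<otimes> y) H H" by (rule bij_betw_translate[OF subgroup_H x])
    have "(\<Oplus>\<^bsub>B\<^esub>z\<in>H. ?t x z) = (\<Oplus>\<^bsub>B\<^esub>y\<in>H. ?t x (x \<otimes> y))"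
      using x by (intro B.A.finsum_bij[OF bij, symmetric, where f = "?t x"]) simp
    also have "\<dots> = (\<Oplus>\<^bsub>B\<^esub>y\<in>H. \<iota> (f x) \<otimes>\<^bsub>B\<^esub> emb B x \<otimes>\<^bsub>B\<^esub> (\<iota> (f' y) \<otimes>\<^bsub>B\<^esub> emb B y))"
    proof (intro B.A.finsum_cong' refl)
      fix y assume y: "y \<in> H"
      have "?t x (x \<otimes> y) = \<iota> (f x) \<otimes>\<^bsub>B\<^esub> (act B x (\<iota> (f' y)) \<otimes>\<^bsub>B\<^esub> emb B x) \<otimes>\<^bsub>B\<^esub> emb B y"
        using x y by (simp add: inv_cancel_left B.emb_mult B.A.m_assoc)
      also have "\<dots> = \<iota> (f x) \<otimes>\<^bsub>B\<^esub> emb B x \<otimes>\<^bsub>B\<^esub> (\<iota> (f' y) \<otimes>\<^bsub>B\<^esub> emb B y)"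
        using x y by (simp add: B.act_inner B.A.m_assoc)
      finally show "?t x (x \<otimes> y) = \<iota> (f x) \<otimes>\<^bsub>B\<^esub> emb B x \<otimes>\<^bsub>B\<^esub> (\<iota> (f' y) \<otimes>\<^bsub>B\<^esub> emb B y)" .
    qed (use x in auto)
    also have "\<dots> = \<iota> (f x) \<otimes>\<^bsub>B\<^esub> emb B x \<otimes>\<^bsub>B\<^esub> extend f'"
      using x by (simp add: extend_def B.A.finsum_rdistr)
    finally show "(\<Oplus>\<^bsub>B\<^esub>z\<in>H. ?t x z) = \<iota> (f x) \<otimes>\<^bsub>B\<^esub> emb B x \<otimes>\<^bsub>B\<^esub> extend f'" .
  qed (use additive_map_closed[OF additive_extend] in auto)
  also have "\<dots> = extend f \<otimes>\<^bsub>B\<^esub> extend f'"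
    using additive_map_closed[OF additive_extend f']
    by (simp add: extend_def[of f] B.A.finsum_ldistr)
  finally show ?thesis .
qed

lemma extend_hom: "interior_hom K H L' F B extend"
proof (rule interior_homI)
  note \<iota>D = interior_homD[OF \<iota>]
  show "extend \<one>\<^bsub>F\<^esub> = \<one>\<^bsub>B\<^esub>"
    using extend_pure_tensor[of "\<one>\<^bsub>A\<^esub>" \<one>] by (simp add: tensor_over_field_def \<iota>D B.emb_one)
  show "extend (emb F x) = emb B x" if "x \<in> H" for x
    using that by (simp add: emb_F extend_pure_tensor \<iota>D B.emb_closed)
  show "extend (c \<odot>\<^bsub>F\<^esub> f) = c \<odot>\<^bsub>B\<^esub> extend f" if "c \<in> carrier K" "f \<in> carrier F" for c f
    using that F.F_smult_app
    by (auto simp: extend_def \<iota>D B.smult_mult B.emb_closed B.smult_closed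
        additive_map_finsum[OF B.additive_smult] intro!: B.A.finsum_cong')
  show "extend (act F g f) = act B g (extend f)" if g: "g \<in> L'" and f: "f \<in> carrier F" for g f
  proof -
    note [simp] = g f \<iota>D B.emb_closed B.act_closed H_normal[OF g] H_normal'[OF g] H_carrier
      L'_carrier[OF g] act_closed subsetD[OF L'_L g]
    let ?t = "\<lambda>x. \<iota> (act F g f x) \<otimes>\<^bsub>B\<^esub> emb B x"
    have "act B g (extend f) = (\<Oplus>\<^bsub>B\<^esub>x\<in>H. act B g (\<iota> (f x) \<otimes>\<^bsub>B\<^esub> emb B x))"
      unfolding extend_def by (subst additive_map_finsum[OF B.additive_act]) auto
    also have "\<dots> = (\<Oplus>\<^bsub>B\<^esub>x\<in>H. ?t (g \<otimes> x \<otimes> inv g))"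
    proof (intro B.A.finsum_cong' refl)
      fix x assume x: "x \<in> H"
      have "inv g \<otimes> (g \<otimes> x \<otimes> inv g) \<otimes> g = x" using x by (simp add: group_word)
      then show "act B g (\<iota> (f x) \<otimes>\<^bsub>B\<^esub> emb B x) = ?t (g \<otimes> x \<otimes> inv g)"
        using x by (simp add: act_F_app B.act_mult B.act_emb)
    qed (auto simp: act_F_app)
    also have "\<dots> = extend (act F g f)"
      unfolding extend_def by (intro B.A.finsum_bij[OF bij_conj[OF g], where f = ?t]) (auto simp: act_F_app)
    finally show ?thesis by simp
  qed
qed (auto simp: extend_mult additive_map_add[OF additive_extend] additive_map_closed[OF additive_extend])

lemma extend_balancing:
  assumes f: "f \<in> balancing G A M H" shows "extend f = \<zero>\<^bsub>B\<^esub>"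
proof -
  note \<iota>D = interior_homD[OF \<iota>]
  have 0: "extend (balancing_gen a n x) = \<zero>\<^bsub>B\<^esub>" if "a \<in> carrier A" "n \<in> M" "x \<in> H" for a n x
    using that
    by (simp add: balancing_gen_def additive_map_minus[OF additive_extend] extend_pure_tensor M_in_H emb_closed
        \<iota>D B.emb_mult B.emb_closed B.A.m_assoc)
  have "extend f \<in> {\<zero>\<^bsub>B\<^esub>}"
    by (rule additive_map_generate[OF additive_extend _ _ _ f[unfolded balancing_generate]])
      (auto simp: 0 balancing_gen_closed B.A.add.triv_subgroup[simplified])
  then show ?thesis by simp
qed

end

subsection \<open>Coordinates of elements of the tensor product\<close>

abbreviation AH where "AH \<equiv> quot_alg F (balancing G A M H)"

lemma F_cls_closed: "f \<in> carrier F \<Longrightarrow> balancing.cls f \<in> carrier AH"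
  by (simp add: balancing.quot_carrier)

lemma coord_cls_cong:
  assumes "f \<in> carrier F" "f' \<in> carrier F"
  shows "balancing.cls f = balancing.cls f' \<longleftrightarrow> (\<forall>g\<in>H. coord g f = coord g f')"
proof -
  have "f \<ominus>\<^bsub>F\<^esub> f' \<in> carrier F" using assms by (rule F.F.minus_closed)
  then have "balancing.cls f = balancing.cls f' \<longleftrightarrow> (\<forall>g\<in>H. coord g f \<ominus>\<^bsub>A\<^esub> coord g f' = \<zero>\<^bsub>A\<^esub>)"
    using assms
    by (subst balancing.cls_eq_iff[OF assms], subst balancing_eq)
      (simp add: additive_map_minus[OF additive_coord])
  moreover have "coord g f \<ominus>\<^bsub>A\<^esub> coord g f' = \<zero>\<^bsub>A\<^esub> \<longleftrightarrow> coord g f = coord g f'" if "g \<in> H" for g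
    using assms that by (intro A.r_right_minus_eq coord_closed)
  ultimately show ?thesis by blast
qed

text \<open>
  Any representative may be taken, since \<open>coord\<close> is constant on the classes.
\<close>

definition coord_class :: "'g \<Rightarrow> ('g \<Rightarrow> 'a) set \<Rightarrow> 'a" where
  "coord_class g C = coord g (SOME f. f \<in> carrier F \<and> C = balancing.cls f)"

lemma coord_class_cls:
  assumes "g \<in> H" "f \<in> carrier F"
  shows "coord_class g (balancing.cls f) = coord g f"
proof -
  let ?f = "SOME f'. f' \<in> carrier F \<and> balancing.cls f = balancing.cls f'"
  have "?f \<in> carrier F \<and> balancing.cls f = balancing.cls ?f"
    by (rule someI[of "\<lambda>f'. f' \<in> carrier F \<and> balancing.cls f = balancing.cls f'"])
      (rule conjI[OF assms(2) refl])
  then have "coord g f = coord g ?f"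
    using assms coord_cls_cong[of f ?f] by blast
  then show ?thesis unfolding coord_class_def by (rule sym)
qed

lemma AH_eqI:
  assumes "C \<in> carrier AH" "C' \<in> carrier AH" "\<And>g. g \<in> H \<Longrightarrow> coord_class g C = coord_class g C'"
  shows "C = C'"
proof -
  obtain f where f: "f \<in> carrier F" "C = balancing.cls f" using assms(1) by (rule balancing.quot_carrierE)
  obtain f' where f': "f' \<in> carrier F" "C' = balancing.cls f'" using assms(2) by (rule balancing.quot_carrierE)
  show ?thesis using assms(3) f f' by (simp add: coord_cls_cong coord_class_cls)
qed

lemma additive_coord_class: "g \<in> H \<Longrightarrow> additive_map AH A (coord_class g)"
  using balancing.ring_quot
  by (intro additive_mapI)
    (auto simp: A.abelian_group_axioms ring_def balancing.quot_ops coord_class_cls F.F_add_closed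
      additive_map_add[OF additive_coord] elim!: balancing.quot_carrierE)

lemma coord_class_shift:
  assumes "g \<in> H" "m \<in> M" "C \<in> carrier AH"
  shows "coord_class (m \<otimes> g) C \<otimes>\<^bsub>A\<^esub> emb A m = coord_class g C"
  using assms by (auto elim!: balancing.quot_carrierE simp: coord_class_cls M_in_H coord_shift)

definition incl :: "'a \<Rightarrow> ('g \<Rightarrow> 'a) set" where
  "incl a = balancing.cls (pure_tensor A H a \<one>)"

lemma pure_tensor_mult_emb:
  assumes "a \<in> carrier A" "x \<in> H"
  shows "pure_tensor A H a \<one> \<otimes>\<^bsub>F\<^esub> emb F x = pure_tensor A H a x"
proof (rule F_eqI)
  fix z assume z: "z \<in> H"
  have "z \<otimes> inv x = \<one> \<longleftrightarrow> z = x"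
    using z assms inv_equality[of z "inv x"] by (auto simp: H_carrier)
  then show "(pure_tensor A H a \<one> \<otimes>\<^bsub>F\<^esub> emb F x) z = pure_tensor A H a x z"
    using z assms by (simp add: mult_emb_app pure_tensor_app)
qed (use assms in \<open>auto simp: emb_F intro!: FR.m_closed\<close>)

lemma coord_class_incl_emb:
  assumes "a \<in> carrier A" "x \<in> H" "g \<in> H"
  shows "coord_class g (incl a \<otimes>\<^bsub>AH\<^esub> emb AH x) =
    (if x \<otimes> inv g \<in> M then a \<otimes>\<^bsub>A\<^esub> emb A (x \<otimes> inv g) else \<zero>\<^bsub>A\<^esub>)"
  using assms pure_tensor_mult_emb[OF assms(1,2)]
  by (simp add: incl_def balancing.quot_ops emb_F coord_class_cls coord_pure_tensor)

lemma incl_emb: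
  assumes "n \<in> M" shows "incl (emb A n) = emb AH n"
proof -
  have "pure_tensor A H (emb A n) \<one> \<ominus>\<^bsub>F\<^esub> pure_tensor A H \<one>\<^bsub>A\<^esub> n = balancing_gen \<one>\<^bsub>A\<^esub> n \<one>"
    using assms by (simp add: balancing_gen_def emb_closed M_carrier)
  also have "\<dots> \<in> balancing G A M H"
    unfolding balancing_generate using assms by (intro generate.incl) (auto intro!: exI)
  finally show ?thesis
    using assms by (simp add: incl_def balancing.quot_ops emb_F balancing.cls_eq_iff emb_closed M_in_H)
qed

lemma incl_hom: "interior_hom K M L' A AH incl"
proof (rule interior_homI)
  show "incl (a \<otimes>\<^bsub>A\<^esub> b) = incl a \<otimes>\<^bsub>AH\<^esub> incl b" if "a \<in> carrier A" "b \<in> carrier A" for a b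
  proof -
    have "pure_tensor A H (a \<otimes>\<^bsub>A\<^esub> b) \<one> = pure_tensor A H a \<one> \<otimes>\<^bsub>F\<^esub> pure_tensor A H b \<one>"
      using that by (intro F_eqI) (auto simp: pure_tensor_mult_app pure_tensor_app act_group_one H_carrier)
    then show ?thesis using that by (simp add: incl_def balancing.quot_ops)
  qed
  show "incl (a \<oplus>\<^bsub>A\<^esub> b) = incl a \<oplus>\<^bsub>AH\<^esub> incl b" if "a \<in> carrier A" "b \<in> carrier A" for a b
  proof -
    have "pure_tensor A H (a \<oplus>\<^bsub>A\<^esub> b) \<one> = pure_tensor A H a \<one> \<oplus>\<^bsub>F\<^esub> pure_tensor A H b \<one>"
      using that F.F_add_app by (intro F_eqI) (auto simp: pure_tensor_app)
    then show ?thesis using that by (simp add: incl_def balancing.quot_ops)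
  qed
  show "incl (c \<odot>\<^bsub>A\<^esub> a) = c \<odot>\<^bsub>AH\<^esub> incl a" if "c \<in> carrier K" "a \<in> carrier A" for c a
  proof -
    have "pure_tensor A H (c \<odot>\<^bsub>A\<^esub> a) \<one> = c \<odot>\<^bsub>F\<^esub> pure_tensor A H a \<one>"
      using that F.F_smult_app F.F_smult_closed additive_map_zero[OF additive_smult]
      by (intro F_eqI) (auto simp: pure_tensor_app smult_closed)
    then show ?thesis using that by (simp add: incl_def balancing.quot_smult)
  qed
  show "incl (act A g a) = act AH g (incl a)" if g: "g \<in> L'" and a: "a \<in> carrier A" for g a
  proof -
    have gL: "g \<in> L" using g L'_L by blast
    have "inv g \<otimes> z \<otimes> g = \<one> \<longleftrightarrow> z = \<one>" if "z \<in> H" for z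
    proof
      assume "inv g \<otimes> z \<otimes> g = \<one>"
      then have "g \<otimes> (inv g \<otimes> z \<otimes> g) \<otimes> inv g = g \<otimes> \<one> \<otimes> inv g" by simp
      then show "z = \<one>" using g that by (simp add: group_word H_carrier L'_carrier)
    qed (use g L'_carrier in simp)
    then have "pure_tensor A H (act A g a) \<one> = act F g (pure_tensor A H a \<one>)"
      using g a gL by (intro F_eqI) (auto simp: pure_tensor_app act_F_app H_normal' act_closed act_zero act_F_closed)
    then show ?thesis using g a by (simp add: incl_def balancing.quot_act)
  qed
  show "incl \<one>\<^bsub>A\<^esub> = \<one>\<^bsub>AH\<^esub>"
    using incl_emb[OF M_simps(1)] balancing.quot_ops(3) int_alg.emb_one[OF int_algI[OF balancing.interior_quot]]
    by (simp add: emb_one)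
qed (auto simp: incl_def F_cls_closed incl_emb[unfolded incl_def])

text \<open>
  The reason is that \<open>n (a \<otimes> g) = n a n\<^sup>-\<^sup>1 \<otimes> n g = n a \<otimes> g\<close>.
\<close>

lemma coord_emb_mult:
  assumes n: "n \<in> M" and g: "g \<in> H" and f: "f \<in> carrier F"
  shows "coord g (emb F n \<otimes>\<^bsub>F\<^esub> f) = emb A n \<otimes>\<^bsub>A\<^esub> coord g f"
proof -
  note [simp] = M_in_H[OF n] M_carrier[OF n] H_carrier[OF g] H_L[OF M_in_H[OF n]] act_closed emb_closed
  have shift: "coord (inv n \<otimes> g) f = coord g f \<otimes>\<^bsub>A\<^esub> emb A n"
    using coord_shift[of "inv n \<otimes> g" n f] n g f by (simp add: inv_cancel_left)
  have "coord g (emb F n \<otimes>\<^bsub>F\<^esub> f) =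
      (\<Oplus>\<^bsub>A\<^esub>x\<in>H. pure_tensor A H \<one>\<^bsub>A\<^esub> n x \<otimes>\<^bsub>A\<^esub> act A x (coord (inv x \<otimes> g) f))"
    using n g f by (simp add: coord_mult(1) emb_F)
  also have "\<dots> = pure_tensor A H \<one>\<^bsub>A\<^esub> n n \<otimes>\<^bsub>A\<^esub> act A n (coord (inv n \<otimes> g) f)"
    using n g f by (intro A.finsum_eq_single finite_H) (auto simp: pure_tensor_app H_L)
  also have "\<dots> = act A n (coord g f \<otimes>\<^bsub>A\<^esub> emb A n)"
    using n g f by (simp add: pure_tensor_app shift)
  also have "\<dots> = act A n (coord g f) \<otimes>\<^bsub>A\<^esub> emb A n"
    using n g f by (simp add: act_mult act_emb group_word)
  also have "\<dots> = emb A n \<otimes>\<^bsub>A\<^esub> coord g f"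
    using n g f by (simp add: act_inner)
  finally show ?thesis .
qed

end

section \<open>Automorphisms of \<open>P\<close> induced by conjugation\<close>

locale brauer_group = group G for G :: "('g, 'n) monoid_scheme" (structure) +
  fixes N P :: "'g set" and T :: "('g \<Rightarrow> 'g) set"
  assumes finite_G: "finite (carrier G)" and normal_N: "N \<lhd> G" and subgroup_P: "subgroup P G"
    and T_def: "T = {\<phi> \<in> Aut_by G P. \<forall>u\<in>P. \<phi> u \<otimes> inv u \<in> N}"
begin

abbreviation NP where "NP \<equiv> normalizer G P"
abbreviation NT where "NT \<equiv> normalizer_T G P T"
abbreviation c where "c \<equiv> conj_on G P"

lemma subgroup_NP: "subgroup NP G"
  using subgroup_P by (intro normalizer_imp_subgroup subgroup.subset)

lemma P_carrier: "u \<in> P \<Longrightarrow> u \<in> carrier G"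
  and NP_carrier: "u \<in> NP \<Longrightarrow> u \<in> carrier G"
  using subgroup_P subgroup_NP subgroup.subset by blast+

lemma P_NP: "u \<in> P \<Longrightarrow> u \<in> NP"
  and P_conj: "\<lbrakk>g \<in> NP; u \<in> P\<rbrakk> \<Longrightarrow> g \<otimes> u \<otimes> inv g \<in> P"
  using subgroup_in_normalizer[OF subgroup_P] normal_in_subgroup_iff[OF subgroup_NP] by blast+

lemma NP_simps [simp]: "\<one> \<in> NP" "\<lbrakk>x \<in> NP; y \<in> NP\<rbrakk> \<Longrightarrow> x \<otimes> y \<in> NP" "x \<in> NP \<Longrightarrow> inv x \<in> NP"
  and P_simps [simp]: "\<one> \<in> P" "\<lbrakk>x \<in> P; y \<in> P\<rbrakk> \<Longrightarrow> x \<otimes> y \<in> P" "x \<in> P \<Longrightarrow> inv x \<in> P"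
  using subgroup_NP subgroup_P by (auto simp: subgroup_def)

lemma P_conj': "\<lbrakk>g \<in> NP; u \<in> P\<rbrakk> \<Longrightarrow> inv g \<otimes> u \<otimes> g \<in> P"
  using P_conj[of "inv g" u] by (simp add: NP_carrier)

lemma subgroup_N: "subgroup N G"
  and N_conj: "\<lbrakk>g \<in> carrier G; n \<in> N\<rbrakk> \<Longrightarrow> g \<otimes> n \<otimes> inv g \<in> N"
  using normal_N by (auto simp: normal_inv_iff)

lemma N_simps [simp]: "\<one> \<in> N" "\<lbrakk>x \<in> N; y \<in> N\<rbrakk> \<Longrightarrow> x \<otimes> y \<in> N" "x \<in> N \<Longrightarrow> inv x \<in> N"
  using subgroup_N by (auto simp: subgroup_def)

lemma N_carrier: "n \<in> N \<Longrightarrow> n \<in> carrier G"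
  using subgroup_N subgroup.subset by blast

lemma c_app: "u \<in> P \<Longrightarrow> c x u = x \<otimes> u \<otimes> inv x"
  by (simp add: conj_on_def)

lemma c_one: "c \<one> = (\<lambda>u\<in>P. u)"
  by (auto simp: conj_on_def P_carrier)

lemma c_mult: "\<lbrakk>x \<in> NP; y \<in> NP\<rbrakk> \<Longrightarrow> c (x \<otimes> y) = compose P (c x) (c y)"
proof (rule ext)
  fix u assume "x \<in> NP" "y \<in> NP"
  then show "c (x \<otimes> y) u = compose P (c x) (c y) u"
    by (cases "u \<in> P") (simp_all add: conj_on_def compose_def P_conj, simp add: group_word P_carrier NP_carrier)
qed

lemma c_in_T_iff: "x \<in> NP \<Longrightarrow> c x \<in> T \<longleftrightarrow> (\<forall>u\<in>P. x \<otimes> u \<otimes> inv x \<otimes> inv u \<in> N)"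
  by (auto simp: T_def Aut_by_def c_app)

text \<open>
  So \<open>NT\<close> consists of the elements that commute with \<open>P\<close> modulo \<open>N\<close>. Its closure under products,
  inverses and conjugation are identities between commutators modulo the normal subgroup \<open>N\<close>.
\<close>

lemma NT_iff: "x \<in> NT \<longleftrightarrow> x \<in> NP \<and> (\<forall>u\<in>P. x \<otimes> u \<otimes> inv x \<otimes> inv u \<in> N)"
  by (auto simp: normalizer_T_def c_in_T_iff)

text \<open>
  Because of this, an element of \<open>T\<close> can always be replaced by an element of \<open>NT\<close>. Composition, inverse
  and conjugation of automorphisms become the corresponding operations in \<open>G\<close>.
\<close>

lemma T_eq: "T = c ` NT"
  by (auto simp: T_def Aut_by_def normalizer_T_def)

lemma TE:
  assumes "\<phi> \<in> T" obtains x where "x \<in> NT" "\<phi> = c x"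
  using assms T_eq by blast

lemma c_in_T: "x \<in> NT \<Longrightarrow> c x \<in> T"
  by (simp add: normalizer_T_def)

lemma NT_NP: "x \<in> NT \<Longrightarrow> x \<in> NP"
  by (simp add: NT_iff)

lemma NT_carrier: "x \<in> NT \<Longrightarrow> x \<in> carrier G"
  by (simp add: NT_iff NP_carrier)

lemma NT_comm: "\<lbrakk>x \<in> NT; u \<in> P\<rbrakk> \<Longrightarrow> x \<otimes> u \<otimes> inv x \<otimes> inv u \<in> N"
  by (simp add: NT_iff)

lemma NT_mult: assumes "x \<in> NT" "y \<in> NT" shows "x \<otimes> y \<in> NT"
proof -
  have "x \<otimes> y \<otimes> u \<otimes> inv (x \<otimes> y) \<otimes> inv u \<in> N" if u: "u \<in> P" for u
  proof -
    have "(x \<otimes> (y \<otimes> u \<otimes> inv y) \<otimes> inv x \<otimes> inv (y \<otimes> u \<otimes> inv y)) \<otimes> (y \<otimes> u \<otimes> inv y \<otimes> inv u) \<in> N"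
      using assms u by (intro N_simps NT_comm P_conj NT_NP)
    then show ?thesis
      using assms u by (simp add: group_word NT_carrier P_carrier)
  qed
  then show ?thesis using assms by (simp add: NT_iff)
qed

lemma NT_inv: assumes "x \<in> NT" shows "inv x \<in> NT"
proof -
  have "inv x \<otimes> u \<otimes> inv (inv x) \<otimes> inv u \<in> N" if u: "u \<in> P" for u
  proof -
    have "inv (x \<otimes> (inv x \<otimes> u \<otimes> x) \<otimes> inv x \<otimes> inv (inv x \<otimes> u \<otimes> x)) \<in> N"
      using assms u by (intro N_simps NT_comm P_conj' NT_NP)
    then show ?thesis
      using assms u by (simp add: group_word NT_carrier P_carrier)
  qed
  then show ?thesis using assms by (simp add: NT_iff)
qed

lemma N_NP_NT: assumes "n \<in> N" "n \<in> NP" shows "n \<in> NT"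
proof -
  have "n \<otimes> (u \<otimes> inv n \<otimes> inv u) \<in> N" if "u \<in> P" for u
    using assms that by (intro N_simps N_conj) (auto simp: P_carrier)
  then show ?thesis
    using assms by (auto simp: NT_iff group_word P_carrier N_carrier)
qed

lemma NT_conj: assumes "g \<in> NP" "x \<in> NT" shows "g \<otimes> x \<otimes> inv g \<in> NT"
proof -
  have "(g \<otimes> x \<otimes> inv g) \<otimes> u \<otimes> inv (g \<otimes> x \<otimes> inv g) \<otimes> inv u \<in> N" if u: "u \<in> P" for u
  proof -
    have "g \<otimes> (x \<otimes> (inv g \<otimes> u \<otimes> g) \<otimes> inv x \<otimes> inv (inv g \<otimes> u \<otimes> g)) \<otimes> inv g \<in> N"
      using assms u by (intro N_conj NT_comm P_conj' NP_carrier)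
    then show ?thesis
      using assms u by (simp add: group_word NT_carrier P_carrier NP_carrier)
  qed
  then show ?thesis using assms by (simp add: NT_iff)
qed

lemma NT_one: "\<one> \<in> NT"
  by (rule N_NP_NT) auto

lemma subgroup_NT: "subgroup NT G"
  using NT_one by (intro subgroupI) (auto simp: NT_mult NT_inv NT_carrier)

lemma finite_T: "finite T"
proof -
  have "NT \<subseteq> carrier G" using NT_carrier by blast
  then have "finite NT" using finite_G finite_subset by blast
  then show ?thesis using T_eq finite_imageI by metis
qed

lemma conj_aut_c:
  assumes "g \<in> NP" "x \<in> NT" shows "conj_aut G P g (c x) = c (g \<otimes> x \<otimes> inv g)"
proof (rule ext)
  fix u show "conj_aut G P g (c x) u = c (g \<otimes> x \<otimes> inv g) u"
    using assms by (cases "u \<in> P")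
      (simp_all add: conj_aut_def conj_on_def P_conj', simp add: group_word P_carrier NP_carrier NT_carrier)
qed

definition TG where
  "TG = \<lparr>carrier = T, monoid.mult = compose P, one = \<lambda>u\<in>P. u\<rparr>"

lemma c_mult_TG: "\<lbrakk>x \<in> NT; y \<in> NT\<rbrakk> \<Longrightarrow> c x \<otimes>\<^bsub>TG\<^esub> c y = c (x \<otimes> y)"
  by (simp add: TG_def c_mult NT_NP)

lemma TG_carrier: "carrier TG = T" and TG_one: "\<one>\<^bsub>TG\<^esub> = c \<one>"
  by (simp_all add: TG_def c_one)

lemma group_TG: "group TG"
proof (rule groupI)
  show "\<exists>\<psi>\<in>carrier TG. \<psi> \<otimes>\<^bsub>TG\<^esub> \<phi> = \<one>\<^bsub>TG\<^esub>" if "\<phi> \<in> carrier TG" for \<phi>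
  proof -
    from that obtain x where x: "x \<in> NT" "\<phi> = c x" by (auto simp: TG_carrier elim: TE)
    then show ?thesis
      by (intro bexI[of _ "c (inv x)"])
        (auto simp: c_mult_TG NT_inv TG_one TG_carrier c_in_T NT_carrier)
  qed
qed (auto elim!: TE simp: TG_carrier TG_one c_mult_TG NT_one NT_mult c_in_T NT_carrier m_assoc)

sublocale TG: group TG by (rule group_TG)

lemma inv_TG: "x \<in> NT \<Longrightarrow> inv\<^bsub>TG\<^esub> (c x) = c (inv x)"
  by (rule TG.inv_equality) (auto simp: c_mult_TG NT_inv TG_one TG_carrier c_in_T NT_carrier)

lemma conj_aut_T: "\<lbrakk>g \<in> NP; \<phi> \<in> T\<rbrakk> \<Longrightarrow> conj_aut G P g \<phi> \<in> T"
  by (auto elim!: TE simp: conj_aut_c NT_conj c_in_T)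

lemma conj_aut_mult:
  assumes g: "g \<in> NP" and "\<phi> \<in> T" "\<psi> \<in> T"
  shows "conj_aut G P g (\<phi> \<otimes>\<^bsub>TG\<^esub> \<psi>) = conj_aut G P g \<phi> \<otimes>\<^bsub>TG\<^esub> conj_aut G P g \<psi>"
proof -
  obtain x y where xy: "x \<in> NT" "\<phi> = c x" "y \<in> NT" "\<psi> = c y" using assms by (metis TE)
  have "g \<otimes> (x \<otimes> y) \<otimes> inv g = g \<otimes> x \<otimes> inv g \<otimes> (g \<otimes> y \<otimes> inv g)"
    using g xy by (simp add: group_word NT_carrier NP_carrier)
  then show ?thesis using g xy by (simp add: c_mult_TG conj_aut_c NT_conj NT_mult)
qed

lemma conj_aut_conj_aut:
  assumes g: "g \<in> NP" and h: "h \<in> NP" and "\<phi> \<in> T"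
  shows "conj_aut G P g (conj_aut G P h \<phi>) = conj_aut G P (g \<otimes> h) \<phi>"
proof -
  obtain x where x: "x \<in> NT" "\<phi> = c x" using assms by (metis TE)
  have "g \<otimes> (h \<otimes> x \<otimes> inv h) \<otimes> inv g = g \<otimes> h \<otimes> x \<otimes> inv (g \<otimes> h)"
    using g h x by (simp add: group_word NT_carrier NP_carrier)
  then show ?thesis using g h x by (simp add: conj_aut_c NT_conj)
qed

lemma conj_aut_one: "\<phi> \<in> T \<Longrightarrow> conj_aut G P \<one> \<phi> = \<phi>"
  by (auto elim!: TE simp: conj_aut_c NT_carrier)

end

section \<open>Relative traces and Brauer kernels\<close>

text \<open>
  As an algebra, the Brauer quotient of \<open>B\<close> depends only on the restriction of the structure to \<open>N\<close> and \<open>N_G(P)\<close>. The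
  groups \<open>M\<close> and \<open>L\<close> are larger in the applications: they are \<open>N\<close> and \<open>G\<close> for \<open>A\<close>, and \<open>N_G^T(P) N\<close> and
  \<open>N_G(P) N\<close> for \<open>E\<close>.
\<close>

locale brauer_alg = brauer_group G N P T + int_alg G K M L B
  for G :: "('g, 'n) monoid_scheme" (structure) and N P T and K :: "('k, 'm) ring_scheme" and M L
    and B :: "('k, 'b, 'g) interior_alg" +
  assumes N_M: "N \<subseteq> M" and NP_L: "NP \<subseteq> L"
begin

abbreviation D where "D \<equiv> Delta_act G B"

lemma NM: "n \<in> N \<Longrightarrow> n \<in> M" and NPL: "n \<in> NP \<Longrightarrow> n \<in> L"
  using N_M NP_L by auto

lemma D_c: "u \<in> P \<Longrightarrow> D (c x) u b = emb B (x \<otimes> u \<otimes> inv x \<otimes> inv u) \<otimes>\<^bsub>B\<^esub> act B u b"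
  by (simp add: Delta_act_def c_app)

lemma D_closed: "\<lbrakk>\<phi> \<in> T; u \<in> P; b \<in> carrier B\<rbrakk> \<Longrightarrow> D \<phi> u b \<in> carrier B"
  by (auto elim!: TE simp: D_c emb_closed act_closed NM NT_comm NPL P_NP)

lemma additive_D: "\<lbrakk>\<phi> \<in> T; u \<in> P\<rbrakk> \<Longrightarrow> additive_map B B (D \<phi> u)"
  by (intro additive_mapI)
    (auto elim!: TE simp: D_closed c_in_T A.abelian_group_axioms D_c emb_closed act_closed NM NT_comm NPL P_NP
      act_add A.r_distr)

lemma D_smult:
  "\<lbrakk>\<phi> \<in> T; u \<in> P; k \<in> carrier K; b \<in> carrier B\<rbrakk> \<Longrightarrow> D \<phi> u (k \<odot>\<^bsub>B\<^esub> b) = k \<odot>\<^bsub>B\<^esub> D \<phi> u b"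
  by (auto elim!: TE simp: D_c emb_closed act_closed NM NT_comm NPL P_NP act_smult mult_smult)

lemma emb_act:
  "\<lbrakk>n \<in> M; g \<in> L; b \<in> carrier B\<rbrakk> \<Longrightarrow> emb B n \<otimes>\<^bsub>B\<^esub> act B g b = act B (n \<otimes> g) b \<otimes>\<^bsub>B\<^esub> emb B n"
  using act_inner[of n "act B g b"] by (simp add: act_closed act_act rev_subsetD[OF _ M_subset])

text \<open>
  This is the reason why the product of the components of \<open>\<psi>\<close> and \<open>\<phi>\<close> lies in the component of
  \<open>\<psi> \<circ> \<phi>\<close>. It is stated for arbitrary \<open>b\<close> and \<open>b'\<close>, and not just for fixed elements, so that it also
  gives the multiplication of a trace by a fixed element.
\<close>

lemma D_mult:
  assumes x: "x \<in> NT" and y: "y \<in> NT" and u: "u \<in> P" and b: "b \<in> carrier B" and b': "b' \<in> carrier B"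
  shows "D (c (x \<otimes> y)) u (b \<otimes>\<^bsub>B\<^esub> b') = D (c x) (y \<otimes> u \<otimes> inv y) b \<otimes>\<^bsub>B\<^esub> D (c y) u b'"
proof -
  let ?v = "y \<otimes> u \<otimes> inv y"
  note [simp] = NT_carrier[OF x] NT_carrier[OF y] P_carrier[OF u] b b'
  have v: "?v \<in> P" using P_conj NT_NP y u by blast
  have n: "x \<otimes> ?v \<otimes> inv x \<otimes> inv ?v \<in> M" "?v \<otimes> inv u \<in> M"
    using NT_comm[OF x v] NT_comm[OF y u] NM by blast+
  have L: "u \<in> L" "?v \<in> L" using u v by (auto intro: NPL P_NP)
  have v_u: "?v \<otimes> inv u \<otimes> u = ?v"
    by (simp add: group_word)
  have "D (c (x \<otimes> y)) u (b \<otimes>\<^bsub>B\<^esub> b') =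
      emb B ((x \<otimes> ?v \<otimes> inv x \<otimes> inv ?v) \<otimes> (?v \<otimes> inv u)) \<otimes>\<^bsub>B\<^esub> (act B u b \<otimes>\<^bsub>B\<^esub> act B u b')"
    using u L by (simp add: D_c act_mult group_word)
  also have "\<dots> = emb B (x \<otimes> ?v \<otimes> inv x \<otimes> inv ?v) \<otimes>\<^bsub>B\<^esub> (emb B (?v \<otimes> inv u) \<otimes>\<^bsub>B\<^esub> act B u b) \<otimes>\<^bsub>B\<^esub> act B u b'"
    by (subst emb_mult[OF n]) (simp add: A.m_assoc emb_closed[OF n(1)] emb_closed[OF n(2)] act_closed[OF L(1)])
  also have "emb B (?v \<otimes> inv u) \<otimes>\<^bsub>B\<^esub> act B u b = act B ?v b \<otimes>\<^bsub>B\<^esub> emb B (?v \<otimes> inv u)"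
    by (subst emb_act[OF n(2) L(1) b]) (subst v_u, rule refl)
  also have "emb B (x \<otimes> ?v \<otimes> inv x \<otimes> inv ?v) \<otimes>\<^bsub>B\<^esub> (act B ?v b \<otimes>\<^bsub>B\<^esub> emb B (?v \<otimes> inv u)) \<otimes>\<^bsub>B\<^esub> act B u b' =
      D (c x) ?v b \<otimes>\<^bsub>B\<^esub> D (c y) u b'"
    using u v by (simp add: D_c A.m_assoc emb_closed[OF n(1)] emb_closed[OF n(2)] act_closed[OF L(1)] act_closed[OF L(2)])
  finally show ?thesis .
qed

lemma D_one: "u \<in> P \<Longrightarrow> D (c \<one>) u \<one>\<^bsub>B\<^esub> = \<one>\<^bsub>B\<^esub>"
  by (simp add: D_c P_carrier emb_one act_one NPL P_NP)

lemma D_D: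
  assumes "\<phi> \<in> T" and u: "u \<in> P" and v: "v \<in> P" and b: "b \<in> carrier B"
  shows "D \<phi> u (D \<phi> v b) = D \<phi> (u \<otimes> v) b"
proof -
  obtain x where x: "x \<in> NT" "\<phi> = c x" using assms(1) by (rule TE)
  note [simp] = NT_carrier[OF x(1)] P_carrier[OF u] P_carrier[OF v] b
  have L: "u \<in> L" "v \<in> L" using u v by (auto intro: NPL P_NP)
  let ?m = "x \<otimes> u \<otimes> inv x \<otimes> inv u" and ?n = "x \<otimes> v \<otimes> inv x \<otimes> inv v"
  have n: "?m \<in> M" "?n \<in> M" "u \<otimes> ?n \<otimes> inv u \<in> M"
    using x u v M_normal[OF L(1)] by (auto intro: NM NT_comm)
  have "D \<phi> u (D \<phi> v b) = emb B ?m \<otimes>\<^bsub>B\<^esub> (emb B (u \<otimes> ?n \<otimes> inv u) \<otimes>\<^bsub>B\<^esub> act B (u \<otimes> v) b)"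
    using u v L n by (simp add: x(2) D_c act_mult act_emb act_act act_closed emb_closed)
  also have "\<dots> = emb B (?m \<otimes> (u \<otimes> ?n \<otimes> inv u)) \<otimes>\<^bsub>B\<^esub> act B (u \<otimes> v) b"
    using L n subgroup.m_closed[OF subgroup_L] by (simp only: emb_mult) (simp add: A.m_assoc emb_closed act_closed)
  also have "?m \<otimes> (u \<otimes> ?n \<otimes> inv u) = x \<otimes> (u \<otimes> v) \<otimes> inv x \<otimes> inv (u \<otimes> v)"
    by (simp add: group_word)
  finally show ?thesis using u v by (simp add: x(2) D_c)
qed

lemma D_act:
  assumes g: "g \<in> NP" and x: "x \<in> NT" and u: "u \<in> P" and b: "b \<in> carrier B"
  shows "act B g (D (c x) u b) = D (c (g \<otimes> x \<otimes> inv g)) (g \<otimes> u \<otimes> inv g) (act B g b)"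
proof -
  note [simp] = NT_carrier[OF x] P_carrier[OF u] NP_carrier[OF g] b
  have L: "g \<in> L" "u \<in> L" "g \<otimes> u \<otimes> inv g \<in> L" using g u by (auto intro!: NPL P_NP P_conj)
  have n: "x \<otimes> u \<otimes> inv x \<otimes> inv u \<in> M" using x u by (auto intro: NM NT_comm)
  have "act B g (D (c x) u b) = emb B (g \<otimes> (x \<otimes> u \<otimes> inv x \<otimes> inv u) \<otimes> inv g) \<otimes>\<^bsub>B\<^esub> act B (g \<otimes> u) b"
    using u L n by (simp add: D_c act_mult act_emb act_act act_closed emb_closed)
  also have "g \<otimes> (x \<otimes> u \<otimes> inv x \<otimes> inv u) \<otimes> inv g =
      (g \<otimes> x \<otimes> inv g) \<otimes> (g \<otimes> u \<otimes> inv g) \<otimes> inv (g \<otimes> x \<otimes> inv g) \<otimes> inv (g \<otimes> u \<otimes> inv g)"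
    by (simp add: group_word)
  also have "act B (g \<otimes> u) b = act B (g \<otimes> u \<otimes> inv g) (act B g b)"
    using L by (simp add: act_act) (simp add: group_word)
  finally show ?thesis using g u by (simp add: D_c P_conj)
qed

lemma D_emb:
  assumes x: "x \<in> NT" "x \<in> M" and u: "u \<in> P"
  shows "D (c x) u (emb B x) = emb B x"
proof -
  note [simp] = NT_carrier[OF x(1)] P_carrier[OF u]
  have L: "u \<in> L" using u by (auto intro!: NPL P_NP)
  have n: "x \<otimes> u \<otimes> inv x \<otimes> inv u \<in> M" "u \<otimes> x \<otimes> inv u \<in> M"
    using x u L by (auto intro: NM NT_comm M_normal)
  have "D (c x) u (emb B x) = emb B ((x \<otimes> u \<otimes> inv x \<otimes> inv u) \<otimes> (u \<otimes> x \<otimes> inv u))"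
    using u L n x by (simp only: emb_mult D_c act_emb)
  also have "(x \<otimes> u \<otimes> inv x \<otimes> inv u) \<otimes> (u \<otimes> x \<otimes> inv u) = x"
    by (simp add: group_word)
  finally show ?thesis .
qed

abbreviation fixed where "fixed \<phi> \<equiv> Delta_fixed G B \<phi> P"

lemma fixedI: "\<lbrakk>b \<in> carrier B; \<And>u. u \<in> R \<Longrightarrow> D \<phi> u b = b\<rbrakk> \<Longrightarrow> b \<in> Delta_fixed G B \<phi> R"
  and fixed_closed: "b \<in> Delta_fixed G B \<phi> R \<Longrightarrow> b \<in> carrier B"
  and fixedD: "\<lbrakk>b \<in> Delta_fixed G B \<phi> R; u \<in> R\<rbrakk> \<Longrightarrow> D \<phi> u b = b"
  by (simp_all add: Delta_fixed_def)

lemma fixed_subgroup: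
  assumes T: "\<phi> \<in> T" shows "subgroup (fixed \<phi>) (add_monoid B)"
proof (rule group.subgroupI[OF A.a_group])
  have "\<zero>\<^bsub>B\<^esub> \<in> fixed \<phi>" using T by (intro fixedI) (auto simp: additive_map_zero[OF additive_D])
  then show "fixed \<phi> \<noteq> {}" by blast
  show "inv\<^bsub>add_monoid B\<^esub> a \<in> fixed \<phi>" if "a \<in> fixed \<phi>" for a
    using T that
    by (auto intro!: fixedI simp: fixed_closed fixedD additive_map_neg[OF additive_D] simp flip: a_inv_def)
  show "a \<otimes>\<^bsub>add_monoid B\<^esub> b \<in> fixed \<phi>" if "a \<in> fixed \<phi>" "b \<in> fixed \<phi>" for a b
    using T that by (auto intro!: fixedI simp: fixed_closed fixedD additive_map_add[OF additive_D])
qed (auto simp: fixed_closed)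

end

lemma (in group) lcosets_eq:
  "lcosets\<^bsub>G\<lparr>carrier := P\<rparr>\<^esub> R = (\<lambda>u. (\<lambda>r. u \<otimes> r) ` R) ` P"
  by (auto simp: LCOSETS_def l_coset_def)

text \<open>
  Hence the trace does not depend on the representatives of the cosets.
\<close>

lemma (in brauer_alg) D_coset:
  assumes T: "\<phi> \<in> T" and R: "R \<subseteq> P" and b: "b \<in> Delta_fixed G B \<phi> R" and u: "u \<in> P"
    and v: "v \<in> (\<lambda>r. u \<otimes> r) ` R"
  shows "D \<phi> v b = D \<phi> u b"
proof -
  obtain r where r: "r \<in> R" "v = u \<otimes> r" using v by blast
  then have "D \<phi> v b = D \<phi> u (D \<phi> r b)"
    using R T u fixed_closed[OF b] by (simp add: D_D subset_iff)
  then show ?thesis using fixedD[OF b r(1)] by simp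
qed

text \<open>
  All properties of the traces come from the following change of variables. An additive map \<open>t\<close>
  that turns the action of \<open>u\<close> into that of \<open>y u z\<close> turns the trace from \<open>R\<close> into the trace from
  \<open>z\<^sup>-\<^sup>1 R z\<close>, because \<open>u R \<mapsto> y (u R) z\<close> is a bijection between the left cosets of the two groups.
  The element \<open>b'\<close> is usually \<open>t b\<close>; having it separate covers also the invariance of the trace,
  where \<open>t\<close> is the action of an element of \<open>P\<close> and \<open>b' = b\<close>.
\<close>

lemma trace_transport:
  fixes G :: "('g, 'n) monoid_scheme" (structure)
  assumes "brauer_alg G N P T K M L B" "brauer_alg G N P T K M' L' B'"
    and T: "\<phi> \<in> T" "\<phi>' \<in> T" and t: "additive_map B B' t"
    and y: "y \<in> normalizer G P" and z: "z \<in> normalizer G P" and yz: "y \<otimes> z \<in> P"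
    and R: "subgroup R G" "R \<subseteq> P" and b: "b \<in> Delta_fixed G B \<phi> R"
    and R': "R' = (\<lambda>r. inv z \<otimes> r \<otimes> z) ` R" and b': "b' \<in> Delta_fixed G B' \<phi>' R'"
    and equiv: "\<And>u. u \<in> P \<Longrightarrow> t (Delta_act G B \<phi> u b) = Delta_act G B' \<phi>' (y \<otimes> u \<otimes> z) b'"
  shows "t (Delta_trace G B P \<phi> R b) = Delta_trace G B' P \<phi>' R' b'"
proof -
  interpret B: brauer_alg G N P T K M L B by fact
  interpret B': brauer_alg G N P T K M' L' B' by fact
  note [simp] = B.NP_carrier[OF y] B.NP_carrier[OF z]
  note Pc [simp] = B.P_carrier
  have Rc: "r \<in> P" "r \<in> carrier G" if "r \<in> R" for r using R that by auto
  have yuz: "y \<otimes> u \<otimes> z \<in> P" if "u \<in> P" for u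
  proof -
    have "y \<otimes> u \<otimes> inv y \<otimes> (y \<otimes> z) \<in> P"
      using that y yz B.P_simps(2) B.P_conj by blast
    then show ?thesis using that by (simp add: B.group_word)
  qed
  have yuz': "\<exists>v\<in>P. u = y \<otimes> v \<otimes> z" if "u \<in> P" for u
  proof -
    have "inv y \<otimes> (u \<otimes> inv (y \<otimes> z)) \<otimes> y \<in> P"
      using that y yz B.P_simps(2,3) B.P_conj' by blast
    then have "inv y \<otimes> u \<otimes> inv z \<in> P"
      using that by (simp add: B.group_word)
    moreover have "u = y \<otimes> (inv y \<otimes> u \<otimes> inv z) \<otimes> z"
      using that by (simp add: B.group_word)
    ultimately show ?thesis by blast
  qed
  let ?h = "\<lambda>C. (\<lambda>v. y \<otimes> v \<otimes> z) ` C"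
  let ?C = "\<lambda>R u. (\<lambda>r. u \<otimes> r) ` R"
  have hC: "?h (?C R u) = ?C R' (y \<otimes> u \<otimes> z)" if "u \<in> P" for u
    unfolding R' image_image using that Rc by (intro image_cong) (auto simp: B.group_word)
  have "inj_on (\<lambda>v. y \<otimes> v \<otimes> z) P"
    by (rule inj_onI) simp
  then have "inj_on ?h (?C R ` P)"
    using Rc by (intro inj_on_image) (auto elim!: inj_on_subset)
  moreover have "?h ` (?C R ` P) = ?C R' ` P"
  proof (intro equalityI subsetI)
    fix C assume "C \<in> ?h ` (?C R ` P)"
    then show "C \<in> ?C R' ` P" using hC yuz by auto
  next
    fix C assume "C \<in> ?C R' ` P"
    then obtain u where "u \<in> P" "C = ?C R' u" by blast
    then show "C \<in> ?h ` (?C R ` P)" using hC yuz'[of u] by (metis (no_types, lifting) imageI)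
  qed
  ultimately have bij: "bij_betw ?h (?C R ` P) (?C R' ` P)"
    by (simp add: bij_betw_def)
  have R'P: "R' \<subseteq> P" unfolding R' using Rc z B.P_conj' by blast
  have bB: "b \<in> carrier B" and b'B: "b' \<in> carrier B'"
    using b b' by (auto dest: B.fixed_closed B'.fixed_closed)
  have some: "(SOME u. u \<in> C) \<in> C \<and> C \<subseteq> P" if "C \<in> ?C R ` P" for C
  proof -
    obtain u where u: "u \<in> P" "C = ?C R u" using \<open>C \<in> ?C R ` P\<close> by blast
    have "u \<otimes> \<one> \<in> C" unfolding u(2) by (rule imageI) (rule subgroup.one_closed[OF R(1)])
    then have "(SOME u. u \<in> C) \<in> C" by (rule someI)
    moreover have "C \<subseteq> P" using u Rc by auto
    ultimately show ?thesis by blast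
  qed
  have some': "Delta_act G B' \<phi>' (SOME u. u \<in> C) b' = Delta_act G B' \<phi>' v b'" "v \<in> P"
    if C: "C \<in> ?C R' ` P" and v: "v \<in> C" for C v
  proof -
    obtain u where u: "u \<in> P" "C = ?C R' u" using C by blast
    have "(SOME u. u \<in> C) \<in> C" using v by (rule someI)
    then show "Delta_act G B' \<phi>' (SOME u. u \<in> C) b' = Delta_act G B' \<phi>' v b'"
      using B'.D_coset[OF T(2) R'P b' u(1)] v u(2) by metis
    show "v \<in> P" using v u R'P by auto
  qed
  have closed: "Delta_act G B' \<phi>' (SOME u. u \<in> C) b' \<in> carrier B'" if C: "C \<in> ?C R' ` P" for C
  proof -
    obtain v where "v \<in> C" using C R' subgroup.one_closed[OF R(1)] by blast
    then show ?thesis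
      using some'[OF C] T(2) b'B by (simp add: B'.D_closed)
  qed
  have "t (Delta_trace G B P \<phi> R b) = (\<Oplus>\<^bsub>B'\<^esub>C\<in>?C R ` P. t (Delta_act G B \<phi> (SOME u. u \<in> C) b))"
    unfolding Delta_trace_def B.lcosets_eq
    by (rule additive_map_finsum[OF t]) (rule B.D_closed[OF T(1) _ bB], use some in blast)
  also have "\<dots> = (\<Oplus>\<^bsub>B'\<^esub>C\<in>?C R ` P. Delta_act G B' \<phi>' (SOME u. u \<in> ?h C) b')"
  proof (rule B'.A.finsum_cong'[OF refl])
    show "(\<lambda>C. Delta_act G B' \<phi>' (SOME u. u \<in> ?h C) b') \<in> ?C R ` P \<rightarrow> carrier B'"
      by (rule Pi_I, rule closed) (rule bij_betwE[OF bij, rule_format])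
    fix C assume C: "C \<in> ?C R ` P"
    let ?u = "SOME u. u \<in> C"
    have "?u \<in> C" "?u \<in> P" using some[OF C] by auto
    then have "Delta_act G B' \<phi>' (SOME u. u \<in> ?h C) b' = Delta_act G B' \<phi>' (y \<otimes> ?u \<otimes> z) b'"
      by (intro some'(1) bij_betwE[OF bij, rule_format] C imageI)
    then show "t (Delta_act G B \<phi> ?u b) = Delta_act G B' \<phi>' (SOME u. u \<in> ?h C) b'"
      using equiv \<open>?u \<in> P\<close> by simp
  qed
  also have "\<dots> = (\<Oplus>\<^bsub>B'\<^esub>C\<in>?C R' ` P. Delta_act G B' \<phi>' (SOME u. u \<in> C) b')"
    using closed by (rule B'.A.finsum_bij[OF bij])
  finally show ?thesis by (simp add: Delta_trace_def B.lcosets_eq)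
qed

lemma (in brauer_alg) trace_fixed:
  assumes T: "\<phi> \<in> T" and R: "subgroup R G" "R \<subseteq> P" and b: "b \<in> Delta_fixed G B \<phi> R"
  shows "Delta_trace G B P \<phi> R b \<in> fixed \<phi>"
proof (rule fixedI)
  have bB: "b \<in> carrier B" using b by (rule fixed_closed)
  have Rc: "r \<in> carrier G" if "r \<in> R" for r using R that P_carrier by auto
  have R': "R = (\<lambda>r. inv \<one> \<otimes> r \<otimes> \<one>) ` R" using Rc by simp
  have ba: "brauer_alg G N P T K M L B" by unfold_locales
  \<comment> \<open>Translation by \<open>v\<close> permutes the left cosets of \<open>R\<close>: this is the case \<open>y = v\<close>, \<open>z = 1\<close>.\<close>
  have eq: "D \<phi> v (Delta_trace G B P \<phi> R b) = Delta_trace G B P \<phi> R b" if v: "v \<in> P" for v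
  proof (rule trace_transport[OF ba ba T T additive_D[OF T v] P_NP[OF v] _ _ R b R' b])
    show "D \<phi> v (D \<phi> u b) = D \<phi> (v \<otimes> u \<otimes> \<one>) b" if "u \<in> P" for u
      using that v T bB by (simp add: D_D P_carrier)
  qed (use v in \<open>simp_all add: P_carrier\<close>)
  then show "D \<phi> v (Delta_trace G B P \<phi> R b) = Delta_trace G B P \<phi> R b" if "v \<in> P" for v
    using that .
  have "D \<phi> \<one> (Delta_trace G B P \<phi> R b) \<in> carrier B"
    unfolding Delta_trace_def lcosets_eq
  proof (intro D_closed T A.finsum_closed Pi_I bB)
    fix C assume "C \<in> (\<lambda>u. (\<lambda>r. u \<otimes> r) ` R) ` P"
    then obtain u where u: "u \<in> P" "C = (\<lambda>r. u \<otimes> r) ` R" by blast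
    then have "u \<otimes> \<one> \<in> C" using subgroup.one_closed[OF R(1)] by blast
    then have "(SOME v. v \<in> C) \<in> C" by (rule someI)
    then show "(SOME v. v \<in> C) \<in> P" using u R by auto
  qed simp
  then show "Delta_trace G B P \<phi> R b \<in> carrier B" using eq by simp
qed

context brauer_alg
begin

abbreviation kernel where "kernel \<phi> \<equiv> Brauer_kernel G B P \<phi>"

lemma
  assumes T: "\<phi> \<in> T"
  shows kernel_fixed: "kernel \<phi> \<subseteq> fixed \<phi>" and kernel_subgroup: "subgroup (kernel \<phi>) (add_monoid B)"
proof -
  have traces: "(\<Union>R\<in>{R. subgroup R G \<and> R \<subset> P}. Delta_trace G B P \<phi> R ` Delta_fixed G B \<phi> R) \<subseteq> fixed \<phi>"
    using trace_fixed[OF T] by blast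
  then show "kernel \<phi> \<subseteq> fixed \<phi>"
    unfolding Brauer_kernel_def by (intro A.add.generate_subgroup_incl fixed_subgroup T)
  have "fixed \<phi> \<subseteq> carrier B" using fixed_closed by blast
  then show "subgroup (kernel \<phi>) (add_monoid B)"
    using traces unfolding Brauer_kernel_def by (intro A.add.generate_is_subgroup) simp
qed

end

text \<open>
  The case \<open>z = y\<^sup>-\<^sup>1\<close> of the change of variables, for all subgroups \<open>R\<close> together. It is applied to the
  multiplications by fixed elements on both sides, to the actions of \<open>N_G(P)\<close> and of scalars, to
  homomorphisms of algebras, and to the coordinates of \<open>E\<close>.
\<close>

lemma
  fixes G :: "('g, 'n) monoid_scheme" (structure)
  assumes "brauer_alg G N P T K M L B" "brauer_alg G N P T K M' L' B'"
    and T: "\<phi> \<in> T" "\<phi>' \<in> T" and t: "additive_map B B' t" and y: "y \<in> normalizer G P"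
    and equiv: "\<And>u b. \<lbrakk>u \<in> P; b \<in> carrier B\<rbrakk> \<Longrightarrow>
      t (Delta_act G B \<phi> u b) = Delta_act G B' \<phi>' (y \<otimes> u \<otimes> inv y) (t b)"
  shows fixed_transport: "b \<in> Delta_fixed G B \<phi> P \<Longrightarrow> t b \<in> Delta_fixed G B' \<phi>' P"
    and kernel_transport: "b \<in> Brauer_kernel G B P \<phi> \<Longrightarrow> t b \<in> Brauer_kernel G B' P \<phi>'"
proof -
  interpret B: brauer_alg G N P T K M L B by fact
  interpret B': brauer_alg G N P T K M' L' B' by fact
  note [simp] = B.NP_carrier[OF y]
  let ?c = "\<lambda>r. y \<otimes> r \<otimes> inv y"
  have fixed: "t b \<in> Delta_fixed G B' \<phi>' (?c ` R)" if "b \<in> Delta_fixed G B \<phi> R" "R \<subseteq> P" for b R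
  proof (rule B'.fixedI)
    have b: "b \<in> carrier B" using that(1) by (rule B.fixed_closed)
    then show "t b \<in> carrier B'" by (rule additive_map_closed[OF t])
    fix v assume "v \<in> ?c ` R"
    then obtain r where r: "r \<in> R" "v = ?c r" by blast
    then have "t (Delta_act G B \<phi> r b) = Delta_act G B' \<phi>' v (t b)"
      using equiv[OF _ b] that(2) by blast
    then show "Delta_act G B' \<phi>' v (t b) = t b" using B.fixedD[OF that(1) r(1)] by simp
  qed
  have bij: "bij_betw ?c P P"
    using y by (intro B.bij_betw_conj) (auto simp: B.P_conj B.P_conj' B.P_carrier)
  then have cP: "?c ` P = P" by (simp add: bij_betw_def)
  show "b \<in> Delta_fixed G B \<phi> P \<Longrightarrow> t b \<in> Delta_fixed G B' \<phi>' P"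
    using fixed[of b P] cP by simp
  have trace: "t (Delta_trace G B P \<phi> R b) \<in> Brauer_kernel G B' P \<phi>'"
    if R: "subgroup R G" "R \<subset> P" and b: "b \<in> Delta_fixed G B \<phi> R" for R b
  proof -
    have RP: "R \<subseteq> P" using R by blast
    have Rc: "r \<in> carrier G" if "r \<in> R" for r using RP that B.P_carrier by blast
    have "t (Delta_trace G B P \<phi> R b) = Delta_trace G B' P \<phi>' (?c ` R) (t b)"
      by (rule trace_transport[OF assms(1,2) T t y _ _ R(1) RP b _ fixed[OF b RP]])
        (use y B.fixed_closed[OF b] equiv in simp_all)
    moreover have "subgroup (?c ` R) G"
    proof (rule B.subgroupI)
      show "?c ` R \<noteq> {}" using subgroup.one_closed[OF R(1)] by blast
      show "inv a \<in> ?c ` R" if a: "a \<in> ?c ` R" for a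
      proof -
        obtain r where r: "r \<in> R" "a = ?c r" using a by blast
        then have "inv a = ?c (inv r)" using Rc by (simp add: B.group_word)
        then show ?thesis using subgroup.m_inv_closed[OF R(1) r(1)] by blast
      qed
      show "a \<otimes> b \<in> ?c ` R" if ab: "a \<in> ?c ` R" "b \<in> ?c ` R" for a b
      proof -
        obtain r s where r: "r \<in> R" "a = ?c r" "s \<in> R" "b = ?c s" using ab by blast
        then have "a \<otimes> b = ?c (r \<otimes> s)" using Rc by (simp add: B.group_word)
        then show ?thesis using subgroup.m_closed[OF R(1) r(1,3)] by blast
      qed
    qed (use Rc in auto)
    moreover have "?c ` R \<subset> P"
    proof -
      have "?c ` R \<subset> ?c ` P"
        using R(2) RP bij inj_on_image_eq_iff[of ?c P R P] by (auto simp: bij_betw_def psubset_eq image_mono)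
      then show ?thesis using cP by simp
    qed
    moreover have "t b \<in> Delta_fixed G B' \<phi>' (?c ` R)" by (rule fixed[OF b RP])
    ultimately show ?thesis
      unfolding Brauer_kernel_def by (intro generate.incl) blast
  qed
  show "t b \<in> Brauer_kernel G B' P \<phi>'" if "b \<in> Brauer_kernel G B P \<phi>"
  proof (rule additive_map_generate[OF t _ B'.kernel_subgroup[OF T(2)] _ that[unfolded Brauer_kernel_def]])
    show "(\<Union>R\<in>{R. subgroup R G \<and> R \<subset> P}. Delta_trace G B P \<phi> R ` Delta_fixed G B \<phi> R) \<subseteq> carrier B"
      using B.trace_fixed[OF T(1)] B.fixed_closed by blast
  qed (use trace in blast)
qed

section \<open>The extended Brauer quotient is an interior algebra\<close>

context brauer_alg
begin

lemma this_brauer_alg: "brauer_alg G N P T K M L B"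
  by unfold_locales

lemma
  assumes x: "x \<in> NT" and y: "y \<in> NT" and b: "b \<in> fixed (c x)"
  shows fixed_mult: "b' \<in> fixed (c y) \<Longrightarrow> b \<otimes>\<^bsub>B\<^esub> b' \<in> fixed (c (x \<otimes> y))"
    and kernel_mult_left: "b' \<in> kernel (c y) \<Longrightarrow> b \<otimes>\<^bsub>B\<^esub> b' \<in> kernel (c (x \<otimes> y))"
proof -
  note [simp] = fixed_closed[OF b]
  have t: "additive_map B B (\<lambda>b'. b \<otimes>\<^bsub>B\<^esub> b')"
    by (intro additive_mapI) (auto simp: A.r_distr A.abelian_group_axioms)
  have equiv: "b \<otimes>\<^bsub>B\<^esub> D (c y) u b' = D (c (x \<otimes> y)) (\<one> \<otimes> u \<otimes> inv \<one>) (b \<otimes>\<^bsub>B\<^esub> b')"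
    if "u \<in> P" "b' \<in> carrier B" for u b'
    using that x y fixedD[OF b P_conj[OF NT_NP[OF y] that(1)]] by (simp add: D_mult P_carrier)
  note tr = this_brauer_alg this_brauer_alg c_in_T[OF y] c_in_T[OF NT_mult[OF x y]] t NP_simps(1) equiv
  show "b' \<in> fixed (c y) \<Longrightarrow> b \<otimes>\<^bsub>B\<^esub> b' \<in> fixed (c (x \<otimes> y))"
    by (rule fixed_transport[OF tr])
  show "b' \<in> kernel (c y) \<Longrightarrow> b \<otimes>\<^bsub>B\<^esub> b' \<in> kernel (c (x \<otimes> y))"
    by (rule kernel_transport[OF tr])
qed

text \<open>
  On the right, multiplication by an element of the component of \<open>c y\<close> moves the variable \<open>u\<close> of the
  trace to \<open>y\<^sup>-\<^sup>1 u y\<close>, by the formula for the action on a product.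
\<close>

lemma kernel_mult_right:
  assumes x: "x \<in> NT" and y: "y \<in> NT" and b: "b \<in> kernel (c x)" and b': "b' \<in> fixed (c y)"
  shows "b \<otimes>\<^bsub>B\<^esub> b' \<in> kernel (c (x \<otimes> y))"
proof (rule kernel_transport[OF this_brauer_alg this_brauer_alg c_in_T[OF x] c_in_T[OF NT_mult[OF x y]] _ _ _ b])
  note [simp] = fixed_closed[OF b'] NT_carrier[OF x] NT_carrier[OF y]
  show "additive_map B B (\<lambda>b. b \<otimes>\<^bsub>B\<^esub> b')"
    by (intro additive_mapI) (auto simp: A.l_distr A.abelian_group_axioms)
  show "inv y \<in> NP" using y by (simp add: NT_NP)
  fix v b assume v: "v \<in> P" and b: "b \<in> carrier B"
  let ?u = "inv y \<otimes> v \<otimes> inv (inv y)"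
  have "?u \<in> P" using P_conj'[OF NT_NP[OF y] v] by simp
  moreover have "y \<otimes> ?u \<otimes> inv y = v" using v by (simp add: group_word P_carrier)
  ultimately show "D (c x) v b \<otimes>\<^bsub>B\<^esub> b' = D (c (x \<otimes> y)) ?u (b \<otimes>\<^bsub>B\<^esub> b')"
    using b x y fixedD[OF b'] by (simp only: D_mult fixed_closed[OF b'])
qed

lemma
  assumes x: "x \<in> NT" and g: "g \<in> NP"
  shows fixed_act: "b \<in> fixed (c x) \<Longrightarrow> act B g b \<in> fixed (c (g \<otimes> x \<otimes> inv g))"
    and kernel_act: "b \<in> kernel (c x) \<Longrightarrow> act B g b \<in> kernel (c (g \<otimes> x \<otimes> inv g))"
proof -
  note tr = this_brauer_alg this_brauer_alg c_in_T[OF x] c_in_T[OF NT_conj[OF g x]] additive_act[OF NPL[OF g]]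
    g D_act[OF g x]
  show "b \<in> fixed (c x) \<Longrightarrow> act B g b \<in> fixed (c (g \<otimes> x \<otimes> inv g))"
    by (rule fixed_transport[OF tr])
  show "b \<in> kernel (c x) \<Longrightarrow> act B g b \<in> kernel (c (g \<otimes> x \<otimes> inv g))"
    by (rule kernel_transport[OF tr])
qed

lemma
  assumes T: "\<phi> \<in> T" and k: "k \<in> carrier K"
  shows fixed_smult: "b \<in> fixed \<phi> \<Longrightarrow> k \<odot>\<^bsub>B\<^esub> b \<in> fixed \<phi>"
    and kernel_smult: "b \<in> kernel \<phi> \<Longrightarrow> k \<odot>\<^bsub>B\<^esub> b \<in> kernel \<phi>"
proof -
  have equiv: "k \<odot>\<^bsub>B\<^esub> D \<phi> u b = D \<phi> (\<one> \<otimes> u \<otimes> inv \<one>) (k \<odot>\<^bsub>B\<^esub> b)" if "u \<in> P" "b \<in> carrier B" for u b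
    using that T k by (simp add: D_smult P_carrier)
  note tr = this_brauer_alg this_brauer_alg T T additive_smult[OF k] NP_simps(1) equiv
  show "b \<in> fixed \<phi> \<Longrightarrow> k \<odot>\<^bsub>B\<^esub> b \<in> fixed \<phi>" by (rule fixed_transport[OF tr])
  show "b \<in> kernel \<phi> \<Longrightarrow> k \<odot>\<^bsub>B\<^esub> b \<in> kernel \<phi>" by (rule kernel_transport[OF tr])
qed

lemma fixed_emb: "\<lbrakk>x \<in> M; x \<in> NT\<rbrakk> \<Longrightarrow> emb B x \<in> fixed (c x)"
  by (intro fixedI) (auto simp: emb_closed D_emb)

abbreviation S where "S \<equiv> Brauer_sum G B P T"

text \<open>
  Indexing the pairs with product \<open>\<chi>\<close> by their first entry brings the multiplication into the form of
  a crossed product of \<open>T\<close> with trivial action.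
\<close>

lemma S_mult:
  assumes f: "f \<in> carrier S" and f': "f' \<in> carrier S" and \<chi>: "\<chi> \<in> T"
  shows "(f \<otimes>\<^bsub>S\<^esub> f') \<chi> = (\<Oplus>\<^bsub>B\<^esub>\<psi>\<in>T. f \<psi> \<otimes>\<^bsub>B\<^esub> f' (inv\<^bsub>TG\<^esub> \<psi> \<otimes>\<^bsub>TG\<^esub> \<chi>))"
proof -
  let ?pairs = "{(\<psi>, \<phi>) \<in> T \<times> T. compose P \<psi> \<phi> = \<chi>}"
  let ?t = "\<lambda>(\<psi>, \<phi>). f \<psi> \<otimes>\<^bsub>B\<^esub> f' \<phi>"
  have T: "\<phi> \<in> carrier TG" if "\<phi> \<in> T" for \<phi> using that by (simp add: TG_carrier)
  have comp: "compose P \<psi> \<phi> = \<psi> \<otimes>\<^bsub>TG\<^esub> \<phi>" for \<psi> \<phi> by (simp add: TG_def)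
  have cl: "inv\<^bsub>TG\<^esub> \<psi> \<otimes>\<^bsub>TG\<^esub> \<chi> \<in> T" if "\<psi> \<in> T" for \<psi>
    using TG.m_closed[OF TG.inv_closed] T[OF that] T[OF \<chi>] by (simp add: TG_carrier)
  have bij: "bij_betw (\<lambda>\<psi>. (\<psi>, inv\<^bsub>TG\<^esub> \<psi> \<otimes>\<^bsub>TG\<^esub> \<chi>)) T ?pairs"
  proof (rule bij_betw_byWitness[where f' = fst])
    show "\<forall>p\<in>?pairs. (fst p, inv\<^bsub>TG\<^esub> fst p \<otimes>\<^bsub>TG\<^esub> \<chi>) = p"
      using TG.inv_cancel_left(1)[OF T T] by (auto simp: comp)
    show "(\<lambda>\<psi>. (\<psi>, inv\<^bsub>TG\<^esub> \<psi> \<otimes>\<^bsub>TG\<^esub> \<chi>)) ` T \<subseteq> ?pairs"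
      using cl TG.inv_cancel_left(2)[OF T T[OF \<chi>]] by (auto simp: comp)
  qed auto
  have fc: "f \<phi> \<in> carrier B" "f' \<phi> \<in> carrier B" if "\<phi> \<in> T" for \<phi>
    using f f' that by (auto simp: Brauer_sum_def PiE_iff intro: fixed_closed)
  have "(f \<otimes>\<^bsub>S\<^esub> f') \<chi> = finsum B ?t ?pairs"
    using \<chi> by (simp add: Brauer_sum_def)
  also have "\<dots> = (\<Oplus>\<^bsub>B\<^esub>\<psi>\<in>T. ?t (\<psi>, inv\<^bsub>TG\<^esub> \<psi> \<otimes>\<^bsub>TG\<^esub> \<chi>))"
    using fc by (intro A.finsum_bij[OF bij, symmetric]) auto
  finally show ?thesis by simp
qed

lemma TG_mult_T: "\<lbrakk>\<phi> \<in> T; \<psi> \<in> T\<rbrakk> \<Longrightarrow> \<phi> \<otimes>\<^bsub>TG\<^esub> \<psi> \<in> T"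
  and TG_inv_T: "\<phi> \<in> T \<Longrightarrow> inv\<^bsub>TG\<^esub> \<phi> \<in> T"
  using TG.m_closed[of \<phi> \<psi>] TG.inv_closed[of \<phi>] by (simp_all add: TG_carrier)

sublocale S: crossed_product TG K B "\<lambda>_ b. b" "\<lambda>\<phi>. fixed \<phi>" S
proof (intro crossed_product.intro crossed_product_axioms.intro group_TG)
  show "f \<otimes>\<^bsub>S\<^esub> f' = (\<lambda>\<chi>\<in>carrier TG. \<Oplus>\<^bsub>B\<^esub>\<psi>\<in>carrier TG. f \<psi> \<otimes>\<^bsub>B\<^esub> f' (inv\<^bsub>TG\<^esub> \<psi> \<otimes>\<^bsub>TG\<^esub> \<chi>))"
    if "f \<in> carrier S" "f' \<in> carrier S" for f f'
  proof (rule ext)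
    fix \<chi>
    show "(f \<otimes>\<^bsub>S\<^esub> f') \<chi> = (\<lambda>\<chi>\<in>carrier TG. \<Oplus>\<^bsub>B\<^esub>\<psi>\<in>carrier TG. f \<psi> \<otimes>\<^bsub>B\<^esub> f' (inv\<^bsub>TG\<^esub> \<psi> \<otimes>\<^bsub>TG\<^esub> \<chi>)) \<chi>"
    proof (cases "\<chi> \<in> T")
      case True then show ?thesis using S_mult[OF that True] by (simp add: TG_carrier)
    next
      case False then show ?thesis by (simp add: TG_carrier) (simp add: Brauer_sum_def)
    qed
  qed
  show "a \<otimes>\<^bsub>B\<^esub> b \<in> fixed (x \<otimes>\<^bsub>TG\<^esub> y)"
    if "x \<in> carrier TG" "y \<in> carrier TG" "a \<in> fixed x" "b \<in> fixed y" for x y a b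
    using that by (auto simp: TG_carrier c_mult_TG elim!: TE intro: fixed_mult)
  show "\<one>\<^bsub>B\<^esub> \<in> fixed \<one>\<^bsub>TG\<^esub>"
    by (auto simp: TG_one D_one intro!: fixedI)
  show "subgroup (fixed x) (add_monoid B)" if "x \<in> carrier TG" for x
    using that by (simp add: TG_carrier fixed_subgroup)
qed (auto simp: TG_carrier finite_T assoc ring_hom_def fixed_smult Brauer_sum_def TG_one c_one)

lemma S_carrier: "carrier S = (\<Pi>\<^sub>E \<phi>\<in>T. fixed \<phi>)"
  using S.F_carrier by (simp add: TG_carrier)

lemma S_fixed: "\<lbrakk>f \<in> carrier S; \<phi> \<in> T\<rbrakk> \<Longrightarrow> f \<phi> \<in> fixed \<phi>"
  using S.F_in by (simp add: TG_carrier)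

lemma S_closed [simp]: "\<lbrakk>f \<in> carrier S; \<phi> \<in> T\<rbrakk> \<Longrightarrow> f \<phi> \<in> carrier B"
  using S.F_closed by (simp add: TG_carrier)

lemma S_eqI: "\<lbrakk>f \<in> carrier S; f' \<in> carrier S; \<And>\<phi>. \<phi> \<in> T \<Longrightarrow> f \<phi> = f' \<phi>\<rbrakk> \<Longrightarrow> f = f'"
  using S.F_eqI by (simp add: TG_carrier)

sublocale SR: ring S by (rule S.ring_F)

lemma emb_S_app: "\<chi> \<in> T \<Longrightarrow> emb S x \<chi> = (if \<chi> = c x then emb B x else \<zero>\<^bsub>B\<^esub>)"
  and act_S_app: "\<chi> \<in> T \<Longrightarrow> act S g f \<chi> = act B g (f (conj_aut G P (inv g) \<chi>))"
  by (simp_all add: Brauer_sum_def)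

lemma emb_S_closed: "\<lbrakk>x \<in> M; x \<in> NT\<rbrakk> \<Longrightarrow> emb S x \<in> carrier S"
  using fixed_emb S.C_zero by (auto simp: S_carrier Brauer_sum_def TG_carrier)

lemma conj_inv_T: "\<lbrakk>g \<in> NP; \<phi> \<in> T\<rbrakk> \<Longrightarrow> conj_aut G P (inv g) \<phi> \<in> T"
  by (simp add: conj_aut_T)

lemma fixed_act_conj:
  assumes g: "g \<in> NP" and \<phi>: "\<phi> \<in> T"
  shows "b \<in> fixed (conj_aut G P (inv g) \<phi>) \<Longrightarrow> act B g b \<in> fixed \<phi>"
    and "b \<in> kernel (conj_aut G P (inv g) \<phi>) \<Longrightarrow> act B g b \<in> kernel \<phi>"
proof -
  obtain x where x: "x \<in> NT" "\<phi> = c x" using \<phi> by (rule TE)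
  have y: "inv g \<otimes> x \<otimes> inv (inv g) \<in> NT" using g x by (intro NT_conj) auto
  have "g \<otimes> (inv g \<otimes> x \<otimes> inv (inv g)) \<otimes> inv g = x"
    using g x by (simp add: group_word NT_carrier NP_carrier)
  then show "b \<in> fixed (conj_aut G P (inv g) \<phi>) \<Longrightarrow> act B g b \<in> fixed \<phi>"
      "b \<in> kernel (conj_aut G P (inv g) \<phi>) \<Longrightarrow> act B g b \<in> kernel \<phi>"
    using fixed_act[OF y g] kernel_act[OF y g] g x by (simp_all only: conj_aut_c NP_simps)
qed

lemma act_S_closed: "\<lbrakk>g \<in> NP; f \<in> carrier S\<rbrakk> \<Longrightarrow> act S g f \<in> carrier S"
  using S_fixed fixed_act_conj(1) conj_inv_T by (auto simp: S_carrier Brauer_sum_def)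

lemma emb_S_mult_app:
  assumes x: "x \<in> M" "x \<in> NT" and f: "f \<in> carrier S" and \<chi>: "\<chi> \<in> T"
  shows "(emb S x \<otimes>\<^bsub>S\<^esub> f) \<chi> = emb B x \<otimes>\<^bsub>B\<^esub> f (c (inv x) \<otimes>\<^bsub>TG\<^esub> \<chi>)"
proof -
  have "(emb S x \<otimes>\<^bsub>S\<^esub> f) \<chi> = (\<Oplus>\<^bsub>B\<^esub>\<psi>\<in>T. emb S x \<psi> \<otimes>\<^bsub>B\<^esub> f (inv\<^bsub>TG\<^esub> \<psi> \<otimes>\<^bsub>TG\<^esub> \<chi>))"
    using assms by (intro S_mult emb_S_closed)
  also have "\<dots> = emb S x (c x) \<otimes>\<^bsub>B\<^esub> f (inv\<^bsub>TG\<^esub> (c x) \<otimes>\<^bsub>TG\<^esub> \<chi>)"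
    using assms by (intro A.finsum_eq_single finite_T)
      (auto simp: c_in_T emb_S_app emb_closed TG_mult_T TG_inv_T)
  finally show ?thesis using x by (simp add: emb_S_app c_in_T inv_TG)
qed

lemma mult_emb_S_app:
  assumes x: "x \<in> M" "x \<in> NT" and f: "f \<in> carrier S" and \<chi>: "\<chi> \<in> T"
  shows "(f \<otimes>\<^bsub>S\<^esub> emb S x) \<chi> = f (\<chi> \<otimes>\<^bsub>TG\<^esub> c (inv x)) \<otimes>\<^bsub>B\<^esub> emb B x"
proof -
  have T: "\<phi> \<in> T \<Longrightarrow> \<phi> \<in> carrier TG" for \<phi> by (simp add: TG_carrier)
  note Ts = T[OF \<chi>] T[OF c_in_T[OF x(2)]]
  have inv: "c (inv x) = inv\<^bsub>TG\<^esub> (c x)" using x by (simp add: inv_TG)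
  have eq: "inv\<^bsub>TG\<^esub> \<psi> \<otimes>\<^bsub>TG\<^esub> \<chi> = c x \<longleftrightarrow> \<psi> = \<chi> \<otimes>\<^bsub>TG\<^esub> c (inv x)" if "\<psi> \<in> T" for \<psi>
  proof
    assume "inv\<^bsub>TG\<^esub> \<psi> \<otimes>\<^bsub>TG\<^esub> \<chi> = c x"
    then show "\<psi> = \<chi> \<otimes>\<^bsub>TG\<^esub> c (inv x)" unfolding inv using Ts T[OF that]
      by (metis TG.inv_closed TG.inv_solve_left TG.inv_solve_right TG.m_closed)
  next
    assume "\<psi> = \<chi> \<otimes>\<^bsub>TG\<^esub> c (inv x)"
    then show "inv\<^bsub>TG\<^esub> \<psi> \<otimes>\<^bsub>TG\<^esub> \<chi> = c x" unfolding inv using Ts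
      by (simp add: TG.group_word)
  qed
  have "(f \<otimes>\<^bsub>S\<^esub> emb S x) \<chi> = (\<Oplus>\<^bsub>B\<^esub>\<psi>\<in>T. f \<psi> \<otimes>\<^bsub>B\<^esub> emb S x (inv\<^bsub>TG\<^esub> \<psi> \<otimes>\<^bsub>TG\<^esub> \<chi>))"
    using assms by (intro S_mult emb_S_closed)
  also have "\<dots> = f (\<chi> \<otimes>\<^bsub>TG\<^esub> c (inv x)) \<otimes>\<^bsub>B\<^esub> emb S x (inv\<^bsub>TG\<^esub> (\<chi> \<otimes>\<^bsub>TG\<^esub> c (inv x)) \<otimes>\<^bsub>TG\<^esub> \<chi>)"
    using assms by (intro A.finsum_eq_single finite_T)
      (auto simp: c_in_T emb_S_app emb_closed TG_mult_T TG_inv_T eq NT_inv)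
  finally show ?thesis
    using x \<chi> eq[of "\<chi> \<otimes>\<^bsub>TG\<^esub> c (inv x)"] by (simp add: emb_S_app c_in_T TG_mult_T NT_inv)
qed

lemma act_S_mult:
  assumes g: "g \<in> NP" and f: "f \<in> carrier S" and f': "f' \<in> carrier S"
  shows "act S g (f \<otimes>\<^bsub>S\<^esub> f') = act S g f \<otimes>\<^bsub>S\<^esub> act S g f'"
proof (rule S_eqI)
  fix \<chi> assume \<chi>: "\<chi> \<in> T"
  let ?c = "conj_aut G P (inv g)"
  have gL: "g \<in> L" and g': "inv g \<in> NP" using g by (simp_all add: NPL)
  have T: "\<phi> \<in> T \<Longrightarrow> \<phi> \<in> carrier TG" for \<phi> by (simp add: TG_carrier)
  have bij: "bij_betw ?c T T"
    using g by (intro bij_betw_byWitness[where f' = "conj_aut G P g"])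
      (auto simp: conj_aut_conj_aut conj_aut_T conj_aut_one NP_carrier)
  have inv: "?c (inv\<^bsub>TG\<^esub> \<psi>) = inv\<^bsub>TG\<^esub> (?c \<psi>)" if "\<psi> \<in> T" for \<psi>
  proof -
    have "?c (inv\<^bsub>TG\<^esub> \<psi>) \<otimes>\<^bsub>TG\<^esub> ?c \<psi> = ?c \<one>\<^bsub>TG\<^esub>"
      using that g' T by (simp add: TG_inv_T flip: conj_aut_mult)
    also have "\<dots> = \<one>\<^bsub>TG\<^esub>"
      using g by (simp add: TG_one conj_aut_c NT_one NP_carrier)
    finally show ?thesis
      using that g' by (intro TG.inv_equality[symmetric]) (auto simp: TG_carrier conj_aut_T TG_inv_T)
  qed
  note [simp] = gL f f' \<chi> conj_aut_T[OF g'] TG_mult_T TG_inv_T act_closed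
  let ?t = "\<lambda>\<psi>. act B g (f \<psi> \<otimes>\<^bsub>B\<^esub> f' (inv\<^bsub>TG\<^esub> \<psi> \<otimes>\<^bsub>TG\<^esub> ?c \<chi>))"
  have "act S g (f \<otimes>\<^bsub>S\<^esub> f') \<chi> = (\<Oplus>\<^bsub>B\<^esub>\<psi>\<in>T. ?t \<psi>)"
    by (simp add: act_S_app S_mult additive_map_finsum[OF additive_act])
  also have "\<dots> = (\<Oplus>\<^bsub>B\<^esub>\<psi>\<in>T. ?t (?c \<psi>))"
    by (rule A.finsum_bij[OF bij, symmetric]) simp
  also have "\<dots> = (\<Oplus>\<^bsub>B\<^esub>\<psi>\<in>T. act S g f \<psi> \<otimes>\<^bsub>B\<^esub> act S g f' (inv\<^bsub>TG\<^esub> \<psi> \<otimes>\<^bsub>TG\<^esub> \<chi>))"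
    by (rule A.finsum_cong'[OF refl]) (auto simp: act_S_app act_mult conj_aut_mult[OF g'] inv)
  also have "\<dots> = (act S g f \<otimes>\<^bsub>S\<^esub> act S g f') \<chi>"
    using g by (simp add: S_mult act_S_closed)
  finally show "act S g (f \<otimes>\<^bsub>S\<^esub> f') \<chi> = (act S g f \<otimes>\<^bsub>S\<^esub> act S g f') \<chi>" .
qed (use assms in \<open>auto intro: act_S_closed\<close>)

lemma S_add_app: "\<phi> \<in> T \<Longrightarrow> (f \<oplus>\<^bsub>S\<^esub> f') \<phi> = f \<phi> \<oplus>\<^bsub>B\<^esub> f' \<phi>"
  and S_smult_app: "\<phi> \<in> T \<Longrightarrow> (k \<odot>\<^bsub>S\<^esub> f) \<phi> = k \<odot>\<^bsub>B\<^esub> f \<phi>"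
  using S.F_add_app S.F_smult_app by (simp_all add: TG_carrier)

lemma interior_S: "interior_algebra K G (M \<inter> NT) NP S"
proof (rule interior_algebraI[OF subgroup_NP _ _ _ S.assoc_algebra_F])
  note [simp] = NPL act_closed conj_inv_T act_S_closed act_S_app NT_NP
  have one: "c x \<otimes>\<^bsub>TG\<^esub> (c (inv x) \<otimes>\<^bsub>TG\<^esub> \<chi>) = \<chi>" "c (inv x) \<otimes>\<^bsub>TG\<^esub> (c x \<otimes>\<^bsub>TG\<^esub> \<chi>) = \<chi>"
    if "x \<in> NT" "\<chi> \<in> T" for x \<chi>
    using that TG.inv_cancel_left[of "c x" \<chi>] by (simp_all add: TG_carrier c_in_T flip: inv_TG)
  show "subgroup (M \<inter> NT) G" by (rule subgroups_Inter_pair[OF subgroup_M subgroup_NT])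
  show "g \<otimes> n \<otimes> inv g \<in> M \<inter> NT" if "g \<in> NP" "n \<in> M \<inter> NT" for g n
    using that by (simp add: M_normal NT_conj)
  show "emb S (n \<otimes> m) = emb S n \<otimes>\<^bsub>S\<^esub> emb S m" if "n \<in> M \<inter> NT" "m \<in> M \<inter> NT" for n m
  proof (rule S_eqI)
    have nm: "n \<otimes> m \<in> M" "n \<otimes> m \<in> NT"
      using that subgroup.m_closed[OF subgroup_M] by (auto simp: NT_mult)
    then show "emb S (n \<otimes> m) \<in> carrier S" by (rule emb_S_closed)
    fix \<chi> assume \<chi>: "\<chi> \<in> T"
    have "\<chi> = c (n \<otimes> m) \<longleftrightarrow> c (inv n) \<otimes>\<^bsub>TG\<^esub> \<chi> = c m"
      using that one[of n \<chi>] one[of n "c m"] \<chi> by (auto simp: c_mult_TG[symmetric] c_in_T)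
    then show "emb S (n \<otimes> m) \<chi> = (emb S n \<otimes>\<^bsub>S\<^esub> emb S m) \<chi>"
      using that \<chi> by (simp add: emb_S_mult_app emb_S_closed emb_S_app emb_mult emb_closed TG_mult_T c_in_T NT_inv)
  qed (use that in \<open>auto intro: emb_S_closed\<close>)
  show "act S n f \<otimes>\<^bsub>S\<^esub> emb S n = emb S n \<otimes>\<^bsub>S\<^esub> f" if n: "n \<in> M \<inter> NT" and f: "f \<in> carrier S" for n f
  proof (rule S_eqI)
    fix \<chi> assume \<chi>: "\<chi> \<in> T"
    then obtain x where x: "x \<in> NT" "\<chi> = c x" by (rule TE)
    have "inv n \<otimes> (x \<otimes> inv n) \<otimes> inv (inv n) = inv n \<otimes> x"
      using n x by (simp add: group_word NT_carrier)
    then have "conj_aut G P (inv n) (\<chi> \<otimes>\<^bsub>TG\<^esub> c (inv n)) = c (inv n) \<otimes>\<^bsub>TG\<^esub> \<chi>"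
      using n x by (simp add: c_mult_TG NT_inv NT_mult conj_aut_c)
    then show "(act S n f \<otimes>\<^bsub>S\<^esub> emb S n) \<chi> = (emb S n \<otimes>\<^bsub>S\<^esub> f) \<chi>"
      using n f \<chi> by (simp add: mult_emb_S_app emb_S_mult_app TG_mult_T c_in_T NT_inv act_inner)
  qed (use n f in \<open>auto intro!: SR.m_closed emb_S_closed act_S_closed NT_NP\<close>)
  show "act S g (emb S n) = emb S (g \<otimes> n \<otimes> inv g)" if g: "g \<in> NP" and n: "n \<in> M \<inter> NT" for g n
  proof (rule S_eqI)
    fix \<chi> assume \<chi>: "\<chi> \<in> T"
    have "conj_aut G P (inv g) \<chi> = c n \<longleftrightarrow> \<chi> = conj_aut G P g (c n)"
    proof -
      have "conj_aut G P g (conj_aut G P (inv g) \<chi>) = \<chi>" "conj_aut G P (inv g) (conj_aut G P g (c n)) = c n"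
        using g n \<chi> by (auto simp: conj_aut_conj_aut conj_aut_one NP_carrier c_in_T)
      then show ?thesis by metis
    qed
    then show "act S g (emb S n) \<chi> = emb S (g \<otimes> n \<otimes> inv g) \<chi>"
      using g n \<chi> by (simp add: emb_S_app conj_aut_c act_emb additive_map_zero[OF additive_act])
  qed (use g n in \<open>auto intro!: emb_S_closed act_S_closed M_normal NT_conj NPL\<close>)
  show "act S g (act S h f) = act S (g \<otimes> h) f" if "g \<in> NP" "h \<in> NP" "f \<in> carrier S" for g h f
    using that by (intro S_eqI) (auto simp: act_act conj_aut_conj_aut conj_aut_T inv_mult_group NP_carrier)
  show "act S \<one> f = f" if "f \<in> carrier S" for f
    using that by (intro S_eqI) (auto simp: act_group_one conj_aut_one)
  show "act S g (f \<oplus>\<^bsub>S\<^esub> f') = act S g f \<oplus>\<^bsub>S\<^esub> act S g f'"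
    if "g \<in> NP" "f \<in> carrier S" "f' \<in> carrier S" for g f f'
    using that by (intro S_eqI) (auto simp: S_add_app act_add)
  show "act S g (k \<odot>\<^bsub>S\<^esub> f) = k \<odot>\<^bsub>S\<^esub> act S g f"
    if "g \<in> NP" "k \<in> carrier K" "f \<in> carrier S" for g k f
    using that S.F_smult_closed by (intro S_eqI) (auto simp: S_smult_app act_smult)
  show "act S g (f \<otimes>\<^bsub>S\<^esub> f') = act S g f \<otimes>\<^bsub>S\<^esub> act S g f'"
    if "g \<in> NP" "f \<in> carrier S" "f' \<in> carrier S" for g f f'
    using that by (rule act_S_mult)
  show "emb S \<one> = \<one>\<^bsub>S\<^esub>"
    by (simp add: Brauer_sum_def emb_one c_one cong: if_cong)
qed (auto simp: emb_S_closed act_S_closed NT_NP)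

abbreviation J where "J \<equiv> \<Pi>\<^sub>E \<phi>\<in>T. kernel \<phi>"

lemma J_S: "f \<in> J \<Longrightarrow> f \<in> carrier S"
  using kernel_fixed by (auto simp: S_carrier)

lemma J_iff: "f \<in> carrier S \<Longrightarrow> f \<in> J \<longleftrightarrow> (\<forall>\<phi>\<in>T. f \<phi> \<in> kernel \<phi>)"
  by (auto simp: S_carrier)

sublocale J: int_alg_ideal G K "M \<inter> NT" NP S J
proof (intro int_alg_ideal.intro int_algI interior_S int_alg_ideal_axioms.intro)
  show "ideal J S"
  proof (rule idealI[OF SR.ring_axioms])
    have eval: "additive_map S B (\<lambda>f. f \<phi>)" if "\<phi> \<in> T" for \<phi>
      using S.additive_eval that by (simp add: TG_carrier)
    show "subgroup J (add_monoid S)"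
    proof (rule group.subgroupI[OF S.F.a_group])
      have "\<zero>\<^bsub>S\<^esub> \<in> J"
        using subgroup.one_closed[OF kernel_subgroup] S.F.zero_closed
        by (subst J_iff) (auto simp: additive_map_zero[OF eval])
      then show "J \<noteq> {}" by blast
      show "inv\<^bsub>add_monoid S\<^esub> f \<in> J" if "f \<in> J" for f
        using subgroup.m_inv_closed[OF kernel_subgroup] that J_S[OF that]
        by (simp flip: a_inv_def) (subst J_iff, auto simp: additive_map_neg[OF eval] PiE_iff)
      show "f \<otimes>\<^bsub>add_monoid S\<^esub> f' \<in> J" if "f \<in> J" "f' \<in> J" for f f'
        using subgroup.m_closed[OF kernel_subgroup] that J_S[OF that(1)] J_S[OF that(2)]
        by simp (subst J_iff, auto simp: S_add_app PiE_iff)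
    qed (use J_S in auto)
    fix f f' assume f: "f \<in> J" and f': "f' \<in> carrier S"
    have mult: "a \<otimes>\<^bsub>B\<^esub> b \<in> kernel \<chi>"
      if "\<psi> \<in> T" "\<chi> \<in> T" "a \<in> fixed \<psi> \<and> b \<in> kernel (inv\<^bsub>TG\<^esub> \<psi> \<otimes>\<^bsub>TG\<^esub> \<chi>) \<or>
          a \<in> kernel \<psi> \<and> b \<in> fixed (inv\<^bsub>TG\<^esub> \<psi> \<otimes>\<^bsub>TG\<^esub> \<chi>)" for a b \<psi> \<chi>
    proof -
      obtain x where x: "x \<in> NT" "\<psi> = c x" using \<open>\<psi> \<in> T\<close> by (rule TE)
      obtain y where y: "y \<in> NT" "\<chi> = c y" using \<open>\<chi> \<in> T\<close> by (rule TE)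
      note xy = x y
      have "x \<otimes> (inv x \<otimes> y) = y" using xy by (simp add: inv_cancel_left NT_carrier)
      then show ?thesis
        using that(3) kernel_mult_left[of x "inv x \<otimes> y" a b] kernel_mult_right[of x "inv x \<otimes> y" a b] xy
        by (auto simp: inv_TG c_mult_TG NT_inv NT_mult)
    qed
    have cl: "inv\<^bsub>TG\<^esub> \<psi> \<otimes>\<^bsub>TG\<^esub> \<chi> \<in> T" if "\<psi> \<in> T" "\<chi> \<in> T" for \<psi> \<chi>
      using that by (simp add: TG_mult_T TG_inv_T)
    note fS = J_S[OF f]
    show "f' \<otimes>\<^bsub>S\<^esub> f \<in> J"
    proof (subst J_iff)
      show "\<forall>\<chi>\<in>T. (f' \<otimes>\<^bsub>S\<^esub> f) \<chi> \<in> kernel \<chi>"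
      proof
        fix \<chi> assume \<chi>: "\<chi> \<in> T"
        have "f' \<psi> \<otimes>\<^bsub>B\<^esub> f (inv\<^bsub>TG\<^esub> \<psi> \<otimes>\<^bsub>TG\<^esub> \<chi>) \<in> kernel \<chi>" if "\<psi> \<in> T" for \<psi>
          using mult[OF that \<chi>] S_fixed[OF f' that] PiE_mem[OF f cl[OF that \<chi>]] by blast
        then show "(f' \<otimes>\<^bsub>S\<^esub> f) \<chi> \<in> kernel \<chi>"
          using f' fS \<chi> by (simp add: S_mult A.finsum_in_subgroup[OF kernel_subgroup])
      qed
    qed (use f' fS in simp)
    show "f \<otimes>\<^bsub>S\<^esub> f' \<in> J"
    proof (subst J_iff)
      show "\<forall>\<chi>\<in>T. (f \<otimes>\<^bsub>S\<^esub> f') \<chi> \<in> kernel \<chi>"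
      proof
        fix \<chi> assume \<chi>: "\<chi> \<in> T"
        have "f \<psi> \<otimes>\<^bsub>B\<^esub> f' (inv\<^bsub>TG\<^esub> \<psi> \<otimes>\<^bsub>TG\<^esub> \<chi>) \<in> kernel \<chi>" if "\<psi> \<in> T" for \<psi>
          using mult[OF that \<chi>] S_fixed[OF f' cl[OF that \<chi>]] PiE_mem[OF f that] by blast
        then show "(f \<otimes>\<^bsub>S\<^esub> f') \<chi> \<in> kernel \<chi>"
          using f' fS \<chi> by (simp add: S_mult A.finsum_in_subgroup[OF kernel_subgroup])
      qed
    qed (use f' fS in simp)
  qed
  show "k \<odot>\<^bsub>S\<^esub> f \<in> J" if "k \<in> carrier K" "f \<in> J" for k f
    using that J_S[OF that(2)] S.F_smult_closed
    by (subst J_iff) (auto simp: S_smult_app kernel_smult PiE_iff)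
  show "act S g f \<in> J" if "g \<in> NP" "f \<in> J" for g f
    using that J_S[OF that(2)] fixed_act_conj(2)[OF that(1)] conj_inv_T[OF that(1)]
    by (subst J_iff) (auto simp: act_S_closed act_S_app PiE_iff)
qed

lemma interior_Brauer_quot: "interior_algebra K G (M \<inter> NT) NP (Brauer_quot G B P T)"
  unfolding Brauer_quot_def by (rule J.interior_quot)

end

section \<open>Homomorphisms of extended Brauer quotients\<close>

text \<open>
  The action of \<open>\<Delta>\<^sub>\<phi>(P)\<close> involves only the images of elements of \<open>N\<close> and the action of \<open>P\<close>. Thus a
  homomorphism of \<open>N\<close>-interior \<open>N_G(P)\<close>-algebras commutes with it.
\<close>

lemma
  fixes G :: "('g, 'n) monoid_scheme" (structure)
  assumes B: "brauer_alg G N P T K M L B" and B': "brauer_alg G N P T K M' L' B'"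
    and h: "interior_hom K N (normalizer G P) B B' h"
  shows hom_kernel: "\<lbrakk>\<phi> \<in> T; b \<in> Brauer_kernel G B P \<phi>\<rbrakk> \<Longrightarrow> h b \<in> Brauer_kernel G B' P \<phi>"
    and Brauer_sum_hom: "interior_hom K (N \<inter> normalizer_T G P T) (normalizer G P)
      (Brauer_sum G B P T) (Brauer_sum G B' P T) (\<lambda>f. \<lambda>\<phi>\<in>T. h (f \<phi>))"
proof -
  interpret B: brauer_alg G N P T K M L B by fact
  interpret B': brauer_alg G N P T K M' L' B' by fact
  note hD = interior_homD[OF h]
  have add: "additive_map B B' h"
    using interior_hom_additive[OF h] B.A.ring_axioms B'.A.ring_axioms by blast
  have equiv: "h (Delta_act G B \<phi> u b) = Delta_act G B' \<phi> (\<one> \<otimes> u \<otimes> inv \<one>) (h b)"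
    if T: "\<phi> \<in> T" and u: "u \<in> P" and b: "b \<in> carrier B" for \<phi> u b
  proof -
    have "u \<in> L" using B.NPL B.P_NP u by blast
    moreover have "\<phi> u \<otimes> inv u \<in> N" using T u by (simp add: B.T_def)
    ultimately show ?thesis
      using b u by (simp add: Delta_act_def hD B.P_carrier B.act_closed B.emb_closed B.NM B.P_NP)
  qed
  note tr = B B' _ _ add B.NP_simps(1) equiv
  have fixed: "h b \<in> Delta_fixed G B' \<phi> P" if "\<phi> \<in> T" "b \<in> Delta_fixed G B \<phi> P" for \<phi> b
    using that(1) by (intro fixed_transport[OF tr that(2)]) auto
  show "h b \<in> Brauer_kernel G B' P \<phi>" if "\<phi> \<in> T" "b \<in> Brauer_kernel G B P \<phi>" for \<phi> b
    using that(1) by (intro kernel_transport[OF tr that(2)]) auto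
  let ?h = "\<lambda>f. \<lambda>\<phi>\<in>T. h (f \<phi>)"
  have closed: "?h f \<in> carrier B'.S" if "f \<in> carrier B.S" for f
    using that fixed B.S_fixed by (simp add: B'.S_carrier)
  show "interior_hom K (N \<inter> B.NT) B.NP B.S B'.S ?h"
  proof (rule interior_homI)
    show "?h (f \<otimes>\<^bsub>B.S\<^esub> f') = ?h f \<otimes>\<^bsub>B'.S\<^esub> ?h f'" if f: "f \<in> carrier B.S" "f' \<in> carrier B.S" for f f'
    proof (rule B'.S_eqI)
      fix \<chi> assume \<chi>: "\<chi> \<in> T"
      note [simp] = B.TG_mult_T B.TG_inv_T hD(1) f \<chi>
      show "?h (f \<otimes>\<^bsub>B.S\<^esub> f') \<chi> = (?h f \<otimes>\<^bsub>B'.S\<^esub> ?h f') \<chi>"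
        using closed
        by (auto simp: B.S_mult B'.S_mult additive_map_finsum[OF add] hD(3) intro!: B'.A.finsum_cong')
    qed (use f closed in auto)
    show "?h (f \<oplus>\<^bsub>B.S\<^esub> f') = ?h f \<oplus>\<^bsub>B'.S\<^esub> ?h f'" if f: "f \<in> carrier B.S" "f' \<in> carrier B.S" for f f'
      using f closed B.S.F_add_closed B'.S.F_add_closed
      by (intro B'.S_eqI) (auto simp: B.S_add_app B'.S_add_app hD)
    show "?h (k \<odot>\<^bsub>B.S\<^esub> f) = k \<odot>\<^bsub>B'.S\<^esub> ?h f" if f: "k \<in> carrier K" "f \<in> carrier B.S" for k f
      using f closed B.S.F_smult_closed B'.S.F_smult_closed
      by (intro B'.S_eqI) (auto simp: B.S_smult_app B'.S_smult_app hD)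
    show "?h (act B.S g f) = act B'.S g (?h f)" if f: "g \<in> B.NP" "f \<in> carrier B.S" for g f
      using f closed B.act_S_closed B'.act_S_closed
      by (intro B'.S_eqI) (auto simp: B.act_S_app B'.act_S_app B.conj_inv_T hD)
    show "?h \<one>\<^bsub>B.S\<^esub> = \<one>\<^bsub>B'.S\<^esub>"
      using additive_map_zero[OF add] hD(4) by (auto simp: Brauer_sum_def fun_eq_iff)
    show "?h (emb B.S n) = emb B'.S n" if "n \<in> N \<inter> B.NT" for n
      using that additive_map_zero[OF add] hD(6) by (auto simp: Brauer_sum_def fun_eq_iff)
  qed (rule closed)
qed

section \<open>The extended Brauer quotient of a tensor product\<close>

context brauer_group
begin

abbreviation Y where "Y \<equiv> NT <#> N"
text \<open>
  The algebra \<open>E\<close> is \<open>Y\<close>-interior, and \<open>Y\<close> need not be contained in \<open>NP\<close>. The group that acts on \<open>E\<close> is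
  therefore enlarged to \<open>NP N\<close>, in which \<open>Y\<close> is normal.
\<close>

abbreviation NPN where "NPN \<equiv> NP <#> N"

lemma set_mult_iff: "y \<in> S <#> N \<longleftrightarrow> (\<exists>s\<in>S. \<exists>n\<in>N. y = s \<otimes> n)"
  by (auto simp: set_mult_def)

lemma N_conj': "\<lbrakk>g \<in> carrier G; n \<in> N\<rbrakk> \<Longrightarrow> inv g \<otimes> n \<otimes> g \<in> N"
  using N_conj[of "inv g" n] by simp

lemma subgroup_mult_N:
  assumes S: "subgroup S G" shows "subgroup (S <#> N) G"
proof (rule subgroupI)
  have Sc: "s \<in> carrier G" if "s \<in> S" for s using S that subgroup.subset by blast
  show "S <#> N \<subseteq> carrier G" using Sc N_carrier by (auto simp: set_mult_iff)
  show "S <#> N \<noteq> {}" using subgroup.one_closed[OF S] N_simps(1) unfolding set_mult_def by blast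
  fix a assume "a \<in> S <#> N"
  then obtain s n where a: "s \<in> S" "n \<in> N" "a = s \<otimes> n" by (auto simp: set_mult_iff)
  note [simp] = Sc[OF a(1)] N_carrier[OF a(2)]
  have "inv a = inv s \<otimes> (s \<otimes> inv n \<otimes> inv s)" using a by (simp add: group_word)
  moreover have "s \<otimes> inv n \<otimes> inv s \<in> N" using a by (intro N_conj) auto
  ultimately show "inv a \<in> S <#> N"
    using subgroup.m_inv_closed[OF S a(1)] unfolding set_mult_iff by blast
  fix b assume "b \<in> S <#> N"
  then obtain s' n' where b: "s' \<in> S" "n' \<in> N" "b = s' \<otimes> n'" by (auto simp: set_mult_iff)
  note [simp] = Sc[OF b(1)] N_carrier[OF b(2)]
  have "a \<otimes> b = (s \<otimes> s') \<otimes> (inv s' \<otimes> n \<otimes> s' \<otimes> n')" using a b by (simp add: group_word)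
  moreover have "inv s' \<otimes> n \<otimes> s' \<otimes> n' \<in> N" using a b by (intro N_simps N_conj') auto
  ultimately show "a \<otimes> b \<in> S <#> N"
    using subgroup.m_closed[OF S a(1) b(1)] unfolding set_mult_iff by blast
qed

lemma subset_mult_N: assumes "subgroup S G" shows "S \<subseteq> S <#> N" "N \<subseteq> S <#> N"
proof -
  have "s = s \<otimes> \<one>" if "s \<in> S" for s using assms that subgroup.mem_carrier by fastforce
  then show "S \<subseteq> S <#> N" using N_simps(1) unfolding set_mult_iff subset_iff by blast
  have "n = \<one> \<otimes> n" if "n \<in> N" for n using that N_carrier by simp
  then show "N \<subseteq> S <#> N" using subgroup.one_closed[OF assms] unfolding set_mult_iff subset_iff by blast
qed

lemma Y_normal:
  assumes "g \<in> NPN" "x \<in> Y" shows "g \<otimes> x \<otimes> inv g \<in> Y"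
proof -
  obtain h n where h: "h \<in> NP" "n \<in> N" "g = h \<otimes> n" using assms(1) by (auto simp: set_mult_iff)
  obtain y m where y: "y \<in> NT" "m \<in> N" "x = y \<otimes> m" using assms(2) by (auto simp: set_mult_iff)
  note [simp] = NP_carrier[OF h(1)] N_carrier[OF h(2)] NT_carrier[OF y(1)] N_carrier[OF y(2)]
  have "g \<otimes> x \<otimes> inv g = (h \<otimes> y \<otimes> inv h) \<otimes> (h \<otimes> (inv y \<otimes> n \<otimes> y \<otimes> (m \<otimes> inv n)) \<otimes> inv h)"
    using h y by (simp add: group_word)
  moreover have "h \<otimes> (inv y \<otimes> n \<otimes> y \<otimes> (m \<otimes> inv n)) \<otimes> inv h \<in> N"
    using h y by (intro N_conj N_simps N_conj') auto
  moreover have "h \<otimes> y \<otimes> inv h \<in> NT" using h y by (intro NT_conj)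
  ultimately show ?thesis unfolding set_mult_iff by blast
qed

text \<open>
  This allows the transversal of \<open>N\<close> in \<open>Y\<close> to be chosen in \<open>NT\<close>.
\<close>

lemma Y_coset:
  assumes "g \<in> Y" obtains n y where "n \<in> N" "y \<in> NT" "g = n \<otimes> y"
proof -
  obtain y m where y: "y \<in> NT" "m \<in> N" "g = y \<otimes> m" using assms by (auto simp: set_mult_iff)
  have "g = (y \<otimes> m \<otimes> inv y) \<otimes> y" using y by (simp add: group_word NT_carrier N_carrier)
  moreover have "y \<otimes> m \<otimes> inv y \<in> N" using y by (intro N_conj NT_carrier)
  ultimately show thesis using that y(1) by blast
qed

end

text \<open>
  The prefixes below refer to \<open>E\<close> as a tensor product (\<open>TE\<close>), to the extended Brauer quotients of \<open>A\<close>
  and of \<open>E\<close> (\<open>BA\<close> and \<open>BE\<close>), and to the tensor product formed with the first of these (\<open>TQ\<close>).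
\<close>

locale brauer_tensor = brauer_group G N P T + A: int_alg G K N "carrier G" A
  for G :: "('g, 'n) monoid_scheme" (structure) and N P T and K :: "('k, 'm) ring_scheme"
    and A :: "('k, 'a, 'g) interior_alg"
begin

sublocale TE: interior_tensor G K N "carrier G" A Y NPN
proof (intro interior_tensor.intro interior_tensor_axioms.intro A.int_alg_axioms)
  have "subgroup NPN G" "subgroup Y G" by (intro subgroup_mult_N subgroup_NP subgroup_NT)+
  then show "subgroup NPN G" "subgroup Y G" "NPN \<subseteq> carrier G" "finite Y"
    using finite_G finite_subset subgroup.subset by blast+
  show "N \<subseteq> Y" by (rule subset_mult_N[OF subgroup_NT])
  show "Y \<subseteq> NPN" using NT_NP by (auto simp: set_mult_def)
qed (rule Y_normal)

abbreviation E where "E \<equiv> TE.AH"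

sublocale BA: brauer_alg G N P T K N "carrier G" A
  using NP_carrier by unfold_locales auto

lemma NP_NPN: "NP \<subseteq> NPN"
  by (rule subset_mult_N[OF subgroup_NP])

sublocale BE: brauer_alg G N P T K Y NPN E
  using TE.balancing.interior_quot NP_NPN subset_mult_N(2)[OF subgroup_NT]
  by (intro brauer_alg.intro brauer_alg_axioms.intro int_algI brauer_group_axioms)

lemma NT_Y: "x \<in> NT \<Longrightarrow> x \<in> Y"
  using subset_mult_N(1)[OF subgroup_NT] by blast

lemma Y_Int_NT: "Y \<inter> NT = NT"
  using NT_Y by blast

sublocale TQ: interior_tensor G K "N \<inter> NT" NP "Brauer_quot G A P T" NT NP
proof (intro interior_tensor.intro int_algI BA.interior_Brauer_quot interior_tensor_axioms.intro
    subgroup_NT subgroup_NP)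
  show "finite NT" using finite_subset[OF subgroup.subset[OF subgroup_NT] finite_G] .
qed (use NT_NP NT_conj in auto)

text \<open>
  With \<open>v = g u g\<^sup>-\<^sup>1\<close>, the action of \<open>u\<close> takes \<open>a \<otimes> g\<close> to \<open>\<^sup>ua \<otimes> u g u\<^sup>-\<^sup>1\<close>, and \<open>u g u\<^sup>-\<^sup>1 = (u v\<^sup>-\<^sup>1) g\<close> with
  \<open>u v\<^sup>-\<^sup>1 \<in> N\<close>. Moving this element of \<open>N\<close> to the coefficient turns \<open>\<^sup>ua\<close> into \<open>\<^sup>ua (u v\<^sup>-\<^sup>1) = (u v\<^sup>-\<^sup>1) \<^sup>va\<close>.
\<close>

lemma coord_D:
  assumes x: "x \<in> NT" and g: "g \<in> NT" and u: "u \<in> P" and C: "C \<in> carrier E"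
  shows "TE.coord_class g (BE.D (c x) u C) = BA.D (c (x \<otimes> inv g)) (g \<otimes> u \<otimes> inv g) (TE.coord_class g C)"
proof -
  obtain f where f: "f \<in> carrier TE.F" "C = TE.balancing.cls f" using C by (rule TE.balancing.quot_carrierE)
  note [simp] = NT_carrier[OF x] NT_carrier[OF g] P_carrier[OF u] f(1)
  have uL: "u \<in> NPN" using NP_NPN P_NP[OF u] by blast
  have gY: "g \<in> Y" using g by (rule NT_Y)
  have v: "g \<otimes> u \<otimes> inv g \<in> P" using g u by (intro P_conj NT_NP)
  let ?v = "g \<otimes> u \<otimes> inv g" and ?n = "x \<otimes> u \<otimes> inv x \<otimes> inv u" and ?a = "TE.coord g f"
  have n: "?n \<in> N" using x u by (rule NT_comm)
  have uv: "u \<otimes> inv ?v \<in> N"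
  proof -
    have "inv (?v \<otimes> inv u) \<in> N" by (intro N_simps NT_comm g u)
    then show ?thesis by (simp add: group_word)
  qed
  have a: "?a \<in> carrier A" using gY by simp
  have m: "inv u \<otimes> g \<otimes> u \<otimes> inv g \<in> N"
  proof -
    have "inv u \<otimes> (g \<otimes> u \<otimes> inv g \<otimes> inv u) \<otimes> u \<in> N" using NT_comm[OF g u] by (intro N_conj') auto
    then show ?thesis by (simp add: group_word)
  qed
  let ?m = "inv u \<otimes> g \<otimes> u \<otimes> inv g"
  have ug: "inv u \<otimes> g \<otimes> u \<in> Y" using TE.H_normal'[OF uL gY] .
  \<comment> \<open>As \<open>u\<^sup>-\<^sup>1 g u\<close> lies in \<open>N g\<close>, its coordinate is that of \<open>g\<close> up to an element of \<open>N\<close>.\<close>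
  have shift: "TE.coord (inv u \<otimes> g \<otimes> u) f = ?a \<otimes>\<^bsub>A\<^esub> emb A (inv ?m)"
  proof -
    have "inv ?m \<otimes> (inv u \<otimes> g \<otimes> u) = g" by (simp add: group_word)
    then have "TE.coord g f \<otimes>\<^bsub>A\<^esub> emb A (inv ?m) = TE.coord (inv u \<otimes> g \<otimes> u) f"
      using TE.coord_shift[of "inv u \<otimes> g \<otimes> u" "inv ?m" f] ug m by simp
    then show ?thesis by simp
  qed
  have "BE.D (c x) u C = TE.balancing.cls (emb TE.F ?n \<otimes>\<^bsub>TE.F\<^esub> act TE.F u f)"
    using u uL n f(2) TE.M_in_H[OF n]
    by (simp add: BE.D_c TE.balancing.quot_ops TE.balancing.quot_act TE.act_F_closed TE.balancing.emb_closed)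
  then have "TE.coord_class g (BE.D (c x) u C) = emb A ?n \<otimes>\<^bsub>A\<^esub> TE.coord g (act TE.F u f)"
    using n gY uL TE.M_in_H[OF n]
    by (simp add: TE.coord_class_cls TE.act_F_closed TE.balancing.emb_closed TE.coord_emb_mult)
  also have "TE.coord g (act TE.F u f) = act A u (?a \<otimes>\<^bsub>A\<^esub> emb A (inv ?m))"
    using gY uL by (simp add: TE.coord_act shift)
  also have "\<dots> = act A u ?a \<otimes>\<^bsub>A\<^esub> emb A (u \<otimes> inv ?v)"
  proof -
    have "u \<otimes> inv ?m \<otimes> inv u = u \<otimes> inv ?v" by (simp add: group_word)
    then show ?thesis using m a by (simp only: A.act_mult A.act_emb A.emb_closed N_simps P_carrier[OF u])
  qed
  also have "\<dots> = emb A (u \<otimes> inv ?v) \<otimes>\<^bsub>A\<^esub> act A ?v ?a"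
  proof -
    have "u \<otimes> inv ?v \<otimes> ?v = u" by (simp add: group_word)
    then show ?thesis using BA.emb_act[OF uv _ a, of ?v] by simp
  qed
  also have "emb A ?n \<otimes>\<^bsub>A\<^esub> (emb A (u \<otimes> inv ?v) \<otimes>\<^bsub>A\<^esub> act A ?v ?a) = emb A (?n \<otimes> (u \<otimes> inv ?v)) \<otimes>\<^bsub>A\<^esub> act A ?v ?a"
    using n uv a by (subst A.emb_mult) (auto simp: A.A.m_assoc A.emb_closed A.act_closed)
  also have "?n \<otimes> (u \<otimes> inv ?v) = x \<otimes> inv g \<otimes> ?v \<otimes> inv (x \<otimes> inv g) \<otimes> inv ?v"
    by (simp add: group_word)
  finally show ?thesis
    using v f gY by (simp add: BA.D_c TE.coord_class_cls)
qed

lemma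
  assumes x: "x \<in> NT" and g: "g \<in> NT"
  shows coord_fixed: "C \<in> BE.fixed (c x) \<Longrightarrow> TE.coord_class g C \<in> BA.fixed (c (x \<otimes> inv g))"
    and coord_kernel: "C \<in> BE.kernel (c x) \<Longrightarrow> TE.coord_class g C \<in> BA.kernel (c (x \<otimes> inv g))"
proof -
  note tr = BE.this_brauer_alg BA.this_brauer_alg c_in_T[OF x] c_in_T[OF NT_mult[OF x NT_inv[OF g]]]
    TE.additive_coord_class[OF NT_Y[OF g]] NT_NP[OF g] coord_D[OF x g]
  show "C \<in> BE.fixed (c x) \<Longrightarrow> TE.coord_class g C \<in> BA.fixed (c (x \<otimes> inv g))"
    by (rule fixed_transport[OF tr])
  show "C \<in> BE.kernel (c x) \<Longrightarrow> TE.coord_class g C \<in> BA.kernel (c (x \<otimes> inv g))"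
    by (rule kernel_transport[OF tr])
qed

abbreviation QA where "QA \<equiv> Brauer_quot G A P T"
abbreviation QE where "QE \<equiv> Brauer_quot G E P T"

text \<open>The map induced by \<open>a \<mapsto> a \<otimes> 1\<close>, on the direct sums and on their quotients.\<close>

definition \<iota>S where "\<iota>S f = (\<lambda>\<phi>\<in>T. TE.incl (f \<phi>))"
definition \<iota>Q where "\<iota>Q C = (\<Union>f\<in>C. BE.J +>\<^bsub>BE.S\<^esub> \<iota>S f)"

lemma incl_hom: "interior_hom K N NP A E TE.incl"
  using TE.incl_hom NP_NPN by (auto simp: interior_hom_def)

lemma \<iota>S_hom: "interior_hom K (N \<inter> NT) NP BA.S BE.S \<iota>S"
  using Brauer_sum_hom[OF BA.this_brauer_alg BE.this_brauer_alg incl_hom] by (simp add: \<iota>S_def[abs_def])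

lemma \<iota>S_J: "f \<in> BA.J \<Longrightarrow> \<iota>S f \<in> BE.J"
  using hom_kernel[OF BA.this_brauer_alg BE.this_brauer_alg incl_hom] by (auto simp: \<iota>S_def)

lemma
  shows \<iota>Q_hom: "interior_hom K (N \<inter> NT) NP QA QE \<iota>Q"
    and \<iota>Q_cls: "f \<in> carrier BA.S \<Longrightarrow> \<iota>Q (BA.J.cls f) = BE.J.cls (\<iota>S f)"
proof -
  note q = interior_hom_quotients[OF BA.J.int_alg_ideal_axioms BE.J.int_alg_ideal_axioms subset_refl subset_refl
      subset_refl \<iota>S_hom \<iota>S_J, folded \<iota>Q_def Brauer_quot_def]
  show "interior_hom K (N \<inter> NT) NP QA QE \<iota>Q" by (rule q)
  show "f \<in> carrier BA.S \<Longrightarrow> \<iota>Q (BA.J.cls f) = BE.J.cls (\<iota>S f)" by (rule q)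
qed

lemma interior_QE: "interior_algebra K G NT NP QE"
  using BE.interior_Brauer_quot by (simp add: Y_Int_NT)

text \<open>
  This will be the inverse of the isomorphism, on \<open>A' \<otimes>\<^bsub>k\<^esub> kX\<close> with the extended Brauer quotient \<open>A'\<close> of \<open>A\<close>.
\<close>

definition \<Theta> where "\<Theta> = TQ.extend QE \<iota>Q"

lemma \<Theta>_hom: "interior_hom K NT NP TQ.F QE \<Theta>"
  unfolding \<Theta>_def by (rule TQ.extend_hom[OF interior_QE \<iota>Q_hom])

text \<open>
  If the coefficients of an element are represented by \<open>f x\<close>, then \<open>\<Phi> f\<close> represents its image under \<open>\<Theta>\<close>.
\<close>

definition \<Phi> where "\<Phi> f = (\<Oplus>\<^bsub>BE.S\<^esub>x\<in>NT. \<iota>S (f x) \<otimes>\<^bsub>BE.S\<^esub> emb BE.S x)"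

lemma \<Phi>_term_closed:
  assumes "f \<in> NT \<rightarrow> carrier BA.S" "x \<in> NT"
  shows "\<iota>S (f x) \<otimes>\<^bsub>BE.S\<^esub> emb BE.S x \<in> carrier BE.S"
  using assms interior_homD(1)[OF \<iota>S_hom] by (intro BE.SR.m_closed BE.emb_S_closed) (auto simp: NT_Y)

lemma \<Phi>_closed: "f \<in> NT \<rightarrow> carrier BA.S \<Longrightarrow> \<Phi> f \<in> carrier BE.S"
  unfolding \<Phi>_def using \<Phi>_term_closed by (intro BE.S.F.finsum_closed) blast

lemma \<Theta>_cls:
  assumes f: "f \<in> NT \<rightarrow> carrier BA.S"
  shows "\<Theta> (\<lambda>x\<in>NT. BA.J.cls (f x)) = BE.J.cls (\<Phi> f)"
proof -
  have emb: "emb QE x = BE.J.cls (emb BE.S x)" for x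
    by (simp add: Brauer_quot_def BE.J.quot_ops)
  interpret QE: int_alg G K NT NP QE by (rule int_algI[OF interior_QE])
  have "\<iota>Q (BA.J.cls (f x)) \<otimes>\<^bsub>QE\<^esub> emb QE x = BE.J.cls (\<iota>S (f x) \<otimes>\<^bsub>BE.S\<^esub> emb BE.S x)"
    if x: "x \<in> NT" for x
  proof -
    have fx: "f x \<in> carrier BA.S" using f x by blast
    have "BE.J.cls (\<iota>S (f x)) \<otimes>\<^bsub>QE\<^esub> BE.J.cls (emb BE.S x) = BE.J.cls (\<iota>S (f x) \<otimes>\<^bsub>BE.S\<^esub> emb BE.S x)"
      unfolding Brauer_quot_def
      by (rule BE.J.quot_ops(1)[OF interior_homD(1)[OF \<iota>S_hom fx] BE.emb_S_closed[OF NT_Y[OF x] x]])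
    then show ?thesis by (simp only: \<iota>Q_cls[OF fx] emb)
  qed
  moreover have "BE.J.cls (\<iota>S (f x) \<otimes>\<^bsub>BE.S\<^esub> emb BE.S x) \<in> carrier QE" if "x \<in> NT" for x
    unfolding Brauer_quot_def BE.J.quot_carrier using \<Phi>_term_closed[OF f that] by (rule imageI)
  ultimately have term_eq: "\<iota>Q (BA.J.cls (f x)) \<otimes>\<^bsub>QE\<^esub> emb QE x = BE.J.cls (\<iota>S (f x) \<otimes>\<^bsub>BE.S\<^esub> emb BE.S x)"
    "BE.J.cls (\<iota>S (f x) \<otimes>\<^bsub>BE.S\<^esub> emb BE.S x) \<in> carrier QE" if "x \<in> NT" for x
    using that by blast+
  have "\<Theta> (\<lambda>x\<in>NT. BA.J.cls (f x)) = (\<Oplus>\<^bsub>QE\<^esub>x\<in>NT. \<iota>Q (BA.J.cls (f x)) \<otimes>\<^bsub>QE\<^esub> emb QE x)"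
    unfolding \<Theta>_def TQ.extend_def[OF interior_QE \<iota>Q_hom]
    by (rule QE.A.finsum_cong'[OF refl]) (use term_eq in auto)
  also have "\<dots> = (\<Oplus>\<^bsub>QE\<^esub>x\<in>NT. BE.J.cls (\<iota>S (f x) \<otimes>\<^bsub>BE.S\<^esub> emb BE.S x))"
    by (rule QE.A.finsum_cong'[OF refl]) (use term_eq in auto)
  also have "\<dots> = BE.J.cls (\<Phi> f)"
    unfolding \<Phi>_def Brauer_quot_def
    by (rule additive_map_finsum[OF BE.J.additive_cls, symmetric]) (rule \<Phi>_term_closed[OF f])
  finally show ?thesis .
qed

lemma lift_closed:
  assumes "f \<in> NT \<rightarrow> carrier BA.S" "w \<in> NT" "x \<in> NT"
  shows "f x (c (w \<otimes> inv x)) \<in> carrier A"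
proof -
  have "f x \<in> carrier BA.S" using assms by blast
  then show ?thesis by (rule BA.S_closed) (intro c_in_T NT_mult NT_inv assms)
qed

lemma incl_emb_closed: "\<lbrakk>a \<in> carrier A; x \<in> NT\<rbrakk> \<Longrightarrow> TE.incl a \<otimes>\<^bsub>E\<^esub> emb E x \<in> carrier E"
  using interior_homD(1)[OF incl_hom] BE.emb_closed[OF NT_Y] by (rule BE.A.m_closed)

lemma \<Phi>_app:
  assumes f: "f \<in> NT \<rightarrow> carrier BA.S" and w: "w \<in> NT"
  shows "\<Phi> f (c w) = (\<Oplus>\<^bsub>E\<^esub>x\<in>NT. TE.incl (f x (c (w \<otimes> inv x))) \<otimes>\<^bsub>E\<^esub> emb E x)"
proof -
  have "\<Phi> f (c w) = (\<Oplus>\<^bsub>E\<^esub>x\<in>NT. (\<iota>S (f x) \<otimes>\<^bsub>BE.S\<^esub> emb BE.S x) (c w))"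
    unfolding \<Phi>_def using w by (intro BE.S.finsum_eval \<Phi>_term_closed f) (auto simp: TG_carrier c_in_T)
  also have "\<dots> = (\<Oplus>\<^bsub>E\<^esub>x\<in>NT. TE.incl (f x (c (w \<otimes> inv x))) \<otimes>\<^bsub>E\<^esub> emb E x)"
  proof (rule BE.A.finsum_cong'[OF refl])
    fix x assume x: "x \<in> NT"
    have "f x \<in> carrier BA.S" using f x by blast
    then show "(\<iota>S (f x) \<otimes>\<^bsub>BE.S\<^esub> emb BE.S x) (c w) = TE.incl (f x (c (w \<otimes> inv x))) \<otimes>\<^bsub>E\<^esub> emb E x"
      using x w interior_homD(1)[OF \<iota>S_hom]
      by (simp add: BE.mult_emb_S_app NT_Y c_in_T c_mult_TG NT_inv NT_mult \<iota>S_def)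
  qed (use lift_closed[OF f w] incl_emb_closed in blast)
  finally show ?thesis .
qed

lemma coord_\<Phi>:
  assumes f: "f \<in> NT \<rightarrow> carrier BA.S" and w: "w \<in> NT" and g: "g \<in> Y"
  shows "TE.coord_class g (\<Phi> f (c w)) =
    (\<Oplus>\<^bsub>A\<^esub>x\<in>NT. if x \<otimes> inv g \<in> N then f x (c (w \<otimes> inv x)) \<otimes>\<^bsub>A\<^esub> emb A (x \<otimes> inv g) else \<zero>\<^bsub>A\<^esub>)"
proof -
  note closed = lift_closed[OF f w]
  have "TE.coord_class g (\<Phi> f (c w)) =
      (\<Oplus>\<^bsub>A\<^esub>x\<in>NT. TE.coord_class g (TE.incl (f x (c (w \<otimes> inv x))) \<otimes>\<^bsub>E\<^esub> emb E x))"
    unfolding \<Phi>_app[OF f w]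
    by (rule additive_map_finsum[OF TE.additive_coord_class[OF g]]) (rule incl_emb_closed[OF closed])
  also have "\<dots> = (\<Oplus>\<^bsub>A\<^esub>x\<in>NT. if x \<otimes> inv g \<in> N then f x (c (w \<otimes> inv x)) \<otimes>\<^bsub>A\<^esub> emb A (x \<otimes> inv g) else \<zero>\<^bsub>A\<^esub>)"
    using closed g by (intro A.A.finsum_cong') (auto simp: TE.coord_class_incl_emb NT_Y A.emb_closed)
  finally show ?thesis .
qed

lemma lifts:
  assumes f: "f \<in> carrier TQ.F"
  obtains f' where "f' \<in> NT \<rightarrow> carrier BA.S" "f = (\<lambda>x\<in>NT. BA.J.cls (f' x))"
proof -
  have "\<exists>s\<in>carrier BA.S. f x = BA.J.cls s" if "x \<in> NT" for x
    using TQ.F_closed[OF f that] unfolding Brauer_quot_def BA.J.quot_carrier by blast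
  then obtain f' where f': "\<And>x. x \<in> NT \<Longrightarrow> f' x \<in> carrier BA.S \<and> f x = BA.J.cls (f' x)" by metis
  moreover have "f = (\<lambda>x\<in>NT. f x)" using f by (simp add: TQ.F_carrier PiE_restrict)
  ultimately have "f = (\<lambda>x\<in>NT. BA.J.cls (f' x))" by (metis (mono_tags, lifting) restrict_ext)
  then show thesis using f' that by blast
qed

text \<open>
  For \<open>v\<close> and \<open>g\<close> in \<open>NT\<close>, the coordinate at \<open>g\<close> of the component \<open>c (v g)\<close> of \<open>\<Phi> f'\<close> is the component \<open>c v\<close>
  of the coordinate at \<open>g\<close> of \<open>f'\<close>. If \<open>\<Phi> f'\<close> is zero in the Brauer quotient of \<open>E\<close>, then \<open>coord_kernel\<close>
  puts the former into the Brauer kernel of \<open>c v\<close>. So all coordinates of the given element vanish.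
\<close>

lemma \<Theta>_injective:
  assumes f: "f \<in> carrier TQ.F" and 0: "\<Theta> f = \<zero>\<^bsub>QE\<^esub>"
  shows "f \<in> balancing G QA (N \<inter> NT) NT"
proof -
  obtain f' where f': "f' \<in> NT \<rightarrow> carrier BA.S" "f = (\<lambda>x\<in>NT. BA.J.cls (f' x))" using f by (rule lifts)
  have "BE.J.cls (\<Phi> f') = \<zero>\<^bsub>QE\<^esub>" using 0 by (simp add: f'(2) \<Theta>_cls[OF f'(1)])
  then have \<Phi>: "\<Phi> f' \<in> BE.J"
    using BE.J.cls_zero_iff[OF \<Phi>_closed[OF f'(1)]] by (simp add: Brauer_quot_def)
  have "TQ.coord g f = \<zero>\<^bsub>QA\<^esub>" if g: "g \<in> NT" for g
  proof -
    let ?s = "\<lambda>n. f' (n \<otimes> g) \<otimes>\<^bsub>BA.S\<^esub> emb BA.S n"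
    have fn: "f' (n \<otimes> g) \<in> carrier BA.S" if "n \<in> N \<inter> NT" for n
      using f'(1) that g by (auto simp: NT_mult)
    have s: "?s n \<in> carrier BA.S" if "n \<in> N \<inter> NT" for n
      using that fn by (intro BA.SR.m_closed BA.emb_S_closed) auto
    have "TQ.coord g f = (\<Oplus>\<^bsub>QA\<^esub>n\<in>N \<inter> NT. BA.J.cls (?s n))"
      unfolding TQ.coord_def
    proof (rule TQ.A.finsum_cong'[OF refl])
      show "(\<lambda>n. BA.J.cls (?s n)) \<in> N \<inter> NT \<rightarrow> carrier QA"
        unfolding Brauer_quot_def BA.J.quot_carrier using s by blast
      fix n assume n: "n \<in> N \<inter> NT"
      have "BA.J.cls (f' (n \<otimes> g)) \<otimes>\<^bsub>QA\<^esub> BA.J.cls (emb BA.S n) = BA.J.cls (?s n)"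
        unfolding Brauer_quot_def using n by (intro BA.J.quot_ops(1) fn BA.emb_S_closed) auto
      moreover have "emb QA n = BA.J.cls (emb BA.S n)" by (simp add: Brauer_quot_def BA.J.quot_ops)
      moreover have "f (n \<otimes> g) = BA.J.cls (f' (n \<otimes> g))" using n g by (simp add: f'(2) NT_mult)
      ultimately show "f (n \<otimes> g) \<otimes>\<^bsub>QA\<^esub> emb QA n = BA.J.cls (?s n)" by simp
    qed
    also have "\<dots> = BA.J.cls (\<Oplus>\<^bsub>BA.S\<^esub>n\<in>N \<inter> NT. ?s n)"
      unfolding Brauer_quot_def by (rule additive_map_finsum[OF BA.J.additive_cls, symmetric]) (rule s)
    also have "\<dots> = \<zero>\<^bsub>QA\<^esub>"
    proof -
      have closed: "(\<Oplus>\<^bsub>BA.S\<^esub>n\<in>N \<inter> NT. ?s n) \<in> carrier BA.S"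
        using s by (intro BA.S.F.finsum_closed) blast
      have "(\<Oplus>\<^bsub>BA.S\<^esub>n\<in>N \<inter> NT. ?s n) \<chi> \<in> BA.kernel \<chi>" if \<chi>: "\<chi> \<in> T" for \<chi>
      proof -
        obtain v where v: "v \<in> NT" "\<chi> = c v" using \<chi> by (rule TE)
        let ?w = "v \<otimes> g"
        have w: "?w \<in> NT" using v g by (simp add: NT_mult)
        note [simp] = NT_carrier[OF v(1)] NT_carrier[OF g]
        let ?t = "\<lambda>x. if x \<otimes> inv g \<in> N then f' x (c (?w \<otimes> inv x)) \<otimes>\<^bsub>A\<^esub> emb A (x \<otimes> inv g) else \<zero>\<^bsub>A\<^esub>"
        have t: "?t x \<in> carrier A" if "x \<in> NT" for x
          using lift_closed[OF f'(1) w that] by (simp add: A.emb_closed)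
        have bij: "bij_betw (\<lambda>n. n \<otimes> g) (N \<inter> NT) {x \<in> NT. x \<otimes> inv g \<in> N}"
          using g by (intro bij_betw_byWitness[where f' = "\<lambda>x. x \<otimes> inv g"])
            (auto simp: NT_mult NT_inv NT_carrier N_carrier m_assoc)
        have "(\<Oplus>\<^bsub>BA.S\<^esub>n\<in>N \<inter> NT. ?s n) \<chi> = (\<Oplus>\<^bsub>A\<^esub>n\<in>N \<inter> NT. ?s n \<chi>)"
          using \<chi> by (intro BA.S.finsum_eval s) (auto simp: TG_carrier)
        also have "\<dots> = (\<Oplus>\<^bsub>A\<^esub>n\<in>N \<inter> NT. ?t (n \<otimes> g))"
        proof (rule A.A.finsum_cong'[OF refl])
          fix n assume n: "n \<in> N \<inter> NT"
          have "?w \<otimes> inv (n \<otimes> g) = v \<otimes> inv n" "n \<otimes> g \<otimes> inv g = n"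
            using n by (simp_all add: group_word NT_carrier)
          then show "?s n \<chi> = ?t (n \<otimes> g)"
            using n \<chi> v fn[OF n] by (simp add: BA.mult_emb_S_app c_mult_TG NT_inv)
        qed (use t g in \<open>auto simp: NT_mult\<close>)
        also have "\<dots> = (\<Oplus>\<^bsub>A\<^esub>x\<in>{x \<in> NT. x \<otimes> inv g \<in> N}. ?t x)"
          by (rule A.A.finsum_bij[OF bij, where f = ?t]) (use t in blast)
        also have "\<dots> = (\<Oplus>\<^bsub>A\<^esub>x\<in>NT. ?t x)"
          using t by (intro A.A.add.finprod_mono_neutral_cong_left TQ.finite_H) auto
        also have "\<dots> = TE.coord_class g (\<Phi> f' (c ?w))"
          by (rule coord_\<Phi>[OF f'(1) w NT_Y[OF g], symmetric])
        also have "\<dots> \<in> BA.kernel (c (?w \<otimes> inv g))"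
          using \<Phi> w by (intro coord_kernel g) (auto simp: c_in_T)
        also have "?w \<otimes> inv g = v" by (simp add: group_word)
        finally show ?thesis using v by simp
      qed
      then show ?thesis
        using closed BA.J.cls_zero_iff[OF closed] by (simp add: BA.J_iff Brauer_quot_def)
    qed
    finally show ?thesis .
  qed
  then show ?thesis using f by (subst TQ.balancing_eq) blast
qed

text \<open>
  The component at \<open>c w\<close> of an element \<open>s\<close> is the sum of the \<open>coord_class x (s (c w)) \<otimes> x\<close> over a
  transversal in \<open>NT\<close>. The coefficient of \<open>x\<close> lies in the component \<open>c (w x\<^sup>-\<^sup>1)\<close> for \<open>A\<close>, by \<open>coord_fixed\<close>.
\<close>

lemma \<Theta>_surjective: "\<Theta> ` carrier TQ.F = carrier QE"
proof (intro equalityI subsetI)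
  fix q assume "q \<in> carrier QE"
  then obtain s where s: "s \<in> carrier BE.S" "q = BE.J.cls s"
    unfolding Brauer_quot_def by (rule BE.J.quot_carrierE)
  \<comment> \<open>One representative \<open>x\<close> of each coset carries the coordinates of the components of \<open>s\<close>.\<close>
  define f where "f x = (\<lambda>\<psi>\<in>T. if TQ.rep x = x then TE.coord_class x (s (\<psi> \<otimes>\<^bsub>TG\<^esub> c x)) else \<zero>\<^bsub>A\<^esub>)" for x
  have f: "f \<in> NT \<rightarrow> carrier BA.S"
  proof
    fix x assume x: "x \<in> NT"
    have "TE.coord_class x (s (\<psi> \<otimes>\<^bsub>TG\<^esub> c x)) \<in> BA.fixed \<psi>" if \<psi>: "\<psi> \<in> T" for \<psi>
    proof -
      obtain v where v: "v \<in> NT" "\<psi> = c v" using \<psi> by (rule TE)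
      have "v \<otimes> x \<otimes> inv x = v" using v x by (simp add: m_assoc NT_carrier)
      then show ?thesis
        using coord_fixed[OF NT_mult[OF v(1) x] x BE.S_fixed[OF s(1) c_in_T[OF NT_mult[OF v(1) x]]]] v x
        by (simp add: c_mult_TG)
    qed
    then show "f x \<in> carrier BA.S"
      using BA.S.C_zero by (auto simp: f_def BA.S_carrier TG_carrier)
  qed
  have "\<Phi> f = s"
  proof (rule BE.S_eqI[OF \<Phi>_closed[OF f] s(1)])
    fix \<phi> assume "\<phi> \<in> T"
    then obtain w where w: "w \<in> NT" "\<phi> = c w" by (rule TE)
    have sw: "s (c w) \<in> carrier E" using s(1) w by (simp add: c_in_T)
    have fx: "f x (c (w \<otimes> inv x)) = (if TQ.rep x = x then TE.coord_class x (s (c w)) else \<zero>\<^bsub>A\<^esub>)"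
      if "x \<in> NT" for x
    proof -
      have "w \<otimes> inv x \<otimes> x = w" using w that by (simp add: m_assoc NT_carrier)
      then show ?thesis using that w by (simp add: f_def c_in_T NT_mult NT_inv c_mult_TG)
    qed
    have "TE.coord_class g (\<Phi> f (c w)) = TE.coord_class g (s (c w))" if g: "g \<in> Y" for g
    proof -
      obtain n y where y: "n \<in> N" "y \<in> NT" "g = n \<otimes> y" using g by (rule Y_coset)
      let ?x = "TQ.rep y"
      have x: "?x \<in> NT" "TQ.rep ?x = ?x" using y by (auto intro: TQ.rep_H TQ.rep_rep)
      note [simp] = NT_carrier[OF x(1)] NT_carrier[OF y(2)] N_carrier[OF y(1)]
      have "inv (y \<otimes> inv ?x) \<otimes> inv n \<in> N" using TQ.rep_M[OF y(2)] y(1) N_simps(2,3) by blast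
      then have xg: "?x \<otimes> inv g \<in> N" using y by (simp add: group_word)
      have only: "x' = ?x" if x': "x' \<in> NT" "TQ.rep x' = x'" "x' \<otimes> inv g \<in> N" for x'
      proof -
        have "x' \<otimes> inv g \<otimes> n \<in> N" using x'(3) y(1) by (rule N_simps(2))
        then have "x' \<otimes> inv y \<in> N \<inter> NT"
          using x' y by (simp add: group_word NT_carrier NT_mult NT_inv)
        then have "TQ.rep (x' \<otimes> inv y \<otimes> y) = TQ.rep y" using y by (intro TQ.rep_shift)
        then show ?thesis using x' by (simp add: m_assoc NT_carrier)
      qed
      let ?t = "\<lambda>x. if x \<otimes> inv g \<in> N then f x (c (w \<otimes> inv x)) \<otimes>\<^bsub>A\<^esub> emb A (x \<otimes> inv g) else \<zero>\<^bsub>A\<^esub>"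
      have cl: "TE.coord_class x (s (c w)) \<in> carrier A" if "x \<in> Y" for x
        by (rule additive_map_closed[OF TE.additive_coord_class[OF that] sw])
      have "TE.coord_class g (\<Phi> f (c w)) = (\<Oplus>\<^bsub>A\<^esub>x\<in>NT. ?t x)"
        by (rule coord_\<Phi>[OF f w(1) g])
      also have "\<dots> = ?t ?x"
      proof (rule A.A.finsum_eq_single[OF TQ.finite_H x(1)])
        show "?t ?x \<in> carrier A"
          using cl[OF NT_Y[OF x(1)]] x xg by (simp add: fx A.emb_closed)
        show "?t x' = \<zero>\<^bsub>A\<^esub>" if "x' \<in> NT" "x' \<noteq> ?x" for x'
          using only[of x'] that by (auto simp: fx A.emb_closed)
      qed
      also have "\<dots> = TE.coord_class ?x (s (c w)) \<otimes>\<^bsub>A\<^esub> emb A (?x \<otimes> inv g)"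
        using x xg by (simp add: fx)
      also have "\<dots> = TE.coord_class g (s (c w))"
      proof -
        have "?x \<otimes> inv g \<otimes> g = ?x" using TE.H_carrier[OF g] by (simp add: m_assoc)
        then show ?thesis using TE.coord_class_shift[OF g xg sw] by simp
      qed
      finally show ?thesis .
    qed
    then have "\<Phi> f (c w) = s (c w)"
      using BE.S_closed[OF \<Phi>_closed[OF f] c_in_T[OF w(1)]] sw by (intro TE.AH_eqI)
    then show "\<Phi> f \<phi> = s \<phi>" using w by simp
  qed
  then have "q = \<Theta> (\<lambda>x\<in>NT. BA.J.cls (f x))" using \<Theta>_cls[OF f] s by simp
  moreover have "(\<lambda>x\<in>NT. BA.J.cls (f x)) \<in> carrier TQ.F"
    unfolding TQ.F_carrier using f by (auto simp: Brauer_quot_def BA.J.quot_carrier)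
  ultimately show "q \<in> \<Theta> ` carrier TQ.F" by blast
qed (use interior_homD(1)[OF \<Theta>_hom] in blast)

lemma Brauer_quot_tensor: "isomorphic_interior_algebras K G NT NP QE (tensor_over_group G QA (N \<inter> NT) NT)"
  unfolding tensor_over_group_def
proof (rule isomorphic_to_quotient[OF TQ.balancing.int_alg_ideal_axioms interior_QE \<Theta>_hom \<Theta>_surjective])
  show "\<Theta> f = \<zero>\<^bsub>QE\<^esub> \<longleftrightarrow> f \<in> balancing G QA (N \<inter> NT) NT" if "f \<in> carrier TQ.F" for f
    using \<Theta>_injective[OF that] TQ.extend_balancing[OF interior_QE \<iota>Q_hom] by (auto simp: \<Theta>_def)
qed

end

theorem proposition3p3:
  fixes K :: "'k ring" and G :: "'g monoid" and A :: "('k, 'a, 'g) interior_alg"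
    and N P :: "'g set" and T :: "('g \<Rightarrow> 'g) set"
    and E :: "('k, ('g \<Rightarrow> 'a) set, 'g) interior_alg" and p :: nat
  assumes "Factorial_Ring.prime p"
    and "algebraically_closed K" and "[p] \<cdot>\<^bsub>K\<^esub> \<one>\<^bsub>K\<^esub> = \<zero>\<^bsub>K\<^esub>"
    and "group G" and "finite (carrier G)" and "N \<lhd> G"
    and "subgroup P G" and "\<exists>n. card P = p ^ n"
    and "interior_algebra K G N (carrier G) A" and "fin_gen_module K A"
    and "T = {\<phi> \<in> Aut_by G P. \<forall>u\<in>P. \<phi> u \<otimes>\<^bsub>G\<^esub> inv\<^bsub>G\<^esub> u \<in> N}"
    and "E = tensor_over_group G A N (normalizer_T G P T <#>\<^bsub>G\<^esub> N)"
  shows "isomorphic_interior_algebras K G (normalizer_T G P T) (normalizer G P)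
    (Brauer_quot G E P T)
    (tensor_over_group G (Brauer_quot G A P T) (N \<inter> normalizer_T G P T) (normalizer_T G P T))"
proof -
  interpret G: group G by fact
  interpret brauer_tensor G N P T K A
    by (intro brauer_tensor.intro brauer_group.intro brauer_group_axioms.intro G.int_algI assms)
  show ?thesis
    using Brauer_quot_tensor by (simp only: assms(12) tensor_over_group_def[of G A])
qed

end
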